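(* Set $w:=W(2n/\pi)$. For each integer $K\ge 1$, as $n\to\infty$, $$\gamma(n)=4\pi^2 e^{7w/4}\sqrt{\frac{w}{w+1}}\left(\frac{e\,w^2}{16\,n\,e^{2/w}}\right)^n\left(1+\sum_{k=1}^{K-1}\frac{c_k(w)}{n^k}+O\!\left(\frac{\log^K(n)}{n^K}\right)\right),$$ with an implied constant depending only on $K$. Each $c_k(w)$ is a rational function of $w$ (defined below) of size $O(\log^k(n))$.
   Context: $\xi(s):=\tfrac12 s(s-1)\pi^{-s/2}\Gamma(s/2)\zeta(s)$ and $\gamma(m):=\frac{m!}{(2m)!}\xi^{(2m)}(1/2)$. $W$ is the Lambert function, the inverse of $x\mapsto xe^x$ on $[0,\infty)$. Partial ordinary Bell polynomials $\hat B_{i,j}$ are defined by $(p_1x+p_2x^2+\cdots)^j=\sum_{i\ge j}\hat B_{i,j}(p_1,p_2,\dots)x^i$ (so $\hat B_{i,0}=\delta_{i,0}$). For $u>0$ let $\ell_i(u):=\sum_{j=1}^i \hat B_{i,j}(1,-\tfrac12,\tfrac13,-\tfrac14,\dots)\frac{(-1)^{j+1}}{j\,u^j}$ (the Taylor coefficients of $\log(1+\log(1+x)/u)$). For real $\beta$ and integer $r\ge0$ put $$a^{(\beta)}_r(v):=\sum_{j=0}^{2r}\frac{(2j+2r-1)!!}{j!}\left(\frac{v^2}{v+1}\right)^{j+r}\sum_{i=j}^{2r}\hat B_{i,j}(\ell_3(v),\ell_4(v),\dots)\binom{\beta}{2r-i},$$ with $(-1)!!=1$, generalized binomial coefficients,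 and $a^{(\beta)}_{-1}:=0$. Let $\mu_r(w):=2^{-r-1}\big(2a^{(5/4)}_r(w)-3w\,a^{(1/4)}_{r-1}(w)\big)$ (so $\mu_0=1$). Let $\kappa_m$ be the Stirling coefficients, i.e. $\Gamma(n+1)\sim\sqrt{2\pi n}(n/e)^n\sum_{m\ge0}\kappa_m n^{-m}$ with $\kappa_0=1$. Set $\kappa^*_k:=\sum_{j=0}^k(-2)^{-j}\kappa_j\kappa_{k-j}$ and $c_k(w):=\sum_{j=0}^k\mu_j(w)\kappa^*_{k-j}$. *)

theory Defs
  imports "HOL-Analysis.Analysis" "HOL-Library.Landau_Symbols"
begin

text \<open>
  The value at the pole \<open>s = 1\<close> is fixed to \<open>0\<close> only so that the description has a unique
  solution.
\<close>
definition riemann_zeta :: "complex \<Rightarrow> complex" where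
  "riemann_zeta = (THE f. f holomorphic_on (- {1}) \<and> f 1 = 0 \<and>
     (\<forall>s. Re s > 1 \<longrightarrow> (\<lambda>n. 1 / of_nat (Suc n) powr s) sums f s))"

text \<open>
  At the removable singularities \<open>s = 0, 1, -2, -4, \<dots>\<close> of the right-hand side this takes the
  value \<open>0\<close> rather than the limit; \<open>gamma_coeff\<close> only uses the function near \<open>1/2\<close>.
\<close>
definition riemann_xi :: "complex \<Rightarrow> complex" where
  "riemann_xi s = 1/2 * s * (s - 1) * complex_of_real pi powr (- s / 2) * Gamma (s / 2)
     * riemann_zeta s"

definition gamma_coeff :: "nat \<Rightarrow> complex" where
  "gamma_coeff m = fact m / fact (2 * m) * (deriv ^^ (2 * m)) riemann_xi (1/2)"

definition Lambert_W :: "real \<Rightarrow> real" where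
  "Lambert_W = the_inv_into {0..} (\<lambda>x. x * exp x)"

text \<open>
  The sequence \<open>p\<close> is indexed from \<open>1\<close>; the value \<open>p 0\<close> is ignored.
\<close>
definition ord_bell :: "nat \<Rightarrow> nat \<Rightarrow> (nat \<Rightarrow> real) \<Rightarrow> real" where
  "ord_bell i j p = fps_nth (Abs_fps (\<lambda>k. if k = 0 then 0 else p k) ^ j) i"

definition ell :: "nat \<Rightarrow> real \<Rightarrow> real" where
  "ell i u = (\<Sum>j=1..i. ord_bell i j (\<lambda>k. (-1) ^ (k + 1) / real k)
     * ((-1) ^ (j + 1) / (real j * u ^ j)))"

text \<open>\<open>odd_dfact m\<close> is \<open>(2m - 1)!!\<close>; the empty product is the convention \<open>(-1)!! = 1\<close>.\<close>
definition odd_dfact :: "nat \<Rightarrow> nat" where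
  "odd_dfact m = (\<Prod>i<m. 2 * i + 1)"

definition a_coeff :: "real \<Rightarrow> nat \<Rightarrow> real \<Rightarrow> real" where
  "a_coeff \<beta> r v = (\<Sum>j=0..2*r. real (odd_dfact (j + r)) / fact j
     * (v\<^sup>2 / (v + 1)) ^ (j + r)
     * (\<Sum>i=j..2*r. ord_bell i j (\<lambda>k. ell (k + 2) v) * (\<beta> gchoose (2 * r - i))))"

text \<open>The case split is the convention that \<open>a_coeff\<close> vanishes at index \<open>-1\<close>.\<close>
definition mu_coeff :: "nat \<Rightarrow> real \<Rightarrow> real" where
  "mu_coeff r w = (2 * a_coeff (5/4) r w
     - 3 * w * (if r = 0 then 0 else a_coeff (1/4) (r - 1) w)) / 2 ^ (r + 1)"

definition stirling_kappa :: "nat \<Rightarrow> real" where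
  "stirling_kappa = (THE \<kappa>. \<kappa> 0 = 1 \<and>
     (\<forall>M. (\<lambda>n::nat. Gamma (real n + 1) / (sqrt (2 * pi * real n) * (real n / exp 1) ^ n)
              - (\<Sum>m<M. \<kappa> m / real n ^ m)) \<in> O(\<lambda>n. 1 / real n ^ M)))"

definition kappa_star :: "nat \<Rightarrow> real" where
  "kappa_star k = (\<Sum>j=0..k. stirling_kappa j * stirling_kappa (k - j) / (-2) ^ j)"

definition c_coeff :: "nat \<Rightarrow> real \<Rightarrow> real" where
  "c_coeff k w = (\<Sum>j=0..k. mu_coeff j w * kappa_star (k - j))"

end

theory Submission
  imports Defs "HOL-Complex_Analysis.Complex_Analysis" "HOL-Real_Asymp.Real_Asymp" "HOL-Probability.Probability"
begin

text \<open>
  With \<open>\<Phi>(x) = \<Sum>\<^sub>k (2 \<pi>\<^sup>2 k\<^sup>4 x\<^sup>2 - 3 \<pi> k\<^sup>2 x) exp (- \<pi> k\<^sup>2 x)\<close>, integrating termwise gives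
  \<open>\<xi>(s)\<close> as the Mellin transform of \<open>\<Phi>\<close> at \<open>s / 2\<close> for \<open>s > 1\<close>. Differentiating the theta inversion
  twice gives \<open>\<Phi>(1/x) = \<surd>x \<Phi>(x)\<close>, which folds the integral onto \<open>x \<ge> 1\<close> as twice the integral of
  \<open>x powr (-3/4) \<Phi>(x) cosh (((s - 1/2) / 2) ln x)\<close>. Expanding \<open>cosh\<close> shows that \<open>\<xi>\<close> is entire (which also
  yields the continuation of zeta) and that \<open>\<gamma>(n)\<close> is \<open>n!/(2n)! 2 4\<^sup>-\<^sup>n\<close> times the moment of order \<open>2n\<close> of
  \<open>ln x\<close>. Only the term \<open>k = 1\<close> matters, and it is treated by Laplace's method around \<open>x = exp w\<close>: for
  \<open>x = exp w (1 + \<sigma> y)\<close> the integrand is a Gaussian in \<open>y\<close> times an analytic function of \<open>\<sigma> y\<close> and \<open>y\<^sup>2\<close>,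
  whose Taylor remainders are controlled uniformly in \<open>w \<ge> 1\<close> by Cauchy's inequality. The factor
  \<open>n!/(2n)!\<close> is expanded by Stirling's series, whose reciprocal is the same series in \<open>- 1/n\<close>.
\<close>

section \<open>Stirling's series\<close>

text \<open>The centre \<open>exp w\<close> maximises \<open>ln x ^ (2 * n) * exp (- pi * x)\<close>
  alone: the critical equation x ln x = 2 n / pi is the one that Lambert's function solves. The
  power of x stays in the amplitude, where it produces the binomial coefficients of
  \<open>a_coeff\<close>. The term k = 1 contains x^2 and x, which together with
  \<open>x powr (-3/4)\<close> explains the exponents 5/4 and 1/4. Their peak values differ by exp
  (- w) = pi w / (2 n), so the second moment enters one order later and with a factor w; this is the
  shape of \<open>mu_coeff\<close>. The obstacle is that the integrand is not a fixed function: w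
  moves with n, and the coefficients may grow with w. The estimates therefore have constants free of
  w and n and are measured by the true large parameter 2 n / w = pi exp w. They assume only the
  relation 2 n = pi w exp w; Lambert's function is substituted at the end. Zeta and the Stirling
  coefficients are given by definite descriptions, so both must be constructed and shown unique
  before anything can be said about them.\<close>

lemma bigo_sequentially_cong:
  fixes f g :: "nat \<Rightarrow> real"
  assumes "f \<in> O(g)" "\<And>n. n > 0 \<Longrightarrow> f n = f' n" "\<And>n. n > 0 \<Longrightarrow> g n = g' n"
  shows "f' \<in> O(g')"
proof -
  have "eventually (\<lambda>n. f n = f' n) sequentially" "eventually (\<lambda>n. g n = g' n) sequentially"
    using assms(2,3) by (auto intro: eventually_mono[OF eventually_gt_at_top[of 0]])
  then show ?thesis using assms(1) landau_o.big.in_cong[of f f' sequentially g] landau_o.big.cong[of g g' sequentially]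
    by simp
qed

text \<open>Lets a real function be expanded by restricting a holomorphic one: on the real axis real
  parts can be taken term by term, so the real parts of the coefficients serve.\<close>

lemma has_fps_expansion_Re:
  fixes F :: "complex fps"
  assumes "f has_fps_expansion F"
  shows "(\<lambda>x::real. Re (f (of_real x))) has_fps_expansion Abs_fps (\<lambda>n. Re (fps_nth F n))"
proof (rule has_fps_expansionI)
  have ev: "eventually (\<lambda>z. eval_fps F z = f z) (nhds 0)" and r: "fps_conv_radius F > 0"
    using assms by (auto simp: has_fps_expansion_def)
  have ev2: "eventually (\<lambda>z. z \<in> eball 0 (fps_conv_radius F)) (nhds (0::complex))"
    using r by (intro eventually_nhds_in_open) (auto simp: zero_ereal_def)
  have "eventually (\<lambda>z. (\<lambda>n. fps_nth F n * z ^ n) sums f z) (nhds (0::complex))"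
    using ev ev2
  proof eventually_elim
    case (elim z)
    then show ?case using sums_eval_fps[of z F] by auto
  qed
  moreover have "filterlim (\<lambda>x::real. complex_of_real x) (nhds 0) (nhds 0)"
    using tendsto_of_real[of "\<lambda>x::real. x" 0 "nhds 0"] by (simp add: filterlim_ident)
  ultimately have "eventually (\<lambda>x::real. (\<lambda>n. fps_nth F n * (of_real x) ^ n) sums f (of_real x)) (nhds 0)"
    by (rule eventually_compose_filterlim)
  then show "\<forall>\<^sub>F u in nhds 0. (\<lambda>n. Abs_fps (\<lambda>n. Re (fps_nth F n)) $ n * u ^ n) sums Re (f (of_real u))"
  proof eventually_elim
    case (elim x)
    then have "(\<lambda>n. Re (fps_nth F n * (of_real x) ^ n)) sums Re (f (of_real x))"
      by (rule sums_Re)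
    moreover have "Re (fps_nth F n * (of_real x) ^ n) = Re (fps_nth F n) * x ^ n" for n
      by (simp flip: of_real_power)
    ultimately show ?case by simp
  qed
qed

lemma has_fps_expansion_Ln_complex: "(\<lambda>z::complex. Ln (1 + z)) has_fps_expansion fps_ln 1"
proof (rule has_fps_expansionI)
  have "eventually (\<lambda>z::complex. z \<in> ball 0 1) (nhds 0)"
    by (intro eventually_nhds_in_open) auto
  then show "\<forall>\<^sub>F u in nhds (0::complex). (\<lambda>n. fps_ln 1 $ n * u ^ n) sums Ln (1 + u)"
  proof eventually_elim
    case (elim z)
    then have "(\<lambda>n. (- 1) ^ Suc n / of_nat n * z ^ n) sums Ln (1 + z)"
      using Ln_series[of z] by simp
    moreover have "(\<lambda>n. (- 1) ^ Suc n / of_nat n * z ^ n) = (\<lambda>n. fps_ln 1 $ n * z ^ n)"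
    proof
      fix n show "(- 1) ^ Suc n / of_nat n * z ^ n = fps_ln 1 $ n * z ^ n"
        by (cases n) (auto simp: fps_ln_nth)
    qed
    ultimately show ?case by simp
  qed
qed

text \<open>Division by \<open>x ^ m\<close> leaves a function with a power series, hence continuous
  and so bounded near 0. The zero series is separate because its subdegree is 0 by
  convention.\<close>

lemma has_fps_expansion_bound:
  fixes f :: "real \<Rightarrow> real"
  assumes F: "f has_fps_expansion F" and 0: "\<And>k. k < m \<Longrightarrow> fps_nth F k = 0"
  shows "\<exists>C d. d > 0 \<and> (\<forall>x. \<bar>x\<bar> < d \<longrightarrow> \<bar>f x\<bar> \<le> C * \<bar>x\<bar> ^ m)"
proof (cases "F = 0")
  case True
  then have "eventually (\<lambda>x. f x = 0) (nhds 0)" using F by (simp add: has_fps_expansion_0_iff)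
  then obtain d where "d > 0" "\<forall>x. dist x 0 < d \<longrightarrow> f x = 0" unfolding eventually_nhds_metric by blast
  then show ?thesis by (intro exI[of _ 0] exI[of _ d]) auto
next
  case False
  then have m: "m \<le> subdegree F" using 0 by (simp add: subdegree_geI)
  define g where "g = (\<lambda>x. if x = 0 then fps_nth F m else f x / x ^ m)"
  have "g has_fps_expansion fps_shift m F"
    unfolding g_def by (rule has_fps_expansion_shift[OF F m refl])
  then have "isCont g 0" by (rule has_fps_expansion_imp_continuous)
  then have "eventually (\<lambda>x. dist (g x) (g 0) < 1) (nhds 0)"
    by (metis (no_types, lifting) continuous_at_eps_delta dist_commute eventually_nhds_metric zero_less_one)
  then obtain d where d: "d > 0" "\<And>x. dist x 0 < d \<Longrightarrow> dist (g x) (g 0) < 1" unfolding eventually_nhds_metric by blast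
  have f0: "f 0 = fps_nth F 0" using has_fps_expansion_imp_0_eq_fps_nth_0[OF F] .
  have "\<bar>f x\<bar> \<le> (\<bar>g 0\<bar> + 1) * \<bar>x\<bar> ^ m" if x: "\<bar>x\<bar> < d" for x
  proof -
    have "\<bar>g x\<bar> \<le> \<bar>g 0\<bar> + 1" using d(2)[of x] x unfolding dist_real_def by linarith
    moreover have "f x = g x * x ^ m"
      by (cases "x = 0") (use f0 0[of 0] in \<open>auto simp: g_def zero_power2 power_0_left\<close>)
    ultimately show ?thesis by (simp add: abs_mult power_abs mult_right_mono)
  qed
  then show ?thesis using d(1) by blast
qed

section \<open>Factorials compared with Stirling's formula\<close>

definition stirling_ratio :: "nat \<Rightarrow> real" where
  "stirling_ratio n = Gamma (real n + 1) / (sqrt (2 * pi * real n) * (real n / exp 1) ^ n)"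

text \<open>At \<open>1 / n\<close> this is the quotient of consecutive values of
  \<open>stirling_ratio\<close>. The case split fills the removable singularity of the exponent, so
  that the function is analytic at 0.\<close>

definition stirling_step :: "real \<Rightarrow> real" where
  "stirling_step x = exp (- (if x = 0 then 0 else (1 / x + 1 / 2) * ln (1 + x) - 1))"

text \<open>The summand 1/2 in the exponent cancels the linear term: (1/x + 1/2) ln (1 + x) - 1
  begins with x^2 / 12. The vanishing linear coefficient is the solvability condition of the
  recursion for the Stirling coefficients at its first order.\<close>

lemma stirling_step_fps:
  obtains E where "stirling_step has_fps_expansion E" "fps_nth E 0 = 1" "fps_nth E 1 = 0"
proof -
  define H :: "complex fps" where "H = fps_const (1/2) * fps_ln 1 + fps_shift 1 (fps_ln 1) - 1"
  define h where "h = (\<lambda>z::complex. 1/2 * Ln (1 + z) + (if z = 0 then 1 else Ln (1 + z) / z ^ 1) - 1)"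
  have sd: "1 \<le> subdegree (fps_ln (1::complex))"
    by (rule subdegree_geI) (auto simp: fps_ln_nth fps_eq_iff intro: exI[of _ 1])
  have h: "h has_fps_expansion H"
    unfolding h_def H_def
    by (intro fps_expansion_intros has_fps_expansion_Ln_complex sd) (auto simp: fps_ln_nth)
  have H0: "fps_nth H 0 = 0" "fps_nth H 1 = 0" by (auto simp: H_def fps_ln_nth)
  have "((\<lambda>z. exp ((-1) * z)) \<circ> h) has_fps_expansion (fps_exp (-1) oo H)"
    by (intro fps_expansion_intros h H0)
  from has_fps_expansion_Re[OF this]
  have 1: "(\<lambda>x::real. Re (exp (- h (of_real x)))) has_fps_expansion Abs_fps (\<lambda>n. Re ((fps_exp (-1) oo H) $ n))"
    by (simp add: o_def)
  have ev: "eventually (\<lambda>x::real. Re (exp (- h (of_real x))) = stirling_step x) (nhds 0)"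
  proof -
    have "eventually (\<lambda>x::real. x \<in> {-1<..<1}) (nhds 0)"
      by (intro eventually_nhds_in_open) auto
    then show ?thesis
    proof eventually_elim
      case (elim x)
      have L: "Ln (1 + complex_of_real x) = of_real (ln (1 + x))"
        using Ln_of_real[of "1 + x"] elim by simp
      have "h (of_real x) = of_real (if x = 0 then 0 else (1 / x + 1 / 2) * ln (1 + x) - 1)"
        unfolding h_def L by (auto simp: field_simps)
      then have "exp (- h (of_real x)) = of_real (stirling_step x)"
        unfolding stirling_step_def by (metis exp_of_real of_real_minus)
      then show ?case by simp
    qed
  qed
  have 2: "stirling_step has_fps_expansion Abs_fps (\<lambda>n. Re ((fps_exp (-1) oo H) $ n))"
    using 1 has_fps_expansion_cong[OF ev refl] by blast
  show ?thesis
    by (rule that[OF 2]) (use H0 in \<open>auto simp: fps_compose_nth\<close>)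
qed

lemma stirling_ratio_pos: "n > 0 \<Longrightarrow> stirling_ratio n > 0"
  unfolding stirling_ratio_def by (intro divide_pos_pos mult_pos_pos Gamma_real_pos) auto

lemma stirling_ratio_Suc:
  assumes "n > 0"
  shows "stirling_ratio (Suc n) = stirling_ratio n * stirling_step (1 / real n)"
proof -
  define x where "x = real n"
  have x: "x > 0" using assms by (simp add: x_def)
  have G: "Gamma (x + 2) = (x + 1) * Gamma (x + 1)"
    using Gamma_plus1[of "x + 1"] x nonpos_Ints_nonpos[of "x + 1"] by (fastforce simp: add_ac)
  have pow: "(y / exp 1) ^ k = exp (real k * (ln y - 1))" if "y > 0" for y k
  proof -
    have "y / exp 1 = exp (ln y - 1)" using that by (simp add: exp_diff)
    then show ?thesis by (simp add: exp_of_nat_mult)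
  qed
  have sq: "sqrt (2 * pi * y) = sqrt (2 * pi) * exp (ln y / 2)" if "y > 0" for y
    using that by (simp add: real_sqrt_mult ln_sqrt[symmetric])
  have "1 + 1 / x = (1 + x) / x" using x by (simp add: field_simps)
  then have ln1: "ln (1 + 1 / x) = ln (1 + x) - ln x"
    using x by (simp add: ln_div)
  have step: "stirling_step (1 / x) = exp (1 - (x + 1/2) * (ln (1 + x) - ln x))"
    unfolding stirling_step_def using x ln1 by simp
  have "stirling_ratio (Suc n) = (x + 1) * Gamma (x + 1) /
     (sqrt (2 * pi) * exp (ln (1 + x) / 2) * exp ((x + 1) * (ln (1 + x) - 1)))"
    unfolding stirling_ratio_def using x pow[of "1 + x" "Suc n"] sq[of "1 + x"]
    by (simp add: x_def[symmetric] G add_ac)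
  also have "\<dots> = Gamma (x + 1) / sqrt (2 * pi) *
      exp (ln (1 + x) - ln (1 + x) / 2 - (x + 1) * (ln (1 + x) - 1))"
  proof -
    have "exp (ln (1 + x) - ln (1 + x) / 2 - (x + 1) * (ln (1 + x) - 1)) =
      (x + 1) / exp (ln (1 + x) / 2) / exp ((x + 1) * (ln (1 + x) - 1))"
      using x by (subst exp_diff, subst exp_diff) simp
    moreover have "y * G / (s * a * b) = G / s * (y / a / b)" for G s a b y :: real by (simp add: mult_ac)
    ultimately show ?thesis by (simp only:)
  qed
  also have "ln (1 + x) - ln (1 + x) / 2 - (x + 1) * (ln (1 + x) - 1) =
     (- ln x / 2 - x * (ln x - 1)) + (1 - (x + 1/2) * (ln (1 + x) - ln x))"
    by (simp add: field_simps)
  also have "Gamma (x + 1) / sqrt (2 * pi) * exp \<dots> =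
     Gamma (x + 1) / (sqrt (2 * pi) * exp (ln x / 2) * exp (x * (ln x - 1))) * stirling_step (1 / x)"
  proof -
    have "exp (- ln x / 2 - x * (ln x - 1)) = 1 / exp (ln x / 2) / exp (x * (ln x - 1))"
      by (subst exp_diff) (simp add: exp_minus inverse_eq_divide)
    moreover have "G / s * (1 / a / b * c) = G / (s * a * b) * c" for G s a b c :: real by simp
    ultimately show ?thesis unfolding step exp_add by (simp only:)
  qed
  also have "Gamma (x + 1) / (sqrt (2 * pi) * exp (ln x / 2) * exp (x * (ln x - 1))) = stirling_ratio n"
    unfolding stirling_ratio_def using x pow[of x n] sq[of x] by (simp add: x_def[symmetric])
  finally show ?thesis by (simp add: x_def)
qed

text \<open>The powers of n / e cancel in the quotient, leaving the reciprocal of a central binomial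
  coefficient times elementary factors; its square is Wallis's product up to a rational
  factor.\<close>

lemma stirling_ratio_square:
  assumes "n > 0"
  shows "(stirling_ratio n ^ 2 / stirling_ratio (2 * n))\<^sup>2 =
     (\<Prod>k=1..n. (4*real k^2) / (4*real k^2 - 1)) * (2 * real n + 1) / (pi * real n)"
proof -
  have W: "(\<Prod>k=1..n. (4*real k^2) / (4*real k^2 - 1)) = (4 ^ n * fact n ^ 2) ^ 2 / (fact (2 * n) ^ 2 * (2 * real n + 1))" for n
  proof (induction n)
    case (Suc n)
    define y where "y = real n"
    have f1: "fact (Suc n) = (y + 1) * (fact n :: real)" by (simp add: y_def add_ac)
    have f2: "fact (2 * Suc n) = (2 * y + 2) * (2 * y + 1) * (fact (2 * n) :: real)"
      by (simp add: y_def algebra_simps)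
    have nz: "2 * y + 1 \<noteq> 0" "2 * y + 2 \<noteq> 0" "2 * y + 3 \<noteq> 0" "y + 1 \<noteq> 0" "y \<ge> 0" by (auto simp: y_def)
    have d: "4 * (y+1)^2 - 1 = (2 * y + 1) * (2 * y + 3)" by (simp add: power2_eq_square algebra_simps)
    have e: "(2 * y + 2) = 2 * (y+1)" by simp
    have "(\<Prod>k=1..Suc n. (4*real k^2) / (4*real k^2 - 1)) =
       (4 ^ n * fact n ^ 2) ^ 2 / (fact (2 * n) ^ 2 * (2 * y + 1)) * ((4 * (y+1)^2) / (4 * (y+1)^2 - 1))"
      using Suc by (simp add: y_def add_ac)
    also have "\<dots> = (4 ^ Suc n * fact (Suc n) ^ 2) ^ 2 / (fact (2 * Suc n) ^ 2 * (2 * y + 3))"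
    proof -
      have "(P * F\<^sup>2)\<^sup>2 / (D\<^sup>2 * b) * (4 * a\<^sup>2 / (b * c)) = (4 * P * (a * F)\<^sup>2)\<^sup>2 / ((2 * a * b * D)\<^sup>2 * c)"
        if "a \<noteq> 0" "b \<noteq> 0" "c \<noteq> 0" "D \<noteq> 0" for P F D a b c :: real
        using that by (simp add: divide_simps) (simp add: power2_eq_square)
      from this[of "y + 1" "2 * y + 1" "2 * y + 3" "fact (2 * n)" "4 ^ n" "fact n"] nz show ?thesis
        unfolding f1 f2 d e by (simp add: mult_ac)
    qed
    finally show ?case by (simp add: y_def algebra_simps)
  qed simp
  define x where "x = real n"
  have x: "x > 0" using assms by (simp add: x_def)
  have G: "Gamma (x + 1) = fact n" "Gamma (2 * x + 1) = fact (2 * n)"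
    using Gamma_fact[of n, where 'a = real] Gamma_fact[of "2 * n", where 'a = real] by (simp_all add: x_def add_ac)
  have nz: "sqrt x ^ 2 = x" "sqrt (2*pi)^2 = 2 * pi" "sqrt (2*pi) > 0" "sqrt x > 0" "sqrt 2 ^ 2 = 2" using x by auto
  have s1: "sqrt (2 * pi * (2 * x)) = sqrt 2 * sqrt (2 * pi) * sqrt x"
    by (simp add: real_sqrt_mult)
  have s2: "sqrt (2 * pi * x) = sqrt (2 * pi) * sqrt x" by (simp add: real_sqrt_mult)
  have "stirling_ratio n ^ 2 / stirling_ratio (2 * n) =
     (fact n / (sqrt (2 * pi) * sqrt x * (x / exp 1) ^ n))^2 / (fact (2*n) / (sqrt 2 * sqrt (2 * pi) * sqrt x * (2 * x / exp 1)^(2*n)))"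
    unfolding stirling_ratio_def by (simp add: x_def[symmetric] G s2) (simp add: s1 real_sqrt_mult)
  also have "\<dots> = fact n ^ 2 * 4 ^ n / fact (2 * n) * (sqrt 2 / (sqrt (2 * pi) * sqrt x))"
  proof -
    have z: "(2 * z) ^ (2 * n) = 4 ^ n * (z ^ n)\<^sup>2" for z :: real
    proof -
      have "(2 * z) ^ (2 * n) = 2 ^ (2 * n) * z ^ (n * 2)" by (simp add: power_mult_distrib mult.commute)
      also have "\<dots> = 4 ^ n * (z ^ n)\<^sup>2" by (simp only: power_mult) simp
      finally show ?thesis .
    qed
    have "(F / (s * y * q))\<^sup>2 / (D / (t * s * y * (f * q\<^sup>2))) = F\<^sup>2 * f / D * (t / (s * y))"
      if "s > 0" "y > 0" "q > 0" for F s y q D t f :: real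
      using that by (simp add: divide_simps) (simp add: power2_eq_square)
    from this[of "sqrt (2 * pi)" "sqrt x" "(x / exp 1) ^ n" "fact n" "fact (2 * n)" "sqrt 2" "4 ^ n"]
    show ?thesis using x z[of "x / exp 1"] by simp
  qed
  also have "\<dots> ^ 2 = (4 ^ n * fact n ^ 2) ^ 2 / (fact (2 * n) ^ 2) * (1 / (pi * x))"
    using nz by (simp add: power_mult_distrib power_divide)
  moreover have "A / B * (1 / c) = A / (B * d) * d / c" if "d \<noteq> 0" for A B c d :: real
    using that by simp
  ultimately show ?thesis unfolding W by (simp add: x_def)
qed

text \<open>The logarithms have increments O(1/n^2), so a positive limit L exists. Then
  \<open>stirling_ratio n ^ 2 / stirling_ratio (2 * n)\<close> tends to L, while Wallis's product
  makes its square tend to 1.\<close>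

lemma stirling_ratio_tendsto_1: "stirling_ratio \<longlonglongrightarrow> 1"
proof -
  define g where "g = (\<lambda>n. - ((real n + 1 / 2) * ln (1 + 1 / real n) - 1))"
  have g: "stirling_step (1 / real n) = exp (g n)" if "n > 0" for n
    using that by (simp add: stirling_step_def g_def)
  have g_bigo: "g \<in> O(\<lambda>n. 1 / real n ^ 2)" unfolding g_def by real_asymp
  have "summable (\<lambda>n. 1 / real n ^ 2)"
    using inverse_power_summable[of 2, where 'a = real] by (simp add: divide_inverse)
  then have "summable (\<lambda>n. norm (1 / real n ^ 2))" by simp
  then have "summable g" by (rule summable_comparison_test_bigo[OF _ g_bigo])
  then have sg: "summable (\<lambda>n. g (Suc n))" using summable_Suc_iff by blast
  have ln: "ln (stirling_ratio (Suc n)) = ln (stirling_ratio 1) + (\<Sum>k<n. g (Suc k))" for n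
  proof (induction n)
    case (Suc n)
    have "ln (stirling_ratio (Suc (Suc n))) = ln (stirling_ratio (Suc n)) + g (Suc n)"
      using stirling_ratio_Suc[of "Suc n"] g[of "Suc n"] stirling_ratio_pos[of "Suc n"]
      by (simp add: ln_mult)
    then show ?case using Suc by simp
  qed simp
  define L where "L = exp (ln (stirling_ratio 1) + suminf (\<lambda>n. g (Suc n)))"
  have "(\<lambda>n. exp (ln (stirling_ratio (Suc n)))) \<longlonglongrightarrow> L"
    unfolding L_def ln by (intro tendsto_intros summable_LIMSEQ sg)
  then have "(\<lambda>n. stirling_ratio (Suc n)) \<longlonglongrightarrow> L"
    using stirling_ratio_pos by simp
  then have S: "stirling_ratio \<longlonglongrightarrow> L" using filterlim_sequentially_Suc by blast
  have Lp: "L > 0" by (simp add: L_def)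
  have S2: "(\<lambda>n. stirling_ratio (2 * n)) \<longlonglongrightarrow> L"
    using S by (rule filterlim_compose) (auto intro!: filterlim_subseq simp: strict_mono_def)
  have "(\<lambda>n. (stirling_ratio n ^ 2 / stirling_ratio (2 * n))\<^sup>2) \<longlonglongrightarrow> (L^2 / L)^2"
    using Lp by (intro tendsto_intros S S2) auto
  moreover have "(\<lambda>n. (stirling_ratio n ^ 2 / stirling_ratio (2 * n))\<^sup>2) \<longlonglongrightarrow> 1"
  proof -
    have "(\<lambda>n. (2 * real n + 1) / (pi * real n)) \<longlonglongrightarrow> 2 / pi"
      by (real_asymp simp: divide_inverse)
    from tendsto_mult[OF wallis this]
    have "(\<lambda>n. (\<Prod>k=1..n. (4*real k^2) / (4*real k^2 - 1)) * ((2 * real n + 1) / (pi * real n))) \<longlonglongrightarrow> 1" by simp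
    moreover have "eventually (\<lambda>n. (\<Prod>k=1..n. (4*real k^2) / (4*real k^2 - 1)) * ((2 * real n + 1) / (pi * real n)) = (stirling_ratio n ^ 2 / stirling_ratio (2 * n))\<^sup>2) sequentially"
      using eventually_gt_at_top[of 0] by eventually_elim (simp add: stirling_ratio_square)
    ultimately show ?thesis by (rule Lim_transform_eventually)
  qed
  ultimately have "(L^2 / L)^2 = 1" using LIMSEQ_unique by blast
  then have "L ^ 2 = 1" using Lp by (simp add: power2_eq_square)
  then have "L = 1" using Lp by (simp add: power2_eq_1_iff)
  then show ?thesis using S by simp
qed

text \<open>A sequence \<open>e\<close> of size \<open>1 / n ^ M\<close> is chosen whose decrements
  dominate the increments of \<open>D\<close>. Then \<open>D + e\<close> decreases and
  \<open>D - e\<close> increases, both to \<open>l\<close>, which traps \<open>D n - l\<close>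
  between \<open>- e n\<close> and \<open>e n\<close>.\<close>

lemma telescoping_bigo:
  fixes D :: "nat \<Rightarrow> real"
  assumes lim: "D \<longlonglongrightarrow> l" and M: "M > 0"
    and step: "(\<lambda>n. D (Suc n) - D n) \<in> O(\<lambda>n. 1 / real n ^ (M + 1))"
  shows "(\<lambda>n. D n - l) \<in> O(\<lambda>n. 1 / real n ^ M)"
proof -
  from step obtain C where C: "C > 0" "eventually (\<lambda>n. norm (D (Suc n) - D n) \<le> C * norm (1 / real n ^ (M + 1))) sequentially"
    by (rule landau_o.bigE)
  then obtain N where N: "\<And>n. n \<ge> N \<Longrightarrow> \<bar>D (Suc n) - D n\<bar> \<le> C / real n ^ (M + 1)"
    unfolding eventually_sequentially by auto
  define N' where "N' = Suc N"
  \<comment> \<open>As \<open>(n / (n + 1)) ^ M\<close> is at most \<open>n / (n + 1)\<close>, the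
    decrement of \<open>1 / n ^ M\<close> is at least \<open>1 / (n ^ M * (n + 1))\<close>; the
    factor 2 pays for replacing \<open>n + 1\<close> by \<open>n\<close>.\<close>
  have key: "1 / real n ^ (M + 1) \<le> 2 * (1 / real n ^ M - 1 / real (Suc n) ^ M)" if "n \<ge> N'" for n
  proof -
    have n: "n \<ge> 1" using that by (simp add: N'_def)
    have "(real n / real (Suc n)) ^ M \<le> (real n / real (Suc n)) ^ 1"
      using M by (intro power_decreasing) auto
    then have "1 / real (Suc n) \<le> 1 - (real n / real (Suc n)) ^ M"
      by (simp add: field_simps)
    then have "1 / real n ^ M * (1 / real (Suc n)) \<le> 1 / real n ^ M * (1 - (real n / real (Suc n)) ^ M)"
      by (intro mult_left_mono) auto
    also have "\<dots> = 1 / real n ^ M - 1 / real (Suc n) ^ M"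
      using n by (simp add: power_divide field_simps)
    finally have 1: "1 / real n ^ M * (1 / real (Suc n)) \<le> 1 / real n ^ M - 1 / real (Suc n) ^ M" .
    have "1 / real n ^ M * (1 / real n) \<le> 1 / real n ^ M * (2 * (1 / real (Suc n)))"
      using n by (intro mult_left_mono) (auto simp: field_simps)
    then show ?thesis using 1 by (simp add: mult_ac)
  qed
  define e where "e = (\<lambda>n. 2 * C * (1 / real n ^ M))"
  have diff: "\<bar>D (Suc n) - D n\<bar> \<le> e n - e (Suc n)" if "n \<ge> N'" for n
  proof -
    have "\<bar>D (Suc n) - D n\<bar> \<le> C * (1 / real n ^ (M + 1))" using N[of n] that by (simp add: N'_def)
    also have "\<dots> \<le> C * (2 * (1 / real n ^ M - 1 / real (Suc n) ^ M))"
      using key[OF that] C(1) by (intro mult_left_mono) auto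
    finally show ?thesis by (simp add: e_def algebra_simps)
  qed
  have e0: "e \<longlonglongrightarrow> 0"
  proof -
    have "(\<lambda>n. 2 * C * (1 / real n ^ M)) \<longlonglongrightarrow> 2 * C * 0"
      using M by (intro tendsto_intros) (use tendsto_inverse_0_at_top[OF filterlim_pow_at_top[OF M filterlim_real_sequentially]] in \<open>simp add: divide_inverse\<close>)
    then show ?thesis by (simp add: e_def)
  qed
  have "\<bar>D n - l\<bar> \<le> e n" if n: "n \<ge> N'" for n
  proof -
    have mono: "D (n + k) + e (n + k) \<le> D n + e n \<and> D n - e n \<le> D (n + k) - e (n + k)" for k
    proof (induction k)
      case (Suc k)
      have "\<bar>D (Suc (n + k)) - D (n + k)\<bar> \<le> e (n + k) - e (Suc (n + k))" using diff[of "n + k"] n by simp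
      then show ?case using Suc by (simp add: abs_le_iff)
    qed simp
    have sh: "(\<lambda>k. D (n + k)) \<longlonglongrightarrow> l" "(\<lambda>k. e (n + k)) \<longlonglongrightarrow> 0"
      using LIMSEQ_ignore_initial_segment[OF lim, of n] LIMSEQ_ignore_initial_segment[OF e0, of n] by (simp_all add: add.commute)
    have "l + 0 \<le> D n + e n"
      by (rule LIMSEQ_le_const2[OF tendsto_add[OF sh]]) (use mono in blast)
    moreover have "D n - e n \<le> l - 0"
      by (rule LIMSEQ_le_const[OF tendsto_diff[OF sh]]) (use mono in blast)
    ultimately show ?thesis by (simp add: abs_le_iff)
  qed
  then have "eventually (\<lambda>n. norm (D n - l) \<le> 2 * C * norm (1 / real n ^ M)) sequentially"
    unfolding eventually_sequentially by (intro exI[of _ N']) (auto simp: e_def)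
  then show ?thesis by (rule landau_o.bigI[rotated]) (use C in auto)
qed


text \<open>
  The recursion determines a formal solution \<open>K(x)\<close> of \<open>K(x / (1 + x)) = K(x) stirling_step x\<close>: for
  \<open>d m = (x / (1 + x))\<^sup>m - x\<^sup>m stirling_step x\<close>, the lowest term is \<open>- m x\<^bsup>m+1\<^esup>\<close>.
\<close>
fun stirling_rec :: "(nat \<Rightarrow> nat \<Rightarrow> real) \<Rightarrow> nat \<Rightarrow> real" where
  "stirling_rec d M = (if M = 0 then 1 else (\<Sum>m<M. stirling_rec d m * d m (M + 1)) / real M)"

declare stirling_rec.simps [simp del]

lemma stirling_series_exists:
  "\<exists>\<kappa>::nat \<Rightarrow> real. \<kappa> 0 = 1 \<and>
     (\<forall>M. \<exists>C d. d > 0 \<and> (\<forall>x. \<bar>x\<bar> < d \<longrightarrow>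
        \<bar>(\<Sum>m<M. \<kappa> m * (x / (1 + x)) ^ m) - (\<Sum>m<M. \<kappa> m * x ^ m) * stirling_step x\<bar> \<le> C * \<bar>x\<bar> ^ (M + 1)))"
proof -
  obtain E where E: "stirling_step has_fps_expansion E" "fps_nth E 0 = 1" "fps_nth E 1 = 0"
    by (rule stirling_step_fps)
  define Y :: "real fps" where "Y = fps_X * inverse (1 + fps_X)"
  define D where "D = (\<lambda>m. Y ^ m - fps_X ^ m * E)"
  define \<kappa> where "\<kappa> = stirling_rec (\<lambda>m k. fps_nth (D m) k)"
  have \<kappa>0: "\<kappa> 0 = 1" by (simp add: \<kappa>_def stirling_rec.simps)
  have \<kappa>S: "\<kappa> M * real M = (\<Sum>m<M. \<kappa> m * fps_nth (D m) (M + 1))" if "M > 0" for M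
    unfolding \<kappa>_def using that by (subst stirling_rec.simps) simp
  have Yp: "Y ^ m = fps_X ^ m * inverse (1 + fps_X) ^ m" for m by (simp add: Y_def power_mult_distrib)
  have Dlow: "fps_nth (D m) k = 0" if "k < m" for m k
    using that by (simp add: D_def Yp fps_X_power_mult_nth)
  have D0: "fps_nth (D m) m = 0" for m
  proof -
    have "fps_nth (inverse (1 + fps_X :: real fps) ^ m) 0 = 1" by (simp add: fps_nth_power_0)
    then show ?thesis by (simp add: D_def Yp fps_X_power_mult_nth E)
  qed
  have D1: "fps_nth (D m) (Suc m) = - real m" for m
  proof -
    have "fps_nth (inverse (1 + fps_X :: real fps) ^ m) (Suc 0) = - real m"
    proof (induction m)
      case (Suc m)
      have "fps_nth (inverse (1 + fps_X :: real fps)) (Suc 0) = -1"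
        by (simp add: fps_inverse_def)
      then show ?case using Suc by (simp add: fps_mult_nth fps_nth_power_0)
    qed simp
    then show ?thesis using E by (simp add: D_def Yp fps_X_power_mult_nth)
  qed
  \<comment> \<open>The series \<open>D m\<close> starts beyond order m, so at order k only the
    indices m < k count. At order k = j + 1 the index m = j contributes \<open>- j\<close> times
    \<open>\<kappa> j\<close>, which the recursion defining \<open>\<kappa> j\<close> makes cancel
    the lower ones.\<close>
  have low: "fps_nth (\<Sum>m<M. fps_const (\<kappa> m) * D m) k = 0" if "k < M + 1" for M k
  proof -
    have "fps_nth (\<Sum>m<M. fps_const (\<kappa> m) * D m) k = (\<Sum>m<M. \<kappa> m * fps_nth (D m) k)"
      by (simp add: fps_sum_nth)
    also have "\<dots> = (\<Sum>m<k. \<kappa> m * fps_nth (D m) k)"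
    proof (rule sum.mono_neutral_cong)
      fix i assume "i \<in> {..<k} - {..<M}"
      then have "i = k" using that by auto
      then show "\<kappa> i * fps_nth (D i) k = 0" using D0 by simp
    next
      fix i assume "i \<in> {..<M} - {..<k}"
      then show "\<kappa> i * fps_nth (D i) k = 0" using D0 Dlow[of k i] by (cases "i = k") auto
    qed auto
    also have "\<dots> = 0"
    proof (cases k)
      case (Suc j)
      show ?thesis
      proof (cases "j = 0")
        case True then show ?thesis using Suc D1[of 0] by simp
      next
        case False
        then show ?thesis using Suc \<kappa>S[of j] D1[of j] by simp
      qed
    qed simp
    finally show ?thesis .
  qed
  have exp: "(\<lambda>x. (\<Sum>m<M. \<kappa> m * ((x * inverse (1 + x)) ^ m - x ^ m * stirling_step x))) has_fps_expansion (\<Sum>m<M. fps_const (\<kappa> m) * D m)" for M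
    unfolding D_def Y_def by (intro fps_expansion_intros E) simp
  have "\<exists>C d. d > 0 \<and> (\<forall>x. \<bar>x\<bar> < d \<longrightarrow>
        \<bar>(\<Sum>m<M. \<kappa> m * (x / (1 + x)) ^ m) - (\<Sum>m<M. \<kappa> m * x ^ m) * stirling_step x\<bar> \<le> C * \<bar>x\<bar> ^ (M + 1))" for M
    using has_fps_expansion_bound[OF exp low[of _ M], where m = "M + 1", simplified]
    by (simp add: divide_inverse right_diff_distrib sum_subtractf sum_distrib_right mult.assoc)
  with \<kappa>0 show ?thesis by blast
qed

text \<open>
  As \<open>stirling_step (- 1 / (n + 1)) = stirling_step (1 / n)\<close>, evaluating the relation for \<open>K\<close> at
  \<open>x = - 1 / (n + 1)\<close> shows that \<open>K(- 1 / n)\<close> satisfies the recurrence of the reciprocal of \<open>stirling_ratio\<close>.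
\<close>
lemma stirling_expansions_exist:
  "\<exists>\<kappa>::nat \<Rightarrow> real. \<kappa> 0 = 1 \<and>
     (\<forall>M. (\<lambda>n. stirling_ratio n - (\<Sum>m<M. \<kappa> m / real n ^ m)) \<in> O(\<lambda>n. 1 / real n ^ M)) \<and>
     (\<forall>M. (\<lambda>n. 1 / stirling_ratio n - (\<Sum>m<M. (-1) ^ m * \<kappa> m / real n ^ m)) \<in> O(\<lambda>n. 1 / real n ^ M))"
proof -
  obtain \<kappa> :: "nat \<Rightarrow> real" where \<kappa>0: "\<kappa> 0 = 1" and
    \<kappa>: "\<And>M. \<exists>C d. d > 0 \<and> (\<forall>x. \<bar>x\<bar> < d \<longrightarrow>
        \<bar>(\<Sum>m<M. \<kappa> m * (x / (1 + x)) ^ m) - (\<Sum>m<M. \<kappa> m * x ^ m) * stirling_step x\<bar> \<le> C * \<bar>x\<bar> ^ (M + 1))"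
    using stirling_series_exists by blast
  define S where "S = stirling_ratio"
  define K where "K = (\<lambda>M x. \<Sum>m<M. \<kappa> m * x ^ m)"
  have S1: "S \<longlonglongrightarrow> 1" using stirling_ratio_tendsto_1 by (simp add: S_def)
  have Sp: "n > 0 \<Longrightarrow> S n > 0" for n by (simp add: S_def stirling_ratio_pos)
  have SS: "n > 0 \<Longrightarrow> S (Suc n) = S n * stirling_step (1 / real n)" for n by (simp add: S_def stirling_ratio_Suc)
  have Sb: "S \<in> O(\<lambda>_. 1)" using S1 by (intro bigoI_tendsto[of _ _ 1]) auto
  have iS1: "(\<lambda>n. 1 / S n) \<longlonglongrightarrow> 1" using tendsto_divide[OF tendsto_const[of 1] S1] by simp
  have iSb: "(\<lambda>n. 1 / S n) \<in> O(\<lambda>_. 1)" using iS1 by (intro bigoI_tendsto[of _ _ 1]) auto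
  have iSb': "(\<lambda>n. 1 / S (Suc n)) \<in> O(\<lambda>_. 1)" using LIMSEQ_Suc[OF iS1] by (intro bigoI_tendsto[of _ _ 1]) auto
  have reflect: "stirling_step (- 1 / real (Suc n)) = stirling_step (1 / real n)" if "n > 0" for n
  proof -
    have "ln (1 - 1 / real (Suc n)) = - ln (1 + 1 / real n)"
    proof -
      have "1 - 1 / real (Suc n) = inverse (1 + 1 / real n)" using that by (simp add: field_simps)
      then show ?thesis using that by (simp add: ln_inverse add_pos_pos)
    qed
    then show ?thesis using that by (simp add: stirling_step_def algebra_simps)
  qed
  have K1: "(\<lambda>n. K M (c / real n)) \<longlonglongrightarrow> 1" if "M > 0" for M c
  proof -
    have "(\<lambda>n. K M (c / real n)) \<longlonglongrightarrow> (\<Sum>m<M. \<kappa> m * 0 ^ m)"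
      unfolding K_def by (intro tendsto_intros lim_const_over_n)
    also have "(\<Sum>m<M. \<kappa> m * 0 ^ m) = (\<Sum>m<M. if m = 0 then \<kappa> m else 0)"
      by (intro sum.cong) auto
    also have "\<dots> = 1" using that \<kappa>0 by (simp add: sum.delta)
    finally show ?thesis .
  qed
  have lim0: "(\<lambda>n. c / real n) \<longlonglongrightarrow> 0" for c by (rule lim_const_over_n)
  have stepA: "(\<lambda>n. K M (1 / real (Suc n)) - K M (1 / real n) * stirling_step (1 / real n)) \<in> O(\<lambda>n. 1 / real n ^ (M + 1))" for M
  proof -
    obtain C d where d: "d > 0" "\<And>x. \<bar>x\<bar> < d \<Longrightarrow> \<bar>K M (x / (1 + x)) - K M x * stirling_step x\<bar> \<le> C * \<bar>x\<bar> ^ (M + 1)"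
      using \<kappa>[of M] unfolding K_def by blast
    have "eventually (\<lambda>n. \<bar>1 / real n\<bar> < d) sequentially"
      using tendstoD[OF lim0[of 1] d(1)] by (simp add: dist_real_def)
    then have "eventually (\<lambda>n. norm (K M (1 / real (Suc n)) - K M (1 / real n) * stirling_step (1 / real n)) \<le> C * norm (1 / real n ^ (M + 1))) sequentially"
      using eventually_gt_at_top[of 0]
    proof eventually_elim
      case (elim n)
      have "(1 / real n) / (1 + 1 / real n) = 1 / real (Suc n)" using elim by (simp add: field_simps)
      then show ?case using d(2)[OF elim(1)] elim by (simp add: power_divide)
    qed
    then show ?thesis by (rule bigoI)
  qed
  have stepB: "(\<lambda>n. K M (- 1 / real n) - K M (- 1 / real (Suc n)) * stirling_step (1 / real n)) \<in> O(\<lambda>n. 1 / real n ^ (M + 1))" for M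
  proof -
    obtain C d where d: "d > 0" "\<And>x. \<bar>x\<bar> < d \<Longrightarrow> \<bar>K M (x / (1 + x)) - K M x * stirling_step x\<bar> \<le> C * \<bar>x\<bar> ^ (M + 1)"
      using \<kappa>[of M] unfolding K_def by blast
    have "eventually (\<lambda>n. \<bar>- 1 / real (Suc n)\<bar> < d) sequentially"
      using tendstoD[OF LIMSEQ_Suc[OF lim0[of "-1"]] d(1)] by (simp add: dist_real_def)
    then have "eventually (\<lambda>n. norm (K M (- 1 / real n) - K M (- 1 / real (Suc n)) * stirling_step (1 / real n)) \<le> \<bar>C\<bar> * norm (1 / real n ^ (M + 1))) sequentially"
      using eventually_gt_at_top[of 0]
    proof eventually_elim
      case (elim n)
      have "(- 1 / real (Suc n)) / (1 + - 1 / real (Suc n)) = - 1 / real n" using elim by (simp add: field_simps)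
      then have "\<bar>K M (- 1 / real n) - K M (- 1 / real (Suc n)) * stirling_step (1 / real n)\<bar> \<le> C * \<bar>- 1 / real (Suc n)\<bar> ^ (M + 1)"
        using d(2)[OF elim(1)] reflect[OF elim(2)] by simp
      also have "\<dots> \<le> \<bar>C\<bar> * (1 / real n) ^ (M + 1)"
        using elim by (intro mult_mono power_mono) (auto simp: field_simps)
      finally show ?case using elim by (simp add: power_divide)
    qed
    then show ?thesis by (rule bigoI)
  qed
  \<comment> \<open>The quotient by \<open>S n\<close>, not the difference, is telescoped: it tends
    to 1, and its increments are the defect of the recurrence times the bounded
    \<open>1 / S (n + 1)\<close>. Telescoping costs one power of n, which is why the defect was
    estimated to order M + 1.\<close>
  have A: "(\<lambda>n. S n - K M (1 / real n)) \<in> O(\<lambda>n. 1 / real n ^ M)" if M: "M > 0" for M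
  proof -
    have "(\<lambda>n. K M (1 / real (Suc n)) / S (Suc n) - K M (1 / real n) / S n) \<in> O(\<lambda>n. 1 / real n ^ (M + 1))"
    proof -
      have "(\<lambda>n. (K M (1 / real (Suc n)) - K M (1 / real n) * stirling_step (1 / real n)) * (1 / S (Suc n))) \<in> O(\<lambda>n. 1 / real n ^ (M + 1) * 1)"
        by (intro landau_o.big.mult stepA iSb')
      then show ?thesis
      proof (rule bigo_sequentially_cong)
        fix n :: nat assume "n > 0"
        then show "(K M (1 / real (Suc n)) - K M (1 / real n) * stirling_step (1 / real n)) * (1 / S (Suc n)) = K M (1 / real (Suc n)) / S (Suc n) - K M (1 / real n) / S n" using SS[of n] Sp[of n] Sp[of "Suc n"] by (auto simp: diff_divide_distrib)
      qed simp
    qed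
    moreover have "(\<lambda>n. K M (1 / real n) / S n) \<longlonglongrightarrow> 1"
      using tendsto_divide[OF K1[OF M, of 1] S1] by simp
    ultimately have "(\<lambda>n. K M (1 / real n) / S n - 1) \<in> O(\<lambda>n. 1 / real n ^ M)"
      using M by (intro telescoping_bigo)
    then have "(\<lambda>n. (K M (1 / real n) / S n - 1) * (- S n)) \<in> O(\<lambda>n. 1 / real n ^ M * 1)"
      using Sb by (intro landau_o.big.mult) auto
    then show ?thesis
    proof (rule bigo_sequentially_cong)
      fix n :: nat assume n: "n > 0"
      show "(K M (1 / real n) / S n - 1) * (- S n) = S n - K M (1 / real n)"
        using Sp[OF n] by (simp add: left_diff_distrib diff_divide_distrib)
    qed simp
  qed
  \<comment> \<open>Here \<open>K M (- 1 / n)\<close> imitates \<open>1 / S n\<close>, so its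
    product with \<open>S n\<close> is telescoped instead.\<close>
  have B: "(\<lambda>n. 1 / S n - K M (- 1 / real n)) \<in> O(\<lambda>n. 1 / real n ^ M)" if M: "M > 0" for M
  proof -
    have "(\<lambda>n. K M (- 1 / real (Suc n)) * S (Suc n) - K M (- 1 / real n) * S n) \<in> O(\<lambda>n. 1 / real n ^ (M + 1))"
    proof -
      have "(\<lambda>n. (K M (- 1 / real n) - K M (- 1 / real (Suc n)) * stirling_step (1 / real n)) * (- S n)) \<in> O(\<lambda>n. 1 / real n ^ (M + 1) * 1)"
        using Sb by (intro landau_o.big.mult stepB) auto
      then show ?thesis
      proof (rule bigo_sequentially_cong)
        fix n :: nat assume "n > 0"
        then show "(K M (- 1 / real n) - K M (- 1 / real (Suc n)) * stirling_step (1 / real n)) * (- S n) = K M (- 1 / real (Suc n)) * S (Suc n) - K M (- 1 / real n) * S n" using SS[of n] by (simp add: algebra_simps)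
      qed simp
    qed
    moreover have "(\<lambda>n. K M (- 1 / real n) * S n) \<longlonglongrightarrow> 1"
      using tendsto_mult[OF K1[OF M, of "-1"] S1] by simp
    ultimately have "(\<lambda>n. K M (- 1 / real n) * S n - 1) \<in> O(\<lambda>n. 1 / real n ^ M)"
      using M by (intro telescoping_bigo)
    then have "(\<lambda>n. (K M (- 1 / real n) * S n - 1) * (- (1 / S n))) \<in> O(\<lambda>n. 1 / real n ^ M * 1)"
      using iSb by (intro landau_o.big.mult) (auto simp del: divide_minus_left)
    then show ?thesis
    proof (rule bigo_sequentially_cong)
      fix n :: nat assume n: "n > 0"
      show "(K M (- 1 / real n) * S n - 1) * (- (1 / S n)) = 1 / S n - K M (- 1 / real n)"
        using Sp[OF n] by (simp add: left_diff_distrib diff_divide_distrib)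
    qed simp
  qed
  have KA: "K M (1 / real n) = (\<Sum>m<M. \<kappa> m / real n ^ m)" for M n
    by (simp add: K_def power_divide)
  have KB: "K M (- 1 / real n) = (\<Sum>m<M. (-1) ^ m * \<kappa> m / real n ^ m)" for M n
    unfolding K_def power_divide by (simp add: mult.commute)
  have "(\<lambda>n. stirling_ratio n - (\<Sum>m<M. \<kappa> m / real n ^ m)) \<in> O(\<lambda>n. 1 / real n ^ M)" for M
    using A[of M] Sb unfolding KA S_def by (cases "M = 0") auto
  moreover have "(\<lambda>n. 1 / stirling_ratio n - (\<Sum>m<M. (-1) ^ m * \<kappa> m / real n ^ m)) \<in> O(\<lambda>n. 1 / real n ^ M)" for M
    using B[of M] iSb unfolding KB S_def by (cases "M = 0") auto
  ultimately show ?thesis using \<kappa>0 by blast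
qed

text \<open>By strong induction the earlier coefficients agree, so subtracting the two remainders of
  order k + 1 leaves a constant over n^k that is O(1 / n^(k+1)); such a constant is 0.\<close>

lemma asymptotic_series_unique:
  fixes \<kappa> \<kappa>' :: "nat \<Rightarrow> real"
  assumes "\<And>M. (\<lambda>n. f n - (\<Sum>m<M. \<kappa> m / real n ^ m)) \<in> O(\<lambda>n. 1 / real n ^ M)"
    and "\<And>M. (\<lambda>n. f n - (\<Sum>m<M. \<kappa>' m / real n ^ m)) \<in> O(\<lambda>n. 1 / real n ^ M)"
  shows "\<kappa> = \<kappa>'"
proof
  fix k show "\<kappa> k = \<kappa>' k"
  proof (induction k rule: less_induct)
    case (less k)
    have "(\<lambda>n. (f n - (\<Sum>m<Suc k. \<kappa>' m / real n ^ m)) - (f n - (\<Sum>m<Suc k. \<kappa> m / real n ^ m))) \<in> O(\<lambda>n. 1 / real n ^ Suc k)"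
      by (intro sum_in_bigo assms)
    moreover have "(f n - (\<Sum>m<Suc k. \<kappa>' m / real n ^ m)) - (f n - (\<Sum>m<Suc k. \<kappa> m / real n ^ m)) = (\<kappa> k - \<kappa>' k) / real n ^ k" for n
      using less by (simp add: diff_divide_distrib)
    ultimately have "(\<lambda>n. (\<kappa> k - \<kappa>' k) / real n ^ k) \<in> O(\<lambda>n. 1 / real n ^ Suc k)" by simp
    then have "(\<lambda>n. (\<kappa> k - \<kappa>' k) / real n ^ k * real n ^ k) \<in> O(\<lambda>n. 1 / real n ^ Suc k * real n ^ k)"
      by (intro landau_o.big.mult) auto
    then have "(\<lambda>n. \<kappa> k - \<kappa>' k) \<in> O(\<lambda>n. 1 / real n)"
      by (rule bigo_sequentially_cong) auto
    moreover have "(\<lambda>n. 1 / real n) \<in> o(\<lambda>_. 1)" by real_asymp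
    ultimately have "(\<lambda>n::nat. \<kappa> k - \<kappa>' k) \<in> o(\<lambda>_. 1)"
      by (rule landau_o.big_small_trans)
    then have "(\<lambda>n::nat. \<kappa> k - \<kappa>' k) \<longlonglongrightarrow> 0"
      by (auto dest: smalloD_tendsto)
    then show ?case by (simp add: tendsto_const_iff)
  qed
qed

text \<open>Uniqueness identifies the described sequence with the one built from the recursion, and
  thereby makes the reciprocal expansion, which the description does not mention, available for
  it.\<close>

lemma stirling_kappa_expansions:
  shows stirling_kappa_0: "stirling_kappa 0 = 1"
    and stirling_kappa_bigo: "(\<lambda>n. stirling_ratio n - (\<Sum>m<M. stirling_kappa m / real n ^ m)) \<in> O(\<lambda>n. 1 / real n ^ M)"
    and inverse_stirling_kappa_bigo: "(\<lambda>n. 1 / stirling_ratio n - (\<Sum>m<M. (-1) ^ m * stirling_kappa m / real n ^ m)) \<in> O(\<lambda>n. 1 / real n ^ M)"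
proof -
  obtain \<kappa> where \<kappa>: "\<kappa> 0 = 1"
     "\<And>M. (\<lambda>n. stirling_ratio n - (\<Sum>m<M. \<kappa> m / real n ^ m)) \<in> O(\<lambda>n. 1 / real n ^ M)"
     "\<And>M. (\<lambda>n. 1 / stirling_ratio n - (\<Sum>m<M. (-1) ^ m * \<kappa> m / real n ^ m)) \<in> O(\<lambda>n. 1 / real n ^ M)"
    using stirling_expansions_exist by blast
  have "stirling_kappa = \<kappa>"
    unfolding stirling_kappa_def
  proof (rule the_equality)
    fix \<kappa>' :: "nat \<Rightarrow> real"
    assume "\<kappa>' 0 = 1 \<and> (\<forall>M. (\<lambda>n. Gamma (real n + 1) / (sqrt (2 * pi * real n) * (real n / exp 1) ^ n) - (\<Sum>m<M. \<kappa>' m / real n ^ m)) \<in> O(\<lambda>n. 1 / real n ^ M))"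
    then show "\<kappa>' = \<kappa>" using \<kappa>(2)
      by (intro asymptotic_series_unique[of stirling_ratio]) (auto simp: stirling_ratio_def)
  qed (use \<kappa> in \<open>auto simp: stirling_ratio_def\<close>)
  with \<kappa> show "stirling_kappa 0 = 1"
    "(\<lambda>n. stirling_ratio n - (\<Sum>m<M. stirling_kappa m / real n ^ m)) \<in> O(\<lambda>n. 1 / real n ^ M)"
    "(\<lambda>n. 1 / stirling_ratio n - (\<Sum>m<M. (-1) ^ m * stirling_kappa m / real n ^ m)) \<in> O(\<lambda>n. 1 / real n ^ M)"
    by auto
qed

section \<open>Laplace's method for logarithmic moments\<close>

text \<open>The coefficients of interest are real, but Cauchy's inequality needs a circle in the
  complex plane; this embedding moves formal identities there.\<close>

definition fps_complex :: "real fps \<Rightarrow> complex fps" where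
  "fps_complex F = Abs_fps (\<lambda>n. complex_of_real (fps_nth F n))"

lemma fps_complex_nth [simp]: "fps_nth (fps_complex F) n = complex_of_real (fps_nth F n)"
  by (simp add: fps_complex_def)

lemma fps_complex_mult: "fps_complex (F * G) = fps_complex F * fps_complex G"
  by (rule fps_ext) (simp add: fps_mult_nth)

lemma fps_complex_power: "fps_complex (F ^ j) = fps_complex F ^ j"
  by (induction j) (simp_all add: fps_complex_mult, simp add: fps_eq_iff)

lemma fps_complex_compose: "fps_complex (F oo G) = fps_complex F oo fps_complex G"
  by (rule fps_ext) (simp add: fps_compose_nth flip: fps_complex_power)

text \<open>A single bound \<open>B\<close> on one circle controls all coefficients, and then the
  Taylor remainder through a geometric series of ratio at most 1/2, whence the factor 2. Keeping
  \<open>B\<close> and \<open>\<rho>\<close> explicit is what later gives uniformity in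
  \<open>w\<close>.\<close>

lemma has_fps_expansion_Cauchy_bounds:
  fixes F :: "complex fps"
  assumes F: "f has_fps_expansion F" and hol: "f holomorphic_on ball 0 r"
    and \<rho>: "0 < \<rho>" "\<rho> < r" and B: "\<And>z. norm z = \<rho> \<Longrightarrow> norm (f z) \<le> B"
  shows "norm (fps_nth F m) \<le> B / \<rho> ^ m"
    and "norm t \<le> \<rho> / 2 \<Longrightarrow> norm (f t - (\<Sum>m<M. fps_nth F m * t ^ m)) \<le> 2 * B * (norm t / \<rho>) ^ M"
    and "norm t < r \<Longrightarrow> (\<lambda>m. fps_nth F m * t ^ m) sums f t"
proof -
  have "norm (f (of_real \<rho>)) \<le> B" using \<rho> by (intro B) simp
  then have B0: "B \<ge> 0" by (rule order.trans[OF norm_ge_zero])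
  have c: "norm (fps_nth F m) \<le> B / \<rho> ^ m" for m
  proof -
    have "norm ((deriv ^^ m) f 0) \<le> fact m * B / \<rho> ^ m"
    proof (rule Cauchy_inequality)
      show "f holomorphic_on ball 0 \<rho>" using hol \<rho> by (auto intro: holomorphic_on_subset)
      have "continuous_on (ball 0 r) f" using hol by (rule holomorphic_on_imp_continuous_on)
      then show "continuous_on (cball 0 \<rho>) f" by (rule continuous_on_subset) (use \<rho> in auto)
    qed (use \<rho> B in auto)
    then show ?thesis unfolding fps_nth_fps_expansion[OF F]
      by (simp add: norm_divide field_simps)
  qed
  then show "norm (fps_nth F m) \<le> B / \<rho> ^ m" .
  have s: "(\<lambda>m. fps_nth F m * t ^ m) sums f t" if "norm t < r" for t
    by (rule has_fps_expansion_imp_sums_complex[OF F, of "ereal r"]) (use hol that in \<open>auto simp: eball_def ball_def\<close>)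
  then show "norm t < r \<Longrightarrow> (\<lambda>m. fps_nth F m * t ^ m) sums f t" .
  assume t: "norm t \<le> \<rho> / 2"
  define x where "x = norm t / \<rho>"
  have x: "0 \<le> x" "x \<le> 1/2" using t \<rho> by (auto simp: x_def field_simps)
  have "norm t < r" using t \<rho> by simp
  note S = s[OF this]
  have "(\<lambda>m. fps_nth F (m + M) * t ^ (m + M)) sums (f t - (\<Sum>m<M. fps_nth F m * t ^ m))"
    using sums_split_initial_segment[OF S, of M] .
  then have "f t - (\<Sum>m<M. fps_nth F m * t ^ m) = (\<Sum>m. fps_nth F (m + M) * t ^ (m + M))"
    by (simp add: sums_iff)
  also have "norm \<dots> \<le> (\<Sum>m. B * x ^ M * x ^ m)"
  proof (rule norm_suminf_le)
    fix m
    have "norm (fps_nth F (m + M) * t ^ (m + M)) \<le> B / \<rho> ^ (m + M) * norm t ^ (m + M)"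
      unfolding norm_mult norm_power by (intro mult_right_mono c) auto
    also have "\<dots> = B * x ^ M * x ^ m" by (simp add: x_def power_divide power_add mult_ac)
    finally show "norm (fps_nth F (m + M) * t ^ (m + M)) \<le> B * x ^ M * x ^ m" .
    show "summable (\<lambda>m. B * x ^ M * x ^ m)" using x by (intro summable_mult summable_geometric) auto
  qed
  also have "\<dots> = B * x ^ M * (1 / (1 - x))"
    using x by (subst suminf_mult) (auto simp: suminf_geometric summable_geometric)
  also have "\<dots> \<le> B * x ^ M * 2"
    using x B0 by (intro mult_left_mono) (auto simp: field_simps)
  finally show "norm (f t - (\<Sum>m<M. fps_nth F m * t ^ m)) \<le> 2 * B * (norm t / \<rho>) ^ M"
    by (simp add: x_def mult_ac)
qed

section \<open>Expansion at the saddle point, uniformly in \<open>w\<close>\<close>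

definition log_log_fps :: "real \<Rightarrow> real fps" where
  "log_log_fps w = Abs_fps (\<lambda>i. ell i w)"

text \<open>As ln x = w (1 + ln (1 + t) / w) for \<open>x = exp w * (1 + t)\<close>, this is the
  logarithm of the factor that is raised to the power 2 n. On |t| = 1/5 the bound |Ln (1 + z)| \<le>
  2 |z| for |z| < 1/2 applies to both logarithms, whatever \<open>w \<ge> 1\<close> is, and yields
  (4/5) / w.\<close>

lemma log_log_expansion:
  fixes w :: real
  assumes w: "w \<ge> 1"
  defines "g \<equiv> \<lambda>t::complex. Ln (1 + Ln (1 + t) / of_real w)"
  shows "g has_fps_expansion fps_complex (log_log_fps w)"
    and "g holomorphic_on ball 0 (1/3)"
    and "norm t = 1/5 \<Longrightarrow> norm (g t) \<le> 1 / w"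
proof -
  have nL: "norm (Ln (1 + t)) \<le> 2 * norm t" if "norm t < 1/2" for t :: complex
    by (rule norm_Ln_le) (use that in auto)
  define f where "f = (\<lambda>z::complex. Ln (1 + z / of_real w))"
  define Fr where "Fr = Abs_fps (\<lambda>j. if j = 0 then 0 else (-1) ^ (j + 1) / (real j * w ^ j))"
  have f: "f has_fps_expansion fps_complex Fr"
  proof (rule has_fps_expansionI)
    have "eventually (\<lambda>z::complex. z \<in> ball 0 w) (nhds 0)"
      using w by (intro eventually_nhds_in_open) auto
    then show "\<forall>\<^sub>F u in nhds (0::complex). (\<lambda>n. fps_nth (fps_complex Fr) n * u ^ n) sums f u"
    proof eventually_elim
      case (elim z)
      then have "norm (z / of_real w) < 1" using w by (simp add: norm_divide)
      then have "(\<lambda>n. (- 1) ^ Suc n / of_nat n * (z / of_real w) ^ n) sums f z"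
        unfolding f_def by (rule Ln_series)
      moreover have "(\<lambda>n. (- 1) ^ Suc n / of_nat n * (z / of_real w) ^ n) = (\<lambda>n. fps_nth (fps_complex Fr) n * z ^ n)"
        by (rule ext) (auto simp: Fr_def power_divide)
      ultimately show ?case by simp
    qed
  qed
  have ln: "fps_ln (1::complex) = fps_complex (Abs_fps (\<lambda>k. if k = 0 then 0 else (-1) ^ (k + 1) / real k))"
    (is "_ = fps_complex ?L")
  proof (rule fps_ext)
    fix n show "fps_nth (fps_ln (1::complex)) n = fps_nth (fps_complex ?L) n"
      by (cases n) (auto simp: fps_ln_nth)
  qed
  have "(f \<circ> (\<lambda>t. Ln (1 + t))) has_fps_expansion (fps_complex Fr oo fps_ln 1)"
    by (intro has_fps_expansion_compose f has_fps_expansion_Ln_complex) (auto simp: fps_ln_nth)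
  moreover have "fps_complex Fr oo fps_ln 1 = fps_complex (log_log_fps w)"
    unfolding ln fps_complex_compose[symmetric]
  proof (rule arg_cong[where f = fps_complex], rule fps_ext)
    fix i
    have "fps_nth (Fr oo ?L) i = (\<Sum>j\<in>{0..i}. fps_nth Fr j * fps_nth (?L ^ j) i)" by (simp add: fps_compose_nth)
    also have "\<dots> = (\<Sum>j=1..i. fps_nth Fr j * fps_nth (?L ^ j) i)"
      by (rule sum.mono_neutral_right) (auto simp: Fr_def)
    also have "\<dots> = ell i w"
      unfolding ell_def ord_bell_def by (rule sum.cong) (auto simp: Fr_def)
    finally show "fps_nth (Fr oo ?L) i = fps_nth (log_log_fps w) i" by (simp add: log_log_fps_def)
  qed
  ultimately show "g has_fps_expansion fps_complex (log_log_fps w)"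
    by (simp add: g_def f_def o_def)
  show "g holomorphic_on ball 0 (1/3)"
    unfolding g_def
  proof (intro holomorphic_intros)
    fix t :: complex assume t: "t \<in> ball 0 (1/3)"
    have "\<bar>Re t\<bar> < 1" using t abs_Re_le_cmod[of t] by simp
    then have "Re (1 + t) > 0" by simp
    then show "1 + t \<notin> \<real>\<^sub>\<le>\<^sub>0" using complex_nonpos_Reals_iff by fastforce
    have "norm (Ln (1 + t) / of_real w) \<le> norm (Ln (1 + t)) / 1"
      using w unfolding norm_divide by (intro divide_left_mono) auto
    also have "\<dots> < 1" using nL[of t] t by simp
    finally have "\<bar>Re (Ln (1 + t) / of_real w)\<bar> < 1" using abs_Re_le_cmod le_less_trans by blast
    then have "Re (1 + Ln (1 + t) / of_real w) > 0" unfolding plus_complex.sel one_complex.sel by linarith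
    then show "1 + Ln (1 + t) / of_real w \<notin> \<real>\<^sub>\<le>\<^sub>0" using complex_nonpos_Reals_iff by fastforce
  qed (use w in auto)
  assume t: "norm t = 1/5"
  have 1: "norm (Ln (1 + t) / of_real w) \<le> (2/5) / w"
  proof -
    have "norm (Ln (1 + t)) / w \<le> (2/5) / w" using w nL[of t] t by (intro divide_right_mono) auto
    then show ?thesis using w by (simp add: norm_divide)
  qed
  also have "\<dots> < 1/2" using w by (simp add: field_simps)
  finally have "norm (g t) \<le> 2 * norm (Ln (1 + t) / of_real w)" unfolding g_def by (intro norm_Ln_le) auto
  also have "\<dots> \<le> 2 * ((2/5) / w)" using 1 by simp
  also have "\<dots> \<le> 1 / w" using w by (simp add: field_simps)
  finally show "norm (g t) \<le> 1 / w" .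
qed

lemma ell_bound:
  assumes "w \<ge> 1"
  shows "\<bar>ell i w\<bar> \<le> 5 ^ i / w"
proof -
  have "norm (fps_nth (fps_complex (log_log_fps w)) i) \<le> (1 / w) / (1/5) ^ i"
    using log_log_expansion[OF assms] by (intro has_fps_expansion_Cauchy_bounds(1)) auto
  then show ?thesis by (simp add: log_log_fps_def field_simps)
qed

lemma ell_0: "ell 0 w = 0" by (simp add: ell_def)

lemma ell_1: "ell 1 w = 1 / w" "ell (Suc 0) w = 1 / w" by (simp_all add: ell_def ord_bell_def)

text \<open>The curvature at the peak: multiplied by \<open>2 * n\<close>, the quadratic term
  becomes \<open>- y\<^sup>2 / 2\<close> under \<open>t = \<sigma> * y\<close> when
  \<open>\<sigma>\<^sup>2 = w\<^sup>2 / (2 * n * (w + 1))\<close>.\<close>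

lemma ell_2:
  assumes "w > 0" shows "ell 2 w = - ((w + 1) / w\<^sup>2 / 2)"
proof -
  have i: "{1..2} = {1, 2::nat}" by auto
  have "fps_nth (F\<^sup>2) 2 = fps_nth F 1 * fps_nth F 1" if "fps_nth F 0 = 0" for F :: "real fps"
    using that by (simp add: power2_eq_square fps_mult_nth numeral_2_eq_2)
  then show ?thesis unfolding ell_def i using assms
    by (simp add: ord_bell_def field_simps power2_eq_square)
qed

lemma log_log_sums:
  fixes t w :: real
  assumes w: "w \<ge> 1" and t: "\<bar>t\<bar> \<le> 1/8"
  shows "(\<lambda>i. ell i w * t ^ i) sums ln (1 + ln (1 + t) / w)" "1 + ln (1 + t) / w > 0"
proof -
  have "(\<lambda>i. fps_nth (fps_complex (log_log_fps w)) i * of_real t ^ i) sums Ln (1 + Ln (1 + of_real t) / of_real w)"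
    using log_log_expansion[OF w] t by (intro has_fps_expansion_Cauchy_bounds(3)[where \<rho> = "1/5" and r = "1/3" and B = "1/w"]) auto
  moreover have L: "Ln (1 + complex_of_real t) = of_real (ln (1 + t))"
    using Ln_of_real[of "1 + t"] t by simp
  have "norm (Ln (1 + complex_of_real t)) \<le> 2 * norm (complex_of_real t)"
    by (rule norm_Ln_le) (use t in auto)
  then have l: "\<bar>ln (1 + t)\<bar> \<le> 1/4" using t by (simp add: L)
  then have "\<bar>ln (1 + t) / w\<bar> \<le> 1/4" using w by (simp add: abs_divide divide_le_eq)
  then show p: "1 + ln (1 + t) / w > 0" by linarith
  have "Ln (1 + of_real (ln (1 + t)) / complex_of_real w) = of_real (ln (1 + ln (1 + t) / w))"
    using Ln_of_real[of "1 + ln (1 + t) / w"] p by simp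
  ultimately have "(\<lambda>i. complex_of_real (ell i w * t ^ i)) sums of_real (ln (1 + ln (1 + t) / w))"
    by (simp add: L log_log_fps_def)
  then show "(\<lambda>i. ell i w * t ^ i) sums ln (1 + ln (1 + t) / w)" by (simp only: sums_of_real_iff)
qed


text \<open>What remains of the logarithm after its linear and quadratic terms, divided by
  \<open>(w + 1) / w\<^sup>2 * t\<^sup>2\<close>. This normalisation turns the non-Gaussian part of
  the exponent into \<open>y\<^sup>2 * lam w t\<close>. The coefficients are bounded uniformly in
  \<open>w\<close>, since the factor \<open>1 / w\<close> in the bound for \<open>ell\<close>
  offsets \<open>w\<^sup>2 / (w + 1)\<close>.\<close>

definition lam_fps :: "real \<Rightarrow> real fps" where
  "lam_fps w = fps_const (w\<^sup>2 / (w + 1)) * Abs_fps (\<lambda>k. if k = 0 then 0 else ell (k + 2) w)"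

definition lam :: "real \<Rightarrow> real \<Rightarrow> real" where
  "lam w t = eval_fps (lam_fps w) t"

lemma lam_fps_nth: "fps_nth (lam_fps w) i = (if i = 0 then 0 else w\<^sup>2 / (w + 1) * ell (i + 2) w)"
  by (simp add: lam_fps_def)

lemma lam_fps_bound:
  assumes w: "w \<ge> 1"
  shows "\<bar>fps_nth (lam_fps w) i\<bar> \<le> 25 * 5 ^ i"
proof -
  have "w\<^sup>2 / (w + 1) * \<bar>ell (i + 2) w\<bar> \<le> w * (5 ^ (i + 2) / w)"
    using w by (intro mult_mono ell_bound) (auto simp: field_simps power2_eq_square)
  also have "\<dots> = 25 * 5 ^ i" using w by simp
  finally show ?thesis using w by (auto simp: lam_fps_nth abs_mult)
qed

text \<open>
  The radius \<open>1/1000\<close> only serves to make the bound \<open>1/4\<close> smaller than the \<open>1/2\<close> of the Gaussian exponent.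
\<close>
lemma lam_expansion:
  fixes w :: real
  assumes w: "w \<ge> 1"
  defines "L \<equiv> eval_fps (fps_complex (lam_fps w))"
  shows "L has_fps_expansion fps_complex (lam_fps w)"
    and "L holomorphic_on ball 0 (1/6)"
    and "norm z \<le> 1/1000 \<Longrightarrow> norm (L z) \<le> 1 / 4"
    and "\<bar>t\<bar> \<le> 1/8 \<Longrightarrow> L (of_real t) = of_real (lam w t)"
    and "\<bar>t\<bar> \<le> 1/8 \<Longrightarrow> (\<lambda>i. fps_nth (lam_fps w) i * t ^ i) sums lam w t"
proof -
  let ?F = "fps_complex (lam_fps w)"
  have "summable (\<lambda>i. fps_nth ?F i * of_real (1/6) ^ i)"
  proof (rule summable_comparison_test')
    show "summable (\<lambda>i. 25 * (5 / 6 :: real) ^ i)" by (intro summable_mult summable_geometric) auto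
    fix i :: nat
    have "norm (fps_nth ?F i * of_real (1/6) ^ i) = \<bar>fps_nth (lam_fps w) i\<bar> * (1/6) ^ i"
      by (simp add: norm_mult norm_power norm_divide)
    also have "\<dots> \<le> 25 * 5 ^ i * (1/6) ^ i"
      by (intro mult_right_mono lam_fps_bound w) auto
    finally show "norm (fps_nth ?F i * of_real (1/6) ^ i) \<le> 25 * (5 / 6 :: real) ^ i"
      by (simp add: power_divide)
  qed
  from conv_radius_geI[OF this] have r: "fps_conv_radius ?F \<ge> ereal (1/6)"
    by (simp add: fps_conv_radius_def)
  then show "L has_fps_expansion ?F"
    unfolding L_def by (intro eval_fps_has_fps_expansion) (auto elim!: less_le_trans[rotated])
  have sub: "ball 0 (1/6) \<subseteq> eball (0::complex) (fps_conv_radius ?F)"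
    using r by (auto simp: eball_def ball_def elim!: less_le_trans[rotated])
  then show "L holomorphic_on ball 0 (1/6)"
    unfolding L_def by (rule holomorphic_on_eval_fps)
  have sums: "(\<lambda>i. fps_nth ?F i * z ^ i) sums L z" if "norm z < 1/6" for z
    unfolding L_def by (rule sums_eval_fps) (use sub that in auto)
  {
    assume z: "norm z \<le> 1/1000"
    have S: "(\<lambda>i. fps_nth ?F i * z ^ i) sums L z" using z by (intro sums) auto
    have "(\<lambda>i. fps_nth ?F (i + 1) * z ^ (i + 1)) sums (L z - (\<Sum>i<1. fps_nth ?F i * z ^ i))"
      by (rule sums_split_initial_segment[OF S])
    then have "L z = (\<Sum>i. fps_nth ?F (i + 1) * z ^ (i + 1))"
      by (simp add: sums_iff lam_fps_nth)
    \<comment> \<open>The constant coefficient is 0, so the sum starts with a factor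
      \<open>z\<close>: 25 * 5 / 1000 = 1/8, and the ratio is 5 / 1000 = 1/200.\<close>
    also have "norm \<dots> \<le> (\<Sum>i. 1/8 * (1/200) ^ i)"
    proof (rule norm_suminf_le)
      fix i
      have "norm (fps_nth ?F (i + 1) * z ^ (i + 1)) \<le> 25 * 5 ^ (i + 1) * (1/1000) ^ (i + 1)"
        unfolding norm_mult norm_power using lam_fps_bound[OF w, of "i + 1"] z
        by (intro mult_mono power_mono) auto
      also have "\<dots> = 1/8 * (1/200) ^ i" by (simp add: power_divide field_simps flip: power_mult_distrib)
      finally show "norm (fps_nth ?F (i + 1) * z ^ (i + 1)) \<le> 1/8 * (1/200) ^ i" .
      show "summable (\<lambda>i. 1/8 * (1/200 :: real) ^ i)" by (intro summable_mult summable_geometric) auto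
    qed
    also have "\<dots> \<le> 1/4" by (subst suminf_mult) (auto simp: suminf_geometric summable_geometric)
    finally show "norm (L z) \<le> 1/4" .
  }
  assume t: "\<bar>t\<bar> \<le> 1/8"
  have "(\<lambda>i. fps_nth ?F i * of_real t ^ i) sums L (of_real t)" using t by (intro sums) auto
  then have s: "(\<lambda>i. complex_of_real (fps_nth (lam_fps w) i * t ^ i)) sums L (of_real t)" by simp
  then have "summable (\<lambda>i. complex_of_real (fps_nth (lam_fps w) i * t ^ i))" by (rule sums_summable)
  then have "summable (\<lambda>i. fps_nth (lam_fps w) i * t ^ i)" by (simp only: summable_complex_of_real)
  then have s2: "(\<lambda>i. fps_nth (lam_fps w) i * t ^ i) sums lam w t"
    unfolding lam_def eval_fps_def by (rule summable_sums)
  then show "(\<lambda>i. fps_nth (lam_fps w) i * t ^ i) sums lam w t" .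
  from s2 have "(\<lambda>i. complex_of_real (fps_nth (lam_fps w) i * t ^ i)) sums of_real (lam w t)"
    by (simp only: sums_of_real_iff)
  with s show "L (of_real t) = of_real (lam w t)" by (rule sums_unique2)
qed

lemma log_log_lam:
  assumes w: "w \<ge> 1" and t: "\<bar>t\<bar> \<le> 1/8"
  shows "ln (1 + ln (1 + t) / w) = t / w + (w + 1) / w\<^sup>2 * (t\<^sup>2 * lam w t - t\<^sup>2 / 2)"
proof -
  have w0: "w > 0" using w by simp
  have "(\<lambda>i. ell (i + 3) w * t ^ (i + 3)) sums (ln (1 + ln (1 + t) / w) - (\<Sum>i<3. ell i w * t ^ i))"
    by (rule sums_split_initial_segment[OF log_log_sums(1)[OF w t]])
  moreover have "(\<lambda>i. (w + 1) / w\<^sup>2 * t\<^sup>2 * (fps_nth (lam_fps w) (i + 1) * t ^ (i + 1))) sums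
      ((w + 1) / w\<^sup>2 * t\<^sup>2 * (lam w t - (\<Sum>i<1. fps_nth (lam_fps w) i * t ^ i)))"
    by (intro sums_mult sums_split_initial_segment[OF lam_expansion(5)[OF w t]])
  moreover have "(w + 1) / w\<^sup>2 * t\<^sup>2 * (fps_nth (lam_fps w) (i + 1) * t ^ (i + 1)) = ell (i + 3) w * t ^ (i + 3)" for i
  proof -
    have "(w + 1) / w\<^sup>2 * (w\<^sup>2 / (w + 1)) = 1" using w0 by simp
    then have "(w + 1) / w\<^sup>2 * t\<^sup>2 * (fps_nth (lam_fps w) (i + 1) * t ^ (i + 1)) = ell (i + 3) w * (t\<^sup>2 * t ^ (i + 1))"
      using w0 unfolding lam_fps_nth by (simp add: numeral_3_eq_3)
    then show ?thesis by (simp flip: power_add add: numeral_3_eq_3 numeral_2_eq_2)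
  qed
  ultimately have "ln (1 + ln (1 + t) / w) - (\<Sum>i<3. ell i w * t ^ i) = (w + 1) / w\<^sup>2 * t\<^sup>2 * (lam w t - (\<Sum>i<1. fps_nth (lam_fps w) i * t ^ i))"
    by (simp only: sums_unique2)
  moreover have "(\<Sum>i<3. ell i w * t ^ i) = t / w - (w + 1) / w\<^sup>2 * (t\<^sup>2 / 2)"
  proof -
    have "ell (Suc (Suc 0)) w = - ((w + 1) / w\<^sup>2 / 2)" using ell_2[OF w0] by (simp only: numeral_2_eq_2)
    moreover have "{..<3::nat} = {0, 1, Suc (Suc 0)}" by auto
    ultimately show ?thesis by (simp add: ell_0 ell_1 power2_eq_square)
  qed
  ultimately have "ln (1 + ln (1 + t) / w) = t / w - (w + 1) / w\<^sup>2 * (t\<^sup>2 / 2) + (w + 1) / w\<^sup>2 * t\<^sup>2 * lam w t"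
    by (simp add: lam_fps_nth)
  then show ?thesis by (simp only: right_diff_distrib mult.assoc)
qed

text \<open>As a function of \<open>q\<close> this is a polynomial of degree at most
  \<open>m\<close>. Setting \<open>q = y\<^sup>2\<close> and \<open>t = \<sigma> * y\<close> only
  afterwards treats the two as independent variables, so that the expansion in \<open>t\<close> has
  coefficients integrable against the Gaussian.\<close>

definition laplace_poly :: "real \<Rightarrow> real \<Rightarrow> nat \<Rightarrow> real \<Rightarrow> real" where
  "laplace_poly \<beta> w m q = fps_nth (fps_binomial \<beta> * (fps_exp q oo lam_fps w)) m"

text \<open>On the circle of radius 1/1000 the exponent \<open>q * L z\<close> is at most
  \<open>q / 4\<close> in modulus, so with \<open>q = y\<^sup>2\<close> only half of the Gaussian
  \<open>exp (- y\<^sup>2 / 2)\<close> is lost. Half that radius, 1/2000, is where the geometric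
  remainder bound applies.\<close>

lemma laplace_poly_bounds:
  fixes \<beta> w q t :: real
  assumes w: "w \<ge> 1" and q: "q \<ge> 0"
  shows "\<bar>laplace_poly \<beta> w m q\<bar> \<le> exp \<bar>\<beta>\<bar> * exp (q / 4) * 1000 ^ m"
    and "\<bar>t\<bar> \<le> 1/2000 \<Longrightarrow> \<bar>(1 + t) powr \<beta> * exp (q * lam w t) - (\<Sum>m<M. laplace_poly \<beta> w m q * t ^ m)\<bar>
          \<le> 2 * exp \<bar>\<beta>\<bar> * exp (q / 4) * (1000 * \<bar>t\<bar>) ^ M"
proof -
  define L where "L = eval_fps (fps_complex (lam_fps w))"
  note lamw = lam_expansion[OF w, folded L_def]
  define f where "f = (\<lambda>z::complex. (1 + z) powr of_real \<beta> * exp (of_real q * L z))"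
  have f: "f has_fps_expansion fps_complex (fps_binomial \<beta> * (fps_exp q oo lam_fps w))"
  proof -
    have 1: "((\<lambda>z. exp (of_real q * z)) \<circ> L) has_fps_expansion (fps_exp (of_real q) oo fps_complex (lam_fps w))"
      by (intro has_fps_expansion_compose lamw has_fps_expansion_exp) (simp add: lam_fps_nth)
    have 2: "fps_exp (complex_of_real q) = fps_complex (fps_exp q)"
      by (rule fps_ext) simp
    have 3: "fps_binomial (complex_of_real \<beta>) = fps_complex (fps_binomial \<beta>)"
      by (rule fps_ext) (simp add: gbinomial_prod_rev)
    show ?thesis unfolding f_def fps_complex_mult fps_complex_compose
      using has_fps_expansion_mult[OF has_fps_expansion_binomial_complex[of "of_real \<beta>"] 1]
      by (simp add: o_def 2 3)
  qed
  have hol: "f holomorphic_on ball 0 (1/6)"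
    unfolding f_def
  proof (intro holomorphic_intros lamw)
    fix z :: complex assume "z \<in> ball 0 (1/6)"
    then have "\<bar>Re z\<bar> < 1" using abs_Re_le_cmod[of z] by simp
    then have "Re (1 + z) > 0" by simp
    then show "1 + z \<notin> \<real>\<^sub>\<le>\<^sub>0" using complex_nonpos_Reals_iff by fastforce
  qed
  have B: "norm (f z) \<le> exp \<bar>\<beta>\<bar> * exp (q / 4)" if z: "norm z = 1/1000" for z
  proof -
    have nz: "1 + z \<noteq> 0"
    proof
      assume "1 + z = 0"
      then have "z = - 1" by (simp add: add_eq_0_iff)
      with z show False by simp
    qed
    have "Re (of_real \<beta> * Ln (1 + z)) \<le> norm (of_real \<beta> * Ln (1 + z))" by (rule complex_Re_le_cmod)
    also have "\<dots> \<le> \<bar>\<beta>\<bar> * (2 * norm z)" unfolding norm_mult using norm_Ln_le[of z] z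
      by (intro mult_mono) auto
    also have "\<dots> \<le> \<bar>\<beta>\<bar> * 1" using z by (intro mult_left_mono) auto
    finally have 1: "norm ((1 + z) powr of_real \<beta>) \<le> exp \<bar>\<beta>\<bar>"
      using nz by (simp add: powr_def norm_exp_eq_Re)
    have "Re (of_real q * L z) \<le> norm (of_real q * L z)" by (rule complex_Re_le_cmod)
    also have "\<dots> \<le> q * (1/4)" unfolding norm_mult using lamw(3)[of z] z q
      by (intro mult_mono) auto
    finally have 2: "norm (exp (of_real q * L z)) \<le> exp (q / 4)" by (simp add: norm_exp_eq_Re)
    show ?thesis unfolding f_def norm_mult using 1 2 by (intro mult_mono) auto
  qed
  note C = has_fps_expansion_Cauchy_bounds[OF f hol _ _ B]
  show "\<bar>laplace_poly \<beta> w m q\<bar> \<le> exp \<bar>\<beta>\<bar> * exp (q / 4) * 1000 ^ m"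
  proof -
    have "norm (fps_nth (fps_complex (fps_binomial \<beta> * (fps_exp q oo lam_fps w))) m) \<le> exp \<bar>\<beta>\<bar> * exp (q / 4) / (1/1000) ^ m"
      by (rule C(1)) auto
    then show ?thesis by (simp add: laplace_poly_def power_divide)
  qed
  assume t: "\<bar>t\<bar> \<le> 1/2000"
  have "f (of_real t) = of_real ((1 + t) powr \<beta> * exp (q * lam w t))"
  proof -
    have "(1 + complex_of_real t) powr of_real \<beta> = of_real ((1 + t) powr \<beta>)"
      using powr_of_real[of "1 + t" \<beta>] t by simp
    then show ?thesis using lamw(4)[of t] t by (simp add: f_def exp_of_real flip: of_real_mult)
  qed
  then have "complex_of_real ((1 + t) powr \<beta> * exp (q * lam w t) - (\<Sum>m<M. laplace_poly \<beta> w m q * t ^ m)) =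
    f (of_real t) - (\<Sum>m<M. fps_nth (fps_complex (fps_binomial \<beta> * (fps_exp q oo lam_fps w))) m * of_real t ^ m)"
    by (simp add: laplace_poly_def)
  then have "\<bar>(1 + t) powr \<beta> * exp (q * lam w t) - (\<Sum>m<M. laplace_poly \<beta> w m q * t ^ m)\<bar> =
    norm (f (of_real t) - (\<Sum>m<M. fps_nth (fps_complex (fps_binomial \<beta> * (fps_exp q oo lam_fps w))) m * of_real t ^ m))"
    by (metis norm_of_real)
  also have "\<dots> \<le> 2 * (exp \<bar>\<beta>\<bar> * exp (q / 4)) * (norm (complex_of_real t) / (1/1000)) ^ M"
    by (rule C(2)) (use t in auto)
  also have "\<dots> = 2 * exp \<bar>\<beta>\<bar> * exp (q / 4) * (1000 * \<bar>t\<bar>) ^ M" by (simp add: mult_ac)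
  finally show "\<bar>(1 + t) powr \<beta> * exp (q * lam w t) - (\<Sum>m<M. laplace_poly \<beta> w m q * t ^ m)\<bar>
          \<le> 2 * exp \<bar>\<beta>\<bar> * exp (q / 4) * (1000 * \<bar>t\<bar>) ^ M" .
qed

section \<open>Gaussian moments and the coefficients \<open>a_coeff\<close>\<close>

lemma odd_dfact_eq: "real (odd_dfact k) = fact (2 * k) / (2 ^ k * fact k)"
proof (induction k)
  case (Suc k)
  have f: "fact (2 * Suc k) = 2 * (real k + 1) * (2 * real k + 1) * fact (2 * k)" "fact (Suc k) = (real k + 1) * fact k"
    by (simp_all add: algebra_simps)
  have "F / (P * f) * b = 2 * a * b * F / (2 * P * (a * f))" if "a \<noteq> 0" for F P f a b :: real
    using that by simp
  note aux = this
  have "real (odd_dfact (Suc k)) = real (odd_dfact k) * (2 * real k + 1)" by (simp add: odd_dfact_def algebra_simps)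
  also have "\<dots> = fact (2 * k) / (2 ^ k * fact k) * (2 * real k + 1)" unfolding Suc ..
  also have "\<dots> = 2 * (real k + 1) * (2 * real k + 1) * fact (2 * k) / (2 * 2 ^ k * ((real k + 1) * fact k))"
    by (rule aux) simp
  also have "\<dots> = fact (2 * Suc k) / (2 ^ Suc k * fact (Suc k))" unfolding f power_Suc ..
  finally show ?case .
qed (simp add: odd_dfact_def)

lemma gaussian_moment:
  "has_bochner_integral lborel (\<lambda>y::real. exp (- y\<^sup>2 / 2) * y ^ k)
     (if even k then sqrt (2 * pi) * real (odd_dfact (k div 2)) else 0)"
proof (cases "even k")
  case True
  then obtain j where k: "k = 2 * j" by (elim evenE)
  show ?thesis
    using has_bochner_integral_mult_right[OF std_normal_moment_even[of j], of "sqrt (2 * pi)"]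
    by (simp add: k std_normal_density_def odd_dfact_eq)
next
  case False
  then obtain j where k: "k = 2 * j + 1" by (elim oddE)
  show ?thesis
    using has_bochner_integral_mult_right[OF std_normal_moment_odd[of j], of "sqrt (2 * pi)"]
    by (simp add: k std_normal_density_def)
qed

lemma lam_fps_power_nth:
  "fps_nth (lam_fps w ^ j) i = (w\<^sup>2 / (w + 1)) ^ j * ord_bell i j (\<lambda>k. ell (k + 2) w)"
  unfolding lam_fps_def power_mult_distrib ord_bell_def by (simp add: fps_const_power)

lemma laplace_poly_eq:
  "laplace_poly \<beta> w m q = (\<Sum>i=0..m. \<Sum>j=0..i. fps_nth (lam_fps w ^ j) i / fact j * (\<beta> gchoose (m - i)) * q ^ j)"
proof -
  have "laplace_poly \<beta> w m q = (\<Sum>i=0..m. (\<Sum>j=0..i. q ^ j / fact j * fps_nth (lam_fps w ^ j) i) * (\<beta> gchoose (m - i)))"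
    unfolding laplace_poly_def by (subst mult.commute) (simp add: fps_mult_nth fps_compose_nth)
  also have "\<dots> = (\<Sum>i=0..m. \<Sum>j=0..i. fps_nth (lam_fps w ^ j) i / fact j * (\<beta> gchoose (m - i)) * q ^ j)"
    unfolding sum_distrib_right by (intro sum.cong refl) simp
  finally show ?thesis .
qed

text \<open>Integration monomial by monomial: \<open>y ^ (m + 2 * j)\<close> has a nonzero moment
  only for even m = 2 r, and then it is the double factorial (2 j + 2 r - 1)!! times the Gaussian
  mass. The factor \<open>w\<^sup>2 / (w + 1)\<close> occurs r times in \<open>\<sigma> ^ m\<close>
  and j times in \<open>lam_fps w ^ j\<close>, which explains the exponent \<open>j + r\<close> in
  \<open>a_coeff\<close>.\<close>

lemma laplace_poly_integral:
  fixes \<sigma> w \<beta> :: real and n m :: nat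
  assumes \<sigma>: "\<sigma>\<^sup>2 = w\<^sup>2 / (2 * real n * (w + 1))"
  shows "has_bochner_integral lborel (\<lambda>y. exp (- y\<^sup>2 / 2) * (laplace_poly \<beta> w m (y\<^sup>2) * (\<sigma> * y) ^ m))
    (if even m then sqrt (2 * pi) * (a_coeff \<beta> (m div 2) w / (2 * real n) ^ (m div 2)) else 0)"
proof -
  define c where "c = (\<lambda>i j. \<sigma> ^ m * (fps_nth (lam_fps w ^ j) i / fact j * (\<beta> gchoose (m - i))))"
  define g where "g = (\<lambda>k::nat. if even k then sqrt (2 * pi) * real (odd_dfact (k div 2)) else 0)"
  have "has_bochner_integral lborel (\<lambda>y. \<Sum>i=0..m. \<Sum>j=0..i. c i j * (exp (- y\<^sup>2 / 2) * y ^ (m + 2 * j)))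
     (\<Sum>i=0..m. \<Sum>j=0..i. c i j * g (m + 2 * j))"
    unfolding g_def by (intro has_bochner_integral_sum has_bochner_integral_mult_right gaussian_moment)
  moreover have "(\<Sum>i=0..m. \<Sum>j=0..i. c i j * (exp (- y\<^sup>2 / 2) * y ^ (m + 2 * j))) =
      exp (- y\<^sup>2 / 2) * (laplace_poly \<beta> w m (y\<^sup>2) * (\<sigma> * y) ^ m)" for y
    unfolding laplace_poly_eq c_def sum_distrib_left sum_distrib_right
    by (intro sum.cong refl) (simp add: power_add power_mult_distrib mult_ac flip: power_mult)
  moreover have "(\<Sum>i=0..m. \<Sum>j=0..i. c i j * g (m + 2 * j)) =
     (if even m then sqrt (2 * pi) * (a_coeff \<beta> (m div 2) w / (2 * real n) ^ (m div 2)) else 0)"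
  proof (cases "even m")
    case True
    then obtain r where m: "m = 2 * r" by (elim evenE)
    define v where "v = w\<^sup>2 / (w + 1)"
    have "\<sigma>\<^sup>2 = v / (2 * real n)" unfolding \<sigma> v_def by (simp add: mult_ac)
    then have s: "\<sigma> ^ m = v ^ r / (2 * real n) ^ r" unfolding m power_mult by (simp add: power_divide)
    have "(\<Sum>i=0..m. \<Sum>j=0..i. c i j * g (m + 2 * j)) = (\<Sum>j=0..m. \<Sum>i=j..m. c i j * g (m + 2 * j))"
    proof -
      have "(\<Sum>i=0..m. \<Sum>j=0..i. f i j) = (\<Sum>j=0..m. \<Sum>i=j..m. f i j)" for f :: "nat \<Rightarrow> nat \<Rightarrow> real"
        unfolding sum.Sigma[OF finite_atLeastAtMost ballI[OF finite_atLeastAtMost]]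
        by (rule sum.reindex_bij_witness[of _ prod.swap prod.swap]) auto
      then show ?thesis .
    qed
    also have "\<dots> = sqrt (2 * pi) * (a_coeff \<beta> r w / (2 * real n) ^ r)"
    proof -
      have "c i j * g (m + 2 * j) =
        sqrt (2 * pi) * (real (odd_dfact (j + r)) / fact j * v ^ (j + r) *
          (ord_bell i j (\<lambda>k. ell (k + 2) w) * (\<beta> gchoose (2 * r - i))) / (2 * real n) ^ r)" for i j
      proof -
        have "(m + 2 * j) div 2 = j + r" "even (m + 2 * j)" by (auto simp: m)
        then show ?thesis unfolding c_def g_def s
          unfolding lam_fps_power_nth v_def[symmetric] power_add by (simp add: m mult_ac add.commute[of r j])
      qed
      then show ?thesis
        unfolding a_coeff_def v_def[symmetric] m sum_distrib_left sum_divide_distrib by simp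
    qed
    finally show ?thesis by (simp add: m)
  next
    case False
    then show ?thesis by (simp add: g_def)
  qed
  ultimately show ?thesis by simp
qed

text \<open>The integrand of the logarithmic moment at \<open>x = exp w * (1 + t)\<close>, divided
  by its value at \<open>t = 0\<close>. The condition is \<open>x \<ge> 1\<close>, and
  \<open>2 * n / w\<close> stands for \<open>pi * exp w\<close>.\<close>

definition laplace_kernel :: "real \<Rightarrow> real \<Rightarrow> nat \<Rightarrow> real \<Rightarrow> real" where
  "laplace_kernel \<beta> w n t = (if exp w * (1 + t) \<ge> 1
     then (1 + t) powr \<beta> * (1 + ln (1 + t) / w) ^ (2 * n) * exp (- (2 * real n / w) * t) else 0)"

text \<open>The linear terms cancel because \<open>exp w\<close> is a critical point, and
  \<open>\<sigma>\<close> normalises the quadratic term. For such small \<open>t\<close> the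
  condition in \<open>laplace_kernel\<close> holds automatically, since
  \<open>exp w \<ge> 2\<close>.\<close>

lemma laplace_kernel_center:
  assumes w: "w \<ge> 1" and n: "n \<ge> 1" and \<sigma>: "\<sigma>\<^sup>2 = w\<^sup>2 / (2 * real n * (w + 1))"
    and t: "t = \<sigma> * y" "\<bar>t\<bar> \<le> 1 / 2000"
  shows "laplace_kernel \<beta> w n t = exp (- y\<^sup>2 / 2) * ((1 + t) powr \<beta> * exp (y\<^sup>2 * lam w t))"
proof -
  have "1 \<le> 2 * (1/2::real)" by simp
  also have "\<dots> \<le> exp w * (1 + t)"
  proof (rule mult_mono)
    show "2 \<le> exp w" using exp_ge_add_one_self[of w] w by linarith
    show "1/2 \<le> 1 + t" using t(2) by linarith
  qed auto
  finally have d: "exp w * (1 + t) \<ge> 1" .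
  have t8: "\<bar>t\<bar> \<le> 1/8" using t(2) by simp
  have p: "1 + ln (1 + t) / w > 0" by (rule log_log_sums(2)[OF w t8])
  have sq: "2 * real n * ((w + 1) / w\<^sup>2 * t\<^sup>2) = y\<^sup>2"
  proof -
    have "w + 1 \<noteq> 0" "w \<noteq> 0" "real n \<noteq> 0" using w n by auto
    then show ?thesis unfolding t(1) power_mult_distrib \<sigma> by simp
  qed
  have "(1 + ln (1 + t) / w) ^ (2 * n) = exp (real (2 * n) * ln (1 + ln (1 + t) / w))"
    using p by (subst exp_of_nat_mult) simp
  also have "real (2 * n) * ln (1 + ln (1 + t) / w) =
      2 * real n / w * t + (2 * real n * ((w + 1) / w\<^sup>2 * t\<^sup>2)) * (lam w t - 1/2)"
  proof -
    have "real (2 * n) * (t / w + a * (t\<^sup>2 * lam w t - t\<^sup>2 / 2)) =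
      2 * real n / w * t + (2 * real n * (a * t\<^sup>2)) * (lam w t - 1/2)" for a
      by (simp add: algebra_simps)
    then show ?thesis unfolding log_log_lam[OF w t8] .
  qed
  also have "\<dots> = 2 * real n / w * t + (y\<^sup>2 * lam w t - y\<^sup>2 / 2)"
    unfolding sq by (simp add: algebra_simps)
  finally have "(1 + ln (1 + t) / w) ^ (2 * n) * exp (- (2 * real n / w) * t) =
     exp (- y\<^sup>2 / 2) * exp (y\<^sup>2 * lam w t)"
    by (simp flip: exp_add)
  then show ?thesis using d by (simp add: laplace_kernel_def mult_ac)
qed

section \<open>Control away from the peak\<close>

lemma laplace_kernel_nonneg: "laplace_kernel \<beta> w n t \<ge> 0"
  by (auto simp: laplace_kernel_def intro!: mult_nonneg_nonneg)

text \<open>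
  From \<open>ln (1 + t) = 2 ln s \<le> 2 (s - 1)\<close> with \<open>s = sqrt (1 + t)\<close> the left-hand side is at most \<open>- (s - 1)\<^sup>2\<close>.
\<close>
lemma ln_one_plus_tail:
  fixes t :: real
  assumes "t > -1" "\<bar>t\<bar> \<ge> 1 / 2000"
  shows "ln (1 + t) - t \<le> - ((1 / 2001)\<^sup>2 / 4) * (1 + \<bar>t\<bar>)"
proof -
  define s where "s = sqrt (1 + t)"
  have s: "s > 0" "s\<^sup>2 = 1 + t" using assms by (auto simp: s_def)
  have "ln (1 + t) = 2 * ln s" using s by (metis ln_realpow of_nat_numeral)
  also have "\<dots> \<le> 2 * (s - 1)" using ln_le_minus_one[OF s(1)] by simp
  finally have 1: "ln (1 + t) - t \<le> - ((s - 1)\<^sup>2)" using s by (simp add: power2_eq_square algebra_simps)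
  have "(s + 1)\<^sup>2 \<le> 4 * (1 + \<bar>t\<bar>)"
  proof -
    have "(s + 1)\<^sup>2 \<le> 2 * (s\<^sup>2 + 1)" using zero_le_power2[of "s - 1"] by (simp add: power2_eq_square algebra_simps)
    also have "\<dots> \<le> 4 * (1 + \<bar>t\<bar>)" unfolding s by simp
    finally show ?thesis .
  qed
  moreover have "t\<^sup>2 = (s - 1)\<^sup>2 * (s + 1)\<^sup>2"
    unfolding power_mult_distrib[symmetric] using s by (simp add: power2_eq_square algebra_simps)
  ultimately have 2: "t\<^sup>2 \<le> (s - 1)\<^sup>2 * (4 * (1 + \<bar>t\<bar>))" by (simp add: mult_left_mono)
  have "1 + \<bar>t\<bar> \<le> 2001 * \<bar>t\<bar>" using assms(2) by simp
  then have "(1 + \<bar>t\<bar>)\<^sup>2 \<le> (2001 * \<bar>t\<bar>)\<^sup>2" by (intro power_mono) auto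
  then have "(1 / 2001)\<^sup>2 * (1 + \<bar>t\<bar>)\<^sup>2 \<le> t\<^sup>2" by (simp add: power_mult_distrib power_divide)
  with 2 have "(1 / 2001)\<^sup>2 * (1 + \<bar>t\<bar>)\<^sup>2 \<le> (s - 1)\<^sup>2 * (4 * (1 + \<bar>t\<bar>))" by linarith
  then have "((1 / 2001)\<^sup>2 / 4 * (1 + \<bar>t\<bar>)) * (1 + \<bar>t\<bar>) \<le> (s - 1)\<^sup>2 * (1 + \<bar>t\<bar>)"
    by (simp add: power2_eq_square mult_ac)
  then have "(1 / 2001)\<^sup>2 / 4 * (1 + \<bar>t\<bar>) \<le> (s - 1)\<^sup>2" by (rule mult_right_le_imp_le) simp
  with 1 show ?thesis by simp
qed

text \<open>The inequality \<open>1 + u \<le> exp u\<close> with \<open>u = ln (1 + t) / w\<close>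
  removes the double logarithm and leaves \<open>exp (T * (ln (1 + t) - t))\<close>. Of the
  resulting decay c T (1 + |t|), the constant part gives the factor exponentially small in
  \<open>T\<close>; the part with |t| absorbs \<open>(1 + t) powr \<beta>\<close> and still leaves
  \<open>exp (- \<bar>t\<bar>)\<close> for integrability.\<close>

lemma laplace_kernel_tail:
  assumes w: "w > 0" and \<beta>: "\<beta> \<ge> 0" and t: "\<bar>t\<bar> \<ge> 1 / 2000"
    and T: "T = 2 * real n / w" and c: "c = (1 / 2001)\<^sup>2 / 4" and large: "c * T / 2 \<ge> \<beta> + 1"
  shows "laplace_kernel \<beta> w n t \<le> exp (- (c * T / 2)) * exp (- \<bar>t\<bar>)"
proof (cases "exp w * (1 + t) \<ge> 1")
  case True
  have t1: "1 + t > 0"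
  proof (rule ccontr)
    assume "\<not> 1 + t > 0"
    then have "exp w * (1 + t) \<le> 0" by (intro mult_nonneg_nonpos) auto
    with True show False by simp
  qed
  \<comment> \<open>The condition \<open>x \<ge> 1\<close> makes the base nonnegative, as
    monotonicity of the power requires.\<close>
  have "0 \<le> ln (exp w * (1 + t))" using True by simp
  then have "0 \<le> w + ln (1 + t)" using t1 by (simp add: ln_mult)
  then have l0: "0 \<le> 1 + ln (1 + t) / w" using w by (simp add: field_simps)
  have "(1 + ln (1 + t) / w) ^ (2 * n) \<le> exp (ln (1 + t) / w) ^ (2 * n)"
    using l0 by (intro power_mono) (auto intro: exp_ge_add_one_self)
  also have "\<dots> = exp (T * ln (1 + t))" by (simp add: T flip: exp_of_nat_mult)
  finally have A: "(1 + ln (1 + t) / w) ^ (2 * n) * exp (- (2 * real n / w) * t) \<le> exp (T * (ln (1 + t) - t))"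
    using mult_right_mono[of _ _ "exp (- T * t)"] by (simp add: T right_diff_distrib exp_diff exp_minus divide_inverse)
  have T0: "T \<ge> 0" using w by (simp add: T)
  have "T * (ln (1 + t) - t) \<le> T * (- c * (1 + \<bar>t\<bar>))"
    unfolding c using ln_one_plus_tail[of t] t t1 T0 by (intro mult_left_mono) auto
  then have B: "(1 + ln (1 + t) / w) ^ (2 * n) * exp (- (2 * real n / w) * t) \<le> exp (- c * T * (1 + \<bar>t\<bar>))"
    using A by (smt (verit, best) exp_le_cancel_iff mult.assoc mult.commute)
  have "(1 + t) powr \<beta> \<le> exp \<bar>t\<bar> powr \<beta>"
  proof (rule powr_mono2)
    show "1 + t \<le> exp \<bar>t\<bar>" using exp_ge_add_one_self[of "\<bar>t\<bar>"] by linarith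
  qed (use t1 \<beta> in auto)
  also have "\<dots> = exp (\<beta> * \<bar>t\<bar>)" by (simp add: powr_def)
  finally have C: "(1 + t) powr \<beta> \<le> exp (\<beta> * \<bar>t\<bar>)" .
  have "laplace_kernel \<beta> w n t = (1 + t) powr \<beta> * ((1 + ln (1 + t) / w) ^ (2 * n) * exp (- (2 * real n / w) * t))"
    using True by (simp add: laplace_kernel_def)
  also have "\<dots> \<le> exp (\<beta> * \<bar>t\<bar>) * exp (- c * T * (1 + \<bar>t\<bar>))"
    using B C by (intro mult_mono) auto
  also have "\<dots> = exp (\<beta> * \<bar>t\<bar> - c * T * (1 + \<bar>t\<bar>))" by (simp flip: exp_add)
  also have "\<dots> \<le> exp (- (c * T / 2) + - \<bar>t\<bar>)"
  proof -
    have cT: "c * T / 2 \<ge> 0" using large \<beta> by linarith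
    have "(\<beta> + 1) * \<bar>t\<bar> \<le> c * T / 2 * \<bar>t\<bar>" using large by (intro mult_right_mono) auto
    moreover have "0 \<le> c * T / 2 * \<bar>t\<bar>" using cT by simp
    ultimately show ?thesis using cT by (simp add: algebra_simps)
  qed
  also have "\<dots> = exp (- (c * T / 2)) * exp (- \<bar>t\<bar>)" by (rule exp_add)
  finally show ?thesis .
qed (simp add: laplace_kernel_def)

text \<open>One bound valid for all \<open>y\<close> is wanted, ready to be integrated. Near the
  peak it is the Taylor remainder. Away from it the kernel and the polynomial are bounded
  separately: there \<open>2000 * \<bar>t\<bar> \<ge> 1\<close>, so every lower power is dominated
  by the \<open>M\<close>-th. In the factor \<open>M + 2\<close>, the 2 comes from the remainder and
  \<open>M\<close> from the polynomial.\<close>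

lemma laplace_kernel_approx:
  fixes \<sigma> y :: real
  assumes w: "w \<ge> 1" and n: "n \<ge> 1" and \<sigma>: "\<sigma>\<^sup>2 = w\<^sup>2 / (2 * real n * (w + 1))" and \<beta>: "\<beta> \<ge> 0"
    and T: "T = 2 * real n / w" and c: "c = (1 / 2001)\<^sup>2 / 4" and large: "c * T / 2 \<ge> \<beta> + 1"
  shows "\<bar>laplace_kernel \<beta> w n (\<sigma> * y) - (\<Sum>m<M. exp (- y\<^sup>2 / 2) * (laplace_poly \<beta> w m (y\<^sup>2) * (\<sigma> * y) ^ m))\<bar>
    \<le> (real M + 2) * exp \<beta> * 2000 ^ M * (\<bar>\<sigma> * y\<bar> ^ M * exp (- y\<^sup>2 / 4)) + exp (- (c * T / 2)) * exp (- \<bar>\<sigma> * y\<bar>)"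
proof -
  define t where "t = \<sigma> * y"
  have e4: "exp (- y\<^sup>2 / 2) * exp (y\<^sup>2 / 4) = exp (- y\<^sup>2 / 4)" by (simp flip: exp_add)
  have sum: "(\<Sum>m<M. exp (- y\<^sup>2 / 2) * (laplace_poly \<beta> w m (y\<^sup>2) * t ^ m)) =
     exp (- y\<^sup>2 / 2) * (\<Sum>m<M. laplace_poly \<beta> w m (y\<^sup>2) * t ^ m)" by (simp add: sum_distrib_left)
  show ?thesis
  proof (cases "\<bar>t\<bar> \<le> 1 / 2000")
    case True
    have "\<bar>laplace_kernel \<beta> w n t - (\<Sum>m<M. exp (- y\<^sup>2 / 2) * (laplace_poly \<beta> w m (y\<^sup>2) * t ^ m))\<bar> =
      exp (- y\<^sup>2 / 2) * \<bar>(1 + t) powr \<beta> * exp (y\<^sup>2 * lam w t) - (\<Sum>m<M. laplace_poly \<beta> w m (y\<^sup>2) * t ^ m)\<bar>"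
      unfolding sum laplace_kernel_center[OF w n \<sigma> t_def True] right_diff_distrib[symmetric] abs_mult by simp
    also have "\<dots> \<le> exp (- y\<^sup>2 / 2) * (2 * exp \<bar>\<beta>\<bar> * exp (y\<^sup>2 / 4) * (1000 * \<bar>t\<bar>) ^ M)"
      using laplace_poly_bounds(2)[OF w, of "y\<^sup>2" t \<beta> M] True by (intro mult_left_mono) auto
    also have "\<dots> = 2 * exp \<beta> * (1000 ^ M) * (\<bar>t\<bar> ^ M * (exp (- y\<^sup>2 / 2) * exp (y\<^sup>2 / 4)))"
      using \<beta> by (simp add: power_mult_distrib mult_ac)
    also have "\<dots> \<le> (real M + 2) * exp \<beta> * 2000 ^ M * (\<bar>t\<bar> ^ M * exp (- y\<^sup>2 / 4))"
      unfolding e4 by (intro mult_mono mult_right_mono power_mono) auto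
    also have "\<dots> \<le> \<dots> + exp (- (c * T / 2)) * exp (- \<bar>t\<bar>)" by simp
    finally show ?thesis unfolding t_def by simp
  next
    case False
    then have t: "\<bar>t\<bar> \<ge> 1 / 2000" "2000 * \<bar>t\<bar> \<ge> 1" by auto
    have "\<bar>\<Sum>m<M. exp (- y\<^sup>2 / 2) * (laplace_poly \<beta> w m (y\<^sup>2) * t ^ m)\<bar> \<le>
       (\<Sum>m<M. exp \<beta> * exp (- y\<^sup>2 / 4) * (2000 * \<bar>t\<bar>) ^ M)"
    proof (rule order.trans[OF sum_abs sum_mono])
      fix m assume "m \<in> {..<M}"
      have "\<bar>exp (- y\<^sup>2 / 2) * (laplace_poly \<beta> w m (y\<^sup>2) * t ^ m)\<bar> =
        exp (- y\<^sup>2 / 2) * (\<bar>laplace_poly \<beta> w m (y\<^sup>2)\<bar> * \<bar>t\<bar> ^ m)" by (simp add: abs_mult power_abs)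
      also have "\<dots> \<le> exp (- y\<^sup>2 / 2) * ((exp \<bar>\<beta>\<bar> * exp (y\<^sup>2 / 4) * 1000 ^ m) * \<bar>t\<bar> ^ m)"
        using laplace_poly_bounds(1)[OF w, of "y\<^sup>2" \<beta> m] by (intro mult_left_mono mult_right_mono) auto
      also have "\<dots> = exp \<beta> * (exp (- y\<^sup>2 / 2) * exp (y\<^sup>2 / 4)) * (1000 * \<bar>t\<bar>) ^ m"
        using \<beta> by (simp add: power_mult_distrib mult_ac)
      also have "\<dots> \<le> exp \<beta> * exp (- y\<^sup>2 / 4) * (2000 * \<bar>t\<bar>) ^ M"
      proof -
        have "(1000 * \<bar>t\<bar>) ^ m \<le> (2000 * \<bar>t\<bar>) ^ m" by (intro power_mono) auto
        also have "\<dots> \<le> (2000 * \<bar>t\<bar>) ^ M" using t(2) \<open>m \<in> {..<M}\<close> by (intro power_increasing) auto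
        finally show ?thesis unfolding e4 by (intro mult_left_mono) auto
      qed
      finally show "\<bar>exp (- y\<^sup>2 / 2) * (laplace_poly \<beta> w m (y\<^sup>2) * t ^ m)\<bar> \<le> exp \<beta> * exp (- y\<^sup>2 / 4) * (2000 * \<bar>t\<bar>) ^ M" .
    qed
    also have "\<dots> = real M * exp \<beta> * 2000 ^ M * (\<bar>t\<bar> ^ M * exp (- y\<^sup>2 / 4))"
      by (simp add: power_mult_distrib mult_ac)
    also have "\<dots> \<le> (real M + 2) * exp \<beta> * 2000 ^ M * (\<bar>t\<bar> ^ M * exp (- y\<^sup>2 / 4))"
      by (intro mult_right_mono) auto
    finally have 1: "\<bar>\<Sum>m<M. exp (- y\<^sup>2 / 2) * (laplace_poly \<beta> w m (y\<^sup>2) * t ^ m)\<bar> \<le> (real M + 2) * exp \<beta> * 2000 ^ M * (\<bar>t\<bar> ^ M * exp (- y\<^sup>2 / 4))" .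
    have 2: "\<bar>laplace_kernel \<beta> w n t\<bar> \<le> exp (- (c * T / 2)) * exp (- \<bar>t\<bar>)"
      using laplace_kernel_tail[OF _ \<beta> t(1) T c large] w laplace_kernel_nonneg[of \<beta> w n t] by simp
    show ?thesis using 1 2 unfolding t_def by linarith
  qed
qed

text \<open>Dominated by the sum of an exponential density and its mirror image.\<close>

lemma integrable_exp_neg_abs: "integrable lborel (\<lambda>x::real. exp (- \<bar>x\<bar>))"
proof -
  have p: "prob_space (density lborel (\<lambda>x. ennreal (exponential_density 1 x)))"
    using prob_space_exponential_density[of 1] by simp
  have "(\<integral>\<^sup>+x. ennreal (exponential_density 1 x) \<partial>lborel) = 1"
    using prob_space.emeasure_space_1[OF p] by (simp add: emeasure_density)
  then have i: "integrable lborel (exponential_density 1)"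
    by (intro integrableI_nonneg) (auto simp: exponential_density_def)
  have i2: "integrable lborel (\<lambda>x. exponential_density 1 (0 + (-1) * x))"
    by (rule lborel_integrable_real_affine[OF i]) simp
  have "integrable lborel (\<lambda>x. exponential_density 1 x + exponential_density 1 (0 + (-1) * x))"
    using i i2 by simp
  then show ?thesis
    by (rule Bochner_Integration.integrable_bound) (auto simp: exponential_density_def)
qed

lemma integrable_exp_neg_abs_scaled:
  assumes "\<sigma> > 0"
  shows "integrable lborel (\<lambda>x::real. exp (- \<bar>\<sigma> * x\<bar>))"
    and "(\<integral>x. exp (- \<bar>\<sigma> * x\<bar>) \<partial>lborel) = (\<integral>x. exp (- \<bar>x\<bar>) \<partial>lborel) / \<sigma>"
  using lborel_integrable_real_affine[OF integrable_exp_neg_abs, of \<sigma> 0]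
    lborel_integral_real_affine[of \<sigma> "\<lambda>x::real. exp (- \<bar>x\<bar>)" 0] assms by auto

lemma integrable_gaussian_moment_4: "integrable lborel (\<lambda>y::real. \<bar>y\<bar> ^ M * exp (- y\<^sup>2 / 4))"
proof -
  have "integrable lborel (\<lambda>x. sqrt (4 * pi) * (normal_density 0 (sqrt 2) x * \<bar>x - 0\<bar> ^ M))"
    by (intro integrable_mult_right integrable_normal_moment_abs) simp
  moreover have "sqrt (4 * pi) * (normal_density 0 (sqrt 2) x * \<bar>x - 0\<bar> ^ M) = \<bar>x\<bar> ^ M * exp (- x\<^sup>2 / 4)" for x
    by (simp add: normal_density_def)
  ultimately show ?thesis by (simp only:)
qed

text \<open>Odd orders integrate to 0, so truncating at order \<open>2 * R\<close> in
  \<open>t\<close> leaves \<open>R\<close> coefficients and an error of order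
  \<open>\<sigma> ^ (2 * R)\<close>, where \<open>\<sigma>\<^sup>2\<close> is at most
  \<open>w / (2 * n)\<close>. Integrability of the kernel comes out as well, by writing it as the
  dominated difference plus the polynomial part.\<close>

lemma laplace_kernel_integral:
  fixes \<sigma> :: real
  assumes w: "w \<ge> 1" and n: "n \<ge> 1" and \<sigma>: "\<sigma>\<^sup>2 = w\<^sup>2 / (2 * real n * (w + 1))" "\<sigma> > 0" and \<beta>: "\<beta> \<ge> 0"
    and T: "T = 2 * real n / w" and c: "c = (1 / 2001)\<^sup>2 / 4" and large: "c * T / 2 \<ge> \<beta> + 1"
  shows "integrable lborel (\<lambda>y. laplace_kernel \<beta> w n (\<sigma> * y))"
    and "\<bar>(\<integral>y. laplace_kernel \<beta> w n (\<sigma> * y) \<partial>lborel) - sqrt (2 * pi) * (\<Sum>r<R. a_coeff \<beta> r w / (2 * real n) ^ r)\<bar>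
    \<le> (2 * real R + 2) * exp \<beta> * 2000 ^ (2 * R) * (\<sigma> ^ (2 * R) * (\<integral>y. \<bar>y\<bar> ^ (2 * R) * exp (- y\<^sup>2 / 4) \<partial>lborel))
      + exp (- (c * T / 2)) * ((\<integral>y. exp (- \<bar>y\<bar>) \<partial>lborel) / \<sigma>)"
proof -
  define P where "P = (\<lambda>y. \<Sum>m<2*R. exp (- y\<^sup>2 / 2) * (laplace_poly \<beta> w m (y\<^sup>2) * (\<sigma> * y) ^ m))"
  define K where "K = (\<lambda>y. laplace_kernel \<beta> w n (\<sigma> * y))"
  define D where "D = (2 * real R + 2) * exp \<beta> * 2000 ^ (2 * R)"
  define B where "B = (\<lambda>y. D * (\<sigma> ^ (2 * R) * (\<bar>y\<bar> ^ (2 * R) * exp (- y\<^sup>2 / 4))) + exp (- (c * T / 2)) * exp (- \<bar>\<sigma> * y\<bar>))"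
  have Bi: "has_bochner_integral lborel B (D * (\<sigma> ^ (2 * R) * (\<integral>y. \<bar>y\<bar> ^ (2 * R) * exp (- y\<^sup>2 / 4) \<partial>lborel))
      + exp (- (c * T / 2)) * ((\<integral>y. exp (- \<bar>y\<bar>) \<partial>lborel) / \<sigma>))"
    unfolding B_def integrable_exp_neg_abs_scaled(2)[OF \<sigma>(2), symmetric]
    by (intro has_bochner_integral_add has_bochner_integral_mult_right has_bochner_integral_integrable
         integrable_gaussian_moment_4 integrable_exp_neg_abs_scaled \<sigma>)
  have "has_bochner_integral lborel P (\<Sum>m<2*R. if even m then sqrt (2 * pi) * (a_coeff \<beta> (m div 2) w / (2 * real n) ^ (m div 2)) else 0)"
    unfolding P_def by (intro has_bochner_integral_sum laplace_poly_integral \<sigma>)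
  also have "(\<Sum>m<2*R. if even m then sqrt (2 * pi) * (a_coeff \<beta> (m div 2) w / (2 * real n) ^ (m div 2)) else 0) =
     sqrt (2 * pi) * (\<Sum>r<R. a_coeff \<beta> r w / (2 * real n) ^ r)"
    by (induction R) (auto simp: distrib_left)
  finally have Pi: "has_bochner_integral lborel P (sqrt (2 * pi) * (\<Sum>r<R. a_coeff \<beta> r w / (2 * real n) ^ r))" .
  have bound: "\<bar>K y - P y\<bar> \<le> B y" for y
  proof -
    have "\<bar>K y - P y\<bar> \<le> (real (2 * R) + 2) * exp \<beta> * 2000 ^ (2 * R) * (\<bar>\<sigma> * y\<bar> ^ (2 * R) * exp (- y\<^sup>2 / 4)) + exp (- (c * T / 2)) * exp (- \<bar>\<sigma> * y\<bar>)"
      unfolding K_def P_def by (rule laplace_kernel_approx[OF w n \<sigma>(1) \<beta> T c large])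
    also have "\<dots> = B y" using \<sigma>(2) by (simp add: B_def D_def abs_mult power_mult_distrib mult_ac)
    finally show ?thesis .
  qed
  have meas: "K \<in> borel_measurable lborel" unfolding K_def laplace_kernel_def by measurable
  have Pint: "integrable lborel P" and Bint: "integrable lborel B" using Pi Bi by (auto simp: has_bochner_integral_iff)
  have "integrable lborel (\<lambda>y. K y - P y)"
  proof (rule Bochner_Integration.integrable_bound[OF Bint])
    show "(\<lambda>y. K y - P y) \<in> borel_measurable lborel" using meas borel_measurable_integrable[OF Pint] by measurable
    show "AE y in lborel. norm (K y - P y) \<le> norm (B y)"
      using order.trans[OF bound abs_ge_self] by simp
  qed
  note KP = this
  have "integrable lborel (\<lambda>y. (K y - P y) + P y)" using KP Pint by (rule Bochner_Integration.integrable_add)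
  then have Kint: "integrable lborel K" by simp
  then show "integrable lborel (\<lambda>y. laplace_kernel \<beta> w n (\<sigma> * y))" by (simp add: K_def)
  have "\<bar>integral\<^sup>L lborel K - integral\<^sup>L lborel P\<bar> = \<bar>\<integral>y. K y - P y \<partial>lborel\<bar>"
    using Kint Pint by simp
  also have "\<dots> \<le> (\<integral>y. \<bar>K y - P y\<bar> \<partial>lborel)"
    using integral_norm_bound[of lborel "\<lambda>y. K y - P y"] by simp
  also have "\<dots> \<le> integral\<^sup>L lborel B"
    using bound KP Bint by (intro integral_mono) auto
  also have "integral\<^sup>L lborel P = sqrt (2 * pi) * (\<Sum>r<R. a_coeff \<beta> r w / (2 * real n) ^ r)"
    using Pi by (simp add: has_bochner_integral_iff)
  also have "integral\<^sup>L lborel B = D * (\<sigma> ^ (2 * R) * (\<integral>y. \<bar>y\<bar> ^ (2 * R) * exp (- y\<^sup>2 / 4) \<partial>lborel))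
      + exp (- (c * T / 2)) * ((\<integral>y. exp (- \<bar>y\<bar>) \<partial>lborel) / \<sigma>)"
    using Bi by (simp add: has_bochner_integral_iff)
  finally show "\<bar>(\<integral>y. laplace_kernel \<beta> w n (\<sigma> * y) \<partial>lborel) - sqrt (2 * pi) * (\<Sum>r<R. a_coeff \<beta> r w / (2 * real n) ^ r)\<bar>
    \<le> (2 * real R + 2) * exp \<beta> * 2000 ^ (2 * R) * (\<sigma> ^ (2 * R) * (\<integral>y. \<bar>y\<bar> ^ (2 * R) * exp (- y\<^sup>2 / 4) \<partial>lborel))
      + exp (- (c * T / 2)) * ((\<integral>y. exp (- \<bar>y\<bar>) \<partial>lborel) / \<sigma>)"
    unfolding K_def D_def .
qed

section \<open>Asymptotics of one logarithmic moment\<close>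

definition log_moment_integrand :: "real \<Rightarrow> nat \<Rightarrow> real \<Rightarrow> real" where
  "log_moment_integrand \<beta> n x = indicator {1..} x * (x powr \<beta> * exp (- pi * x) * ln x ^ (2 * n))"

text \<open>The value of the integrand at \<open>x = exp w\<close>, where
  \<open>pi * exp w = 2 * n / w\<close>, times the Jacobian \<open>exp w * \<sigma>\<close> of
  \<open>x = exp w * (1 + \<sigma> * y)\<close>. The Gaussian mass \<open>sqrt (2 * pi)\<close> is
  kept apart.\<close>

definition laplace_prefactor :: "real \<Rightarrow> nat \<Rightarrow> real \<Rightarrow> real" where
  "laplace_prefactor \<beta> n w = exp ((\<beta> + 1) * w) * w ^ (2 * n) * exp (- (2 * real n / w)) * sqrt (w\<^sup>2 / (2 * real n * (w + 1)))"

lemma log_moment_substitution: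
  assumes w: "w \<ge> 1" and n: "2 * real n = pi * w * exp w"
  shows "log_moment_integrand \<beta> n (exp w + (exp w * \<sigma>) * y) =
    exp (\<beta> * w) * w ^ (2 * n) * exp (- (2 * real n / w)) * laplace_kernel \<beta> w n (\<sigma> * y)"
proof -
  define t where "t = \<sigma> * y"
  have x: "exp w + (exp w * \<sigma>) * y = exp w * (1 + t)" by (simp add: t_def algebra_simps)
  show ?thesis
  proof (cases "exp w * (1 + t) \<ge> 1")
    case True
    have t1: "1 + t > 0"
    proof (rule ccontr)
      assume "\<not> 1 + t > 0"
      then have "exp w * (1 + t) \<le> 0" by (intro mult_nonneg_nonpos) auto
      with True show False by simp
    qed
    have "ln (exp w * (1 + t)) = w + ln (1 + t)" using t1 by (simp add: ln_mult)
    also have "\<dots> = w * (1 + ln (1 + t) / w)" using w by (simp add: distrib_left)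
    finally have "ln (exp w * (1 + t)) = w * (1 + ln (1 + t) / w)" .
    moreover have "pi * (exp w * (1 + t)) = 2 * real n / w + 2 * real n / w * t"
      using w unfolding n by (simp add: algebra_simps)
    then have "exp (- pi * (exp w * (1 + t))) = exp (- (2 * real n / w)) * exp (- (2 * real n / w) * t)"
      by (simp flip: exp_add)
    moreover have "(exp w * (1 + t)) powr \<beta> = exp (\<beta> * w) * (1 + t) powr \<beta>"
      using t1 by (subst powr_mult) (simp_all add: powr_def)
    ultimately show ?thesis using True
      unfolding x t_def[symmetric] log_moment_integrand_def laplace_kernel_def
      by (simp add: power_mult_distrib mult_ac)
  qed (simp add: x t_def[symmetric] log_moment_integrand_def laplace_kernel_def)
qed

text \<open>The large parameter is \<open>T = 2 * n / w = pi * exp w\<close>: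
  \<open>\<sigma>\<^sup>2 \<le> 1 / T\<close> bounds the Taylor error, and the tail is exponentially
  small in \<open>T\<close>. Quantifying over all pairs \<open>w\<close>, \<open>n\<close> tied by
  the saddle point equation records the uniformity.\<close>

theorem log_moment_asymptotics:
  fixes \<beta> :: real
  assumes \<beta>: "\<beta> \<ge> 0"
  shows "\<exists>C W. W \<ge> 1 \<and> (\<forall>w n. w \<ge> W \<longrightarrow> 2 * real n = pi * w * exp w \<longrightarrow>
     integrable lborel (log_moment_integrand \<beta> n) \<and>
     \<bar>integral\<^sup>L lborel (log_moment_integrand \<beta> n) / (laplace_prefactor \<beta> n w * sqrt (2 * pi))
       - (\<Sum>r<R. a_coeff \<beta> r w / (2 * real n) ^ r)\<bar> \<le> C * (w / real n) ^ R)"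
proof -
  define c :: real where "c = (1 / 2001)\<^sup>2 / 4"
  have c0: "c > 0" by (simp add: c_def)
  define D where "D = (2 * real R + 2) * exp \<beta> * 2000 ^ (2 * R) * (\<integral>y. \<bar>y\<bar> ^ (2 * R) * exp (- y\<^sup>2 / 4) \<partial>lborel)"
  define E where "E = (\<integral>y. exp (- \<bar>y::real\<bar>) \<partial>lborel)"
  have D0: "D \<ge> 0" unfolding D_def by (intro mult_nonneg_nonneg Bochner_Integration.integral_nonneg) auto
  have E0: "E \<ge> 0" unfolding E_def by (intro Bochner_Integration.integral_nonneg) auto
  \<comment> \<open>One power more than \<open>R\<close>, because the tail term carries
    \<open>1 / \<sigma>\<close>, for which the bound is \<open>2 * T\<close>.\<close>
  have "eventually (\<lambda>x::real. x ^ (R + 1) / exp x < 1) at_top"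
    using tendsto_power_div_exp_0[of "R + 1"] by (rule order_tendstoD) simp
  then obtain X :: real where X: "\<And>x. x \<ge> X \<Longrightarrow> x ^ (R + 1) / exp x < 1" unfolding eventually_at_top_linorder by blast
  \<comment> \<open>As \<open>T \<ge> w\<close>, a threshold on \<open>w\<close> is a threshold on
    \<open>T\<close>; the last two entries give \<open>c * T / 2 \<ge> X\<close> and the hypothesis
    of the tail estimate.\<close>
  define W where "W = max 1 (max (2 * X / c) (2 * (\<beta> + 1) / c))"
  define C where "C = (D * 1 + E * 2 * (2 / c) ^ (R + 1)) / sqrt (2 * pi)"
  have C0: "C \<ge> 0" unfolding C_def using D0 E0 c0 by (intro divide_nonneg_nonneg add_nonneg_nonneg mult_nonneg_nonneg) auto
  show ?thesis
  proof (rule exI[of _ C], rule exI[of _ W], intro conjI allI impI)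
    show "W \<ge> 1" by (simp add: W_def)
    fix w :: real and n :: nat
    assume wW: "w \<ge> W" and n2: "2 * real n = pi * w * exp w"
    have w: "w \<ge> 1" using wW by (simp add: W_def)
    have "pi * w * exp w > 0" using w by simp
    then have n: "n \<ge> 1" unfolding n2[symmetric] by simp
    define T where "T = 2 * real n / w"
    have T: "T = pi * exp w" using w n2 by (simp add: T_def)
    have "w \<le> 1 * exp w" using exp_ge_add_one_self[of w] by linarith
    also have "\<dots> \<le> pi * exp w" using pi_gt3 by (intro mult_right_mono) auto
    finally have Tw: "T \<ge> w" by (simp add: T)
    have T1: "T \<ge> 1" using Tw w by simp
    have cT1: "c * T / 2 \<ge> X" and large: "c * T / 2 \<ge> \<beta> + 1"
    proof -
      have "T \<ge> 2 * X / c" "T \<ge> 2 * (\<beta> + 1) / c" using Tw wW by (auto simp: W_def)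
      then show "c * T / 2 \<ge> X" "c * T / 2 \<ge> \<beta> + 1" using c0 by (auto simp: field_simps)
    qed
    define \<sigma> where "\<sigma> = sqrt (w\<^sup>2 / (2 * real n * (w + 1)))"
    have \<sigma>2: "\<sigma>\<^sup>2 = w\<^sup>2 / (2 * real n * (w + 1))" unfolding \<sigma>_def using w by simp
    have \<sigma>0: "\<sigma> > 0" unfolding \<sigma>_def using w n by simp
    have \<sigma>T: "\<sigma>\<^sup>2 = w / (w + 1) / T" unfolding \<sigma>2 T_def using w n by (simp add: power2_eq_square)
    have s1: "\<sigma>\<^sup>2 \<le> 1 / T" unfolding \<sigma>T using w T1 by (intro divide_right_mono) auto
    have "1 / 2 \<le> w / (w + 1)" using w by (simp add: field_simps)
    then have "1 / 2 / T \<le> w / (w + 1) / T" using T1 by (intro divide_right_mono) auto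
    then have s2: "1 / (2 * T) \<le> \<sigma>\<^sup>2" unfolding \<sigma>T by simp
    have "(1 / \<sigma>)\<^sup>2 \<le> 2 * T"
      using s2 \<sigma>0 T1 by (simp add: power_divide field_simps)
    also have "\<dots> \<le> (2 * T)\<^sup>2" using T1 by (simp add: power2_eq_square)
    finally have inv_s: "1 / \<sigma> \<le> 2 * T" by (rule power2_le_imp_le) (use T1 in auto)
    note KI = laplace_kernel_integral[OF w n \<sigma>2 \<sigma>0 \<beta> T_def c_def large]
    define pre where "pre = exp (\<beta> * w) * w ^ (2 * n) * exp (- (2 * real n / w))"
    have pre0: "pre > 0" unfolding pre_def using w by simp
    have sub: "(\<lambda>y. log_moment_integrand \<beta> n (exp w + (exp w * \<sigma>) * y)) = (\<lambda>y. pre * laplace_kernel \<beta> w n (\<sigma> * y))"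
      unfolding pre_def by (rule ext) (rule log_moment_substitution[OF w n2])
    have ne: "exp w * \<sigma> \<noteq> 0" using \<sigma>0 by simp
    have "integrable lborel (\<lambda>y. log_moment_integrand \<beta> n (exp w + (exp w * \<sigma>) * y))"
      unfolding sub by (intro integrable_mult_right KI(1))
    then show "integrable lborel (log_moment_integrand \<beta> n)"
      using lborel_integrable_real_affine_iff[OF ne] by blast
    have I: "integral\<^sup>L lborel (log_moment_integrand \<beta> n) = exp w * \<sigma> * (pre * (\<integral>y. laplace_kernel \<beta> w n (\<sigma> * y) \<partial>lborel))"
      using lborel_integral_real_affine[OF ne, of "log_moment_integrand \<beta> n" "exp w"] \<sigma>0 unfolding sub by simp
    have LP: "laplace_prefactor \<beta> n w = exp w * \<sigma> * pre"
    proof -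
      have "exp ((\<beta> + 1) * w) = exp (\<beta> * w) * exp w" by (simp add: distrib_right exp_add)
      then show ?thesis unfolding laplace_prefactor_def pre_def \<sigma>_def by (simp only: mult_ac)
    qed
    have ratio: "integral\<^sup>L lborel (log_moment_integrand \<beta> n) / (laplace_prefactor \<beta> n w * sqrt (2 * pi)) =
      (\<integral>y. laplace_kernel \<beta> w n (\<sigma> * y) \<partial>lborel) / sqrt (2 * pi)"
      unfolding I LP using pre0 \<sigma>0 by simp
    have "\<bar>integral\<^sup>L lborel (log_moment_integrand \<beta> n) / (laplace_prefactor \<beta> n w * sqrt (2 * pi)) - (\<Sum>r<R. a_coeff \<beta> r w / (2 * real n) ^ r)\<bar>
      = \<bar>(\<integral>y. laplace_kernel \<beta> w n (\<sigma> * y) \<partial>lborel) - sqrt (2 * pi) * (\<Sum>r<R. a_coeff \<beta> r w / (2 * real n) ^ r)\<bar> / sqrt (2 * pi)"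
    proof -
      have "\<bar>A / q - S\<bar> = \<bar>A - q * S\<bar> / q" if "q > 0" for A q S :: real
      proof -
        have e: "A - q * S = q * (A / q - S)" using that by (simp add: right_diff_distrib)
        show ?thesis unfolding e abs_mult using that by simp
      qed
      then show ?thesis unfolding ratio by simp
    qed
    also have "\<dots> \<le> (D * (\<sigma>\<^sup>2) ^ R + exp (- (c * T / 2)) * (E * (1 / \<sigma>))) / sqrt (2 * pi)"
      using KI(2)[of R] unfolding D_def E_def by (intro divide_right_mono) (auto simp: mult_ac simp flip: power_mult)
    also have "\<dots> \<le> (D * (1 / T) ^ R + (2 / (c * T)) ^ (R + 1) * (E * (2 * T))) / sqrt (2 * pi)"
    proof (intro divide_right_mono add_mono mult_mono power_mono s1 inv_s)
      have p: "c * T / 2 > 0" using c0 T1 by simp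
      have "(c * T / 2) ^ (R + 1) < exp (c * T / 2)" using X[OF cT1] by (simp add: field_simps)
      then have "inverse (exp (c * T / 2)) \<le> inverse ((c * T / 2) ^ (R + 1))"
        using p by (intro le_imp_inverse_le) auto
      then show "exp (- (c * T / 2)) \<le> (2 / (c * T)) ^ (R + 1)"
      proof -
        have e: "2 / (c * T) = inverse (c * T / 2)" by simp
        show ?thesis unfolding e power_inverse exp_minus by fact
      qed
    qed (use D0 E0 \<sigma>0 c0 T1 in auto)
    also have "\<dots> = C * (1 / T) ^ R"
      using T1 c0 unfolding C_def by (simp add: power_divide power_mult_distrib divide_simps)
    also have "\<dots> \<le> C * (w / real n) ^ R"
      unfolding T_def using w n C0 by (intro mult_left_mono power_mono) (auto simp: field_simps)
    finally show "\<bar>integral\<^sup>L lborel (log_moment_integrand \<beta> n) / (laplace_prefactor \<beta> n w * sqrt (2 * pi)) - (\<Sum>r<R. a_coeff \<beta> r w / (2 * real n) ^ r)\<bar> \<le> C * (w / real n) ^ R" .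
  qed
qed

section \<open>Jacobi's theta inversion\<close>

text \<open>Completeness of the cosines, which avoids pointwise convergence of Fourier series.
  Addition formulas make \<open>h\<close> orthogonal to all polynomials in cos (2 pi t); as this
  cosine is injective on \<open>{0..1/2}\<close>, such polynomials approximate \<open>h\<close>
  uniformly by Weierstrass, so the integral of h^2 is 0.\<close>

lemma cos_orthogonal_imp_zero:
  fixes h :: "real \<Rightarrow> real"
  assumes cont: "continuous_on {0..1/2} h"
    and orth: "\<And>k::nat. integral {0..1/2} (\<lambda>t. h t * cos (2 * pi * real k * t)) = 0"
    and t: "t \<in> {0..1/2}"
  shows "h t = 0"
proof -
  have ci [continuous_intros]: "continuous_on {0..1/2} (\<lambda>t. h t * f t)" if "continuous_on {0..1/2} f" for f :: "real \<Rightarrow> real"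
    using cont that by (rule continuous_on_mult)
  have int: "(\<lambda>t. h t * f t) integrable_on {0..1/2}" if "continuous_on {0..1/2} f" for f :: "real \<Rightarrow> real"
    by (rule integrable_continuous_real) (intro ci that)
  have pow: "integral {0..1/2} (\<lambda>t. h t * (cos (2 * pi * real k * t) * cos (2 * pi * t) ^ i)) = 0" for i k
  proof (induction i arbitrary: k)
    case 0
    then show ?case using orth by simp
  next
    case (Suc i)
    show ?case
    proof (cases k)
      case 0
      then show ?thesis using Suc[of 1] by simp
    next
      case (Suc k')
      have "cos (2 * pi * real k * t) * cos (2 * pi * t) ^ Suc i =
        (1/2) * (cos (2 * pi * real (Suc k) * t) * cos (2 * pi * t) ^ i) + (1/2) * (cos (2 * pi * real k' * t) * cos (2 * pi * t) ^ i)" for t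
      proof -
        have e: "2 * pi * real (Suc k) * t = 2 * pi * real k * t + 2 * pi * t" "2 * pi * real k' * t = 2 * pi * real k * t - 2 * pi * t"
          by (simp_all add: Suc algebra_simps)
        have "cos A * (cos B * P) = (1/2) * (cos (A + B) * P) + (1/2) * (cos (A - B) * P)" for A B P :: real
          by (simp add: cos_add cos_diff algebra_simps)
        then show ?thesis by (simp only: e power_Suc)
      qed
      then have "integral {0..1/2} (\<lambda>t. h t * (cos (2 * pi * real k * t) * cos (2 * pi * t) ^ Suc i)) =
        integral {0..1/2} (\<lambda>t. (1/2) * (h t * (cos (2 * pi * real (Suc k) * t) * cos (2 * pi * t) ^ i)) + (1/2) * (h t * (cos (2 * pi * real k' * t) * cos (2 * pi * t) ^ i)))"
        by (intro arg_cong[where f = "integral {0..1/2}"] ext) (simp only: distrib_left mult_ac)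
      also have "\<dots> = (1/2) * integral {0..1/2} (\<lambda>t. h t * (cos (2 * pi * real (Suc k) * t) * cos (2 * pi * t) ^ i)) + (1/2) * integral {0..1/2} (\<lambda>t. h t * (cos (2 * pi * real k' * t) * cos (2 * pi * t) ^ i))"
        by (subst Henstock_Kurzweil_Integration.integral_add) (auto intro!: int integrable_on_cmult_left continuous_intros)
      also have "\<dots> = 0" unfolding Suc.IH by simp
      finally show ?thesis .
    qed
  qed
  have poly: "integral {0..1/2} (\<lambda>t. h t * (\<Sum>i\<le>N. a i * cos (2 * pi * t) ^ i)) = 0" for a and N :: nat
  proof -
    have "integral {0..1/2} (\<lambda>t. h t * (\<Sum>i\<le>N. a i * cos (2 * pi * t) ^ i)) = integral {0..1/2} (\<lambda>t. \<Sum>i\<le>N. a i * (h t * (cos (2 * pi * real 0 * t) * cos (2 * pi * t) ^ i)))"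
      by (intro arg_cong[where f = "integral {0..1/2}"] ext) (simp add: sum_distrib_left mult_ac)
    also have "\<dots> = (\<Sum>i\<le>N. integral {0..1/2} (\<lambda>t. a i * (h t * (cos (2 * pi * real 0 * t) * cos (2 * pi * t) ^ i))))"
    proof (rule Henstock_Kurzweil_Integration.integral_sum)
      fix i show "(\<lambda>t. a i * (h t * (cos (2 * pi * real 0 * t) * cos (2 * pi * t) ^ i))) integrable_on {0..1/2}"
        using int[of "\<lambda>t. a i * (cos (2 * pi * real 0 * t) * cos (2 * pi * t) ^ i)"]
        by (simp add: mult_ac continuous_intros)
    qed simp
    also have "\<dots> = 0" by (simp only: Henstock_Kurzweil_Integration.integral_mult_right pow) simp
    finally show ?thesis .
  qed
  have "continuous_on {-1..1} (\<lambda>y. h (arccos y / (2 * pi)))"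
  proof (rule continuous_on_compose2[OF cont])
    show "continuous_on {-1..1} (\<lambda>y. arccos y / (2 * pi))" by (intro continuous_intros) auto
    show "(\<lambda>y. arccos y / (2 * pi)) ` {-1..1} \<subseteq> {0..1/2}"
      using arccos_lbound arccos_ubound by (auto simp: field_simps)
  qed
  note phi = this
  define I where "I = integral {0..1/2} (\<lambda>t. h t * h t)"
  define A where "A = integral {0..1/2} (\<lambda>t. \<bar>h t\<bar>)"
  have A0: "A \<ge> 0" unfolding A_def by (intro integral_nonneg integrable_continuous_real continuous_intros cont) auto
  have I0: "I \<ge> 0" unfolding I_def by (intro integral_nonneg integrable_continuous_real continuous_intros cont) auto
  \<comment> \<open>\<open>A + 1\<close> instead of \<open>A\<close> permits the later choice of
    \<open>e\<close> by division even when \<open>A = 0\<close>.\<close>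
  have "I \<le> e * (A + 1)" if e: "e > 0" for e
  proof -
    obtain p where p: "real_polynomial_function p" "\<And>y. y \<in> {-1..1} \<Longrightarrow> \<bar>h (arccos y / (2 * pi)) - p y\<bar> < e"
      using Stone_Weierstrass_real_polynomial_function[OF compact_Icc phi e] by blast
    obtain a and N :: nat where pa: "p = (\<lambda>x. \<Sum>i\<le>N. a i * x ^ i)"
      using p(1) unfolding real_polynomial_function_iff_sum by blast
    have pc: "continuous_on {0..1/2} (\<lambda>t. p (cos (2 * pi * t)))" unfolding pa by (intro continuous_intros)
    have close: "\<bar>h t - p (cos (2 * pi * t))\<bar> \<le> e" if "t \<in> {0..1/2}" for t
    proof -
      have "arccos (cos (2 * pi * t)) = 2 * pi * t" using that by (intro arccos_cos) auto
      then show ?thesis using p(2)[of "cos (2 * pi * t)"] by simp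
    qed
    have "I = integral {0..1/2} (\<lambda>t. h t * h t) - integral {0..1/2} (\<lambda>t. h t * p (cos (2 * pi * t)))"
      unfolding I_def pa poly by simp
    also have "\<dots> = integral {0..1/2} (\<lambda>t. h t * h t - h t * p (cos (2 * pi * t)))"
      by (rule Henstock_Kurzweil_Integration.integral_diff[symmetric]) (intro int cont pc)+
    also have "\<dots> \<le> integral {0..1/2} (\<lambda>t. e * \<bar>h t\<bar>)"
    proof (rule integral_le)
      show "(\<lambda>t. h t * h t - h t * p (cos (2 * pi * t))) integrable_on {0..1/2}"
        "(\<lambda>t. e * \<bar>h t\<bar>) integrable_on {0..1/2}"
        by (intro integrable_continuous_real continuous_intros cont pc)+
      fix t :: real assume t: "t \<in> {0..1/2}"
      have "h t * h t - h t * p (cos (2 * pi * t)) \<le> \<bar>h t\<bar> * \<bar>h t - p (cos (2 * pi * t))\<bar>"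
        unfolding abs_mult[symmetric] by (simp add: right_diff_distrib)
      also have "\<dots> \<le> \<bar>h t\<bar> * e" using close[OF t] by (intro mult_left_mono) auto
      finally show "h t * h t - h t * p (cos (2 * pi * t)) \<le> e * \<bar>h t\<bar>" by (simp add: mult.commute)
    qed
    also have "\<dots> = e * A" unfolding A_def by simp
    also have "\<dots> \<le> e * (A + 1)" using e by simp
    finally show ?thesis .
  qed
  note small = this
  have "I \<le> 0"
  proof (rule field_le_epsilon)
    fix \<epsilon> :: real assume "\<epsilon> > 0"
    then show "I \<le> 0 + \<epsilon>" using small[of "\<epsilon> / (A + 1)"] A0 by simp
  qed
  with I0 have "I = 0" by simp
  then have "\<forall>t\<in>{0..1/2}. h t * h t = 0"
    unfolding I_def by (subst (asm) integral_eq_0_iff) (auto intro!: continuous_intros cont)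
  then show ?thesis using t by auto
qed

text \<open>The real part of the characteristic function of the standard normal law, rescaled by
  \<open>s = sqrt (2 * pi * x)\<close>.\<close>

lemma gaussian_cos_integral:
  fixes x c :: real
  assumes x: "x > 0"
  shows "has_bochner_integral lborel (\<lambda>u. exp (- pi * x * u\<^sup>2) * cos (2 * pi * c * u)) (exp (- pi * c\<^sup>2 / x) / sqrt x)"
proof -
  have st: "has_bochner_integral lborel (\<lambda>u. std_normal_density u * cos (t * u)) (exp (- (t\<^sup>2) / 2))" for t :: real
  proof -
    interpret real_distribution std_normal_distribution by (rule real_dist_normal_dist)
    have int: "integrable std_normal_distribution (\<lambda>x. iexp (t * x))"
      by (rule integrable_iexp) auto
    have "complex_of_real (exp (- (t\<^sup>2) / 2)) = (CLINT x|std_normal_distribution. iexp (t * x))"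
      using fun_cong[OF char_std_normal_distribution, of t] by (simp add: char_def)
    then have "Re (CLINT x|std_normal_distribution. iexp (t * x)) = exp (- (t\<^sup>2) / 2)"
      by (metis Re_complex_of_real)
    then have 1: "(\<integral>x. cos (t * x) \<partial>std_normal_distribution) = exp (- (t\<^sup>2) / 2)"
      using integral_Re[OF int] by (simp add: Re_exp)
    have 2: "integrable std_normal_distribution (\<lambda>x. cos (t * x))"
      using integrable_Re[OF int] by (simp add: Re_exp)
    have "integrable lborel (\<lambda>u. std_normal_density u *\<^sub>R cos (t * u))"
      using 2 by (subst (asm) integrable_density) (auto simp: normal_density_nonneg)
    moreover have "(\<integral>u. std_normal_density u *\<^sub>R cos (t * u) \<partial>lborel) = exp (- (t\<^sup>2) / 2)"
      using 1 by (subst (asm) integral_density) (auto simp: normal_density_nonneg)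
    ultimately show ?thesis by (simp add: has_bochner_integral_iff)
  qed
  define s where "s = sqrt (2 * pi * x)"
  have s: "s > 0" "s\<^sup>2 = 2 * pi * x" using x by (auto simp: s_def)
  have "has_bochner_integral lborel (\<lambda>u. std_normal_density (0 + s * u) * cos ((2 * pi * c / s) * (0 + s * u))) (exp (- ((2 * pi * c / s)\<^sup>2) / 2) /\<^sub>R \<bar>s\<bar>)"
    using lborel_has_bochner_integral_real_affine_iff[of s "\<lambda>u. std_normal_density u * cos ((2 * pi * c / s) * u)" _ 0] st[of "2 * pi * c / s"] s by simp
  from has_bochner_integral_mult_right[OF this, of "sqrt (2 * pi)"]
  have 1: "has_bochner_integral lborel (\<lambda>u. sqrt (2 * pi) * (std_normal_density (0 + s * u) * cos ((2 * pi * c / s) * (0 + s * u)))) (sqrt (2 * pi) * (exp (- ((2 * pi * c / s)\<^sup>2) / 2) /\<^sub>R \<bar>s\<bar>))" by simp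
  have "sqrt (2 * pi) * (std_normal_density (0 + s * u) * cos ((2 * pi * c / s) * (0 + s * u))) = exp (- pi * x * u\<^sup>2) * cos (2 * pi * c * u)" for u
    using s by (simp add: std_normal_density_def power_mult_distrib mult_ac)
  moreover have "(2 * pi * c / s)\<^sup>2 / 2 = pi * c\<^sup>2 / x"
    unfolding power_divide s(2) by (simp add: power2_eq_square)
  then have "sqrt (2 * pi) * (exp (- ((2 * pi * c / s)\<^sup>2) / 2) /\<^sub>R \<bar>s\<bar>) = exp (- pi * c\<^sup>2 / x) / sqrt x"
  proof -
    have "- ((2 * pi * c / s)\<^sup>2) / 2 = - pi * c\<^sup>2 / x" using \<open>(2 * pi * c / s)\<^sup>2 / 2 = pi * c\<^sup>2 / x\<close> by simp
    moreover have "s = sqrt (2 * pi) * sqrt x" unfolding s_def by (simp add: real_sqrt_mult)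
    moreover have "y * (E /\<^sub>R \<bar>y * z\<bar>) = E / z" if "y > 0" "z > 0" for y z E :: real
      using that by (simp add: abs_mult inverse_eq_divide)
    ultimately show ?thesis using x by (simp only:) simp
  qed
  ultimately show ?thesis using 1 by simp
qed

text \<open>Half of the full integral, by evenness. The upper limits are integers because unfolding
  the first N terms of a periodised sum produces the integral over \<open>{0..N}\<close>.\<close>

lemma gaussian_cos_integral_half:
  fixes x c :: real
  assumes x: "x > 0"
  shows "(\<lambda>N. integral {0..real N} (\<lambda>u. exp (- pi * x * u\<^sup>2) * cos (2 * pi * c * u))) \<longlonglongrightarrow> exp (- pi * c\<^sup>2 / x) / sqrt x / 2"
proof -
  define q where "q = (\<lambda>u. exp (- pi * x * u\<^sup>2) * cos (2 * pi * c * u))"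
  have q: "has_bochner_integral lborel q (exp (- pi * c\<^sup>2 / x) / sqrt x)"
    unfolding q_def by (rule gaussian_cos_integral[OF x])
  have qi: "integrable lborel q" using q by (simp add: has_bochner_integral_iff)
  have qe: "q (- u) = q u" for u by (simp add: q_def)
  have si: "set_integrable lborel A q" if "A \<in> sets borel" for A
    unfolding set_integrable_def using qi that by (intro integrable_mult_indicator) auto
  have "(LINT u:{0..}|lborel. q u) = exp (- pi * c\<^sup>2 / x) / sqrt x / 2"
  proof -
    have 1: "(LINT u:{..0}|lborel. q u) = (LINT u:{0..}|lborel. q u)"
    proof -
      have "(LINT u:{..0}|lborel. q u) = (\<integral>u. indicator {..0} (0 + (-1) * u) *\<^sub>R q (0 + (-1) * u) \<partial>lborel)"
        unfolding set_lebesgue_integral_def by (subst lborel_integral_real_affine[of "-1" _ 0]) auto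
      also have "\<dots> = (LINT u:{0..}|lborel. q u)"
        unfolding set_lebesgue_integral_def by (intro Bochner_Integration.integral_cong) (auto simp: qe indicator_def)
      finally show ?thesis .
    qed
    have "(LINT u:{..0} \<union> {0<..}|lborel. q u) = (LINT u:{..0}|lborel. q u) + (LINT u:{0<..}|lborel. q u)"
      by (intro set_integral_Un si) auto
    moreover have "(LINT u:{0<..}|lborel. q u) = (LINT u:{0..}|lborel. q u)"
    proof -
      have [measurable]: "q \<in> borel_measurable borel" unfolding q_def by measurable
      have "AE u in lborel. indicator {0<..} u *\<^sub>R q u = indicator {0..} u *\<^sub>R q u"
        using AE_lborel_singleton[of 0] by eventually_elim (auto simp: indicator_def)
      then show ?thesis unfolding set_lebesgue_integral_def by (intro integral_cong_AE) measurable
    qed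
    moreover have "{..0} \<union> {0<..} = (UNIV :: real set)" by auto
    ultimately have "(LINT u:UNIV|lborel. q u) = 2 * (LINT u:{0..}|lborel. q u)" using 1 by simp
    then show ?thesis using q by (simp add: set_lebesgue_integral_def has_bochner_integral_iff)
  qed
  moreover have "((\<lambda>b. LINT u:{0..b}|lborel. q u) \<longlongrightarrow> (LINT u:{0..}|lborel. q u)) at_top"
    by (rule tendsto_set_lebesgue_integral_at_top) (auto intro!: si)
  then have "(\<lambda>N. LINT u:{0..real N}|lborel. q u) \<longlonglongrightarrow> (LINT u:{0..}|lborel. q u)"
    by (rule filterlim_compose) (rule filterlim_real_sequentially)
  moreover have "(LINT u:{0..real N}|lborel. q u) = integral {0..real N} q" for N
    by (rule set_borel_integral_eq_integral(2)) (auto intro!: si)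
  ultimately show ?thesis by (simp add: q_def)
qed


section \<open>Theta series and Poisson summation\<close>

lemma power_exp_square_summable:
  fixes c :: real
  assumes c: "c > 0"
  shows "summable (\<lambda>k. real (Suc k) ^ m * exp (- c * (real (Suc k))\<^sup>2))"
proof -
  have "((\<lambda>x::real. x ^ (m + 2) / exp x) \<longlongrightarrow> 0) at_top" by (rule tendsto_power_div_exp_0)
  moreover have "filterlim (\<lambda>k. c * real (Suc k)) at_top sequentially" using c by real_asymp
  ultimately have "(\<lambda>k. (c * real (Suc k)) ^ (m + 2) / exp (c * real (Suc k))) \<longlonglongrightarrow> 0"
    by (rule filterlim_compose)
  then have "eventually (\<lambda>k. (c * real (Suc k)) ^ (m + 2) / exp (c * real (Suc k)) < 1) sequentially"
    by (rule order_tendstoD) simp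
  then obtain N where N: "\<And>k. k \<ge> N \<Longrightarrow> (c * real (Suc k)) ^ (m + 2) / exp (c * real (Suc k)) < 1"
    unfolding eventually_sequentially by blast
  have s: "summable (\<lambda>k. (1 / c ^ (m + 2)) * inverse (real (Suc k) ^ 2))"
  proof (intro summable_mult)
    have "summable (\<lambda>k. inverse (real k ^ 2))" using inverse_power_summable[of 2, where 'a = real] by simp
    then show "summable (\<lambda>k. inverse (real (Suc k) ^ 2))" by (subst summable_Suc_iff)
  qed
  show ?thesis
  proof (rule summable_comparison_test'[OF s])
    fix k assume k: "k \<ge> N"
    define x where "x = real (Suc k)"
    have x: "x \<ge> 1" by (simp add: x_def)
    have "(c * x) ^ (m + 2) / exp (c * x) < 1" using N[OF k] unfolding x_def .
    then have "c ^ (m + 2) * x ^ (m + 2) < exp (c * x)"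
      by (simp only: divide_less_eq_1_pos exp_gt_zero power_mult_distrib)
    also have "\<dots> \<le> exp (c * x\<^sup>2)" using c x by (simp add: power2_eq_square)
    finally have 1: "c ^ (m + 2) * x ^ (m + 2) < exp (c * x\<^sup>2)" .
    have "x ^ m * exp (- c * x\<^sup>2) * (c ^ (m + 2) * x\<^sup>2) = (c ^ (m + 2) * x ^ (m + 2)) * exp (- c * x\<^sup>2)"
      by (simp add: power_add power2_eq_square mult_ac)
    also have "\<dots> \<le> exp (c * x\<^sup>2) * exp (- c * x\<^sup>2)" using 1 by (intro mult_right_mono) auto
    also have "\<dots> = 1" by (simp flip: exp_add)
    finally have "x ^ m * exp (- c * x\<^sup>2) \<le> 1 / (c ^ (m + 2) * x\<^sup>2)" using c x by (simp add: le_divide_eq)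
    also have "\<dots> = (1 / c ^ (m + 2)) * inverse (x ^ 2)" by (simp add: inverse_eq_divide)
    finally have "norm (x ^ m * exp (- c * x\<^sup>2)) \<le> (1 / c ^ (m + 2)) * inverse (x ^ 2)"
      using x by (simp add: abs_mult)
    then show "norm (real (Suc k) ^ m * exp (- c * (real (Suc k))\<^sup>2)) \<le> (1 / c ^ (m + 2)) * inverse (real (Suc k) ^ 2)"
      unfolding x_def .
  qed
qed

text \<open>A derivative in \<open>x\<close> raises \<open>m\<close> by 2, so the orders 0, 2 and 4
  carry the one-sided theta series and its first two derivatives, up to powers of
  \<open>- pi\<close>.\<close>

definition theta_moment :: "nat \<Rightarrow> real \<Rightarrow> real" where
  "theta_moment m x = (\<Sum>k. real (Suc k) ^ m * exp (- pi * (real (Suc k))\<^sup>2 * x))"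

lemma theta_moment_summable:
  assumes "x > 0"
  shows "summable (\<lambda>k. real (Suc k) ^ m * exp (- pi * (real (Suc k))\<^sup>2 * x))"
proof -
  have "- (pi * x) * y = - pi * y * x" for y :: real by simp
  then show ?thesis using power_exp_square_summable[of "pi * x" m] assms by (simp only: mult_pos_pos pi_gt_zero)
qed

lemma theta_moment_sums:
  "x > 0 \<Longrightarrow> (\<lambda>k. real (Suc k) ^ m * exp (- pi * (real (Suc k))\<^sup>2 * x)) sums theta_moment m x"
  unfolding theta_moment_def by (intro summable_sums theta_moment_summable)

text \<open>On the half-line beyond \<open>x / 2\<close> the differentiated series is dominated by
  its terms at \<open>x / 2\<close>, which justifies termwise differentiation.\<close>

lemma theta_moment_deriv:
  assumes x: "x > 0"
  shows "(theta_moment m has_field_derivative - pi * theta_moment (m + 2) x) (at x)"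
proof -
  define S where "S = {x / 2<..}"
  have S: "convex S" "x \<in> S" "x \<in> interior S" "\<And>y. y \<in> S \<Longrightarrow> y > x / 2" using x by (auto simp: S_def interior_open)
  define f where "f = (\<lambda>k y. real (Suc k) ^ m * exp (- pi * (real (Suc k))\<^sup>2 * y))"
  define f' where "f' = (\<lambda>k y. - pi * (real (Suc k) ^ (m + 2) * exp (- pi * (real (Suc k))\<^sup>2 * y)))"
  have d: "(f k has_field_derivative f' k y) (at y within S)" for k y
    unfolding f_def f'_def by (auto intro!: derivative_eq_intros simp: power_add power2_eq_square)
  have u: "uniformly_convergent_on S (\<lambda>n y. \<Sum>i<n. f' i y)"
  proof (rule Weierstrass_m_test')
    show "summable (\<lambda>k. pi * (real (Suc k) ^ (m + 2) * exp (- pi * (real (Suc k))\<^sup>2 * (x / 2))))"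
      using x by (intro summable_mult theta_moment_summable) auto
    fix k y assume "y \<in> S"
    then have "y > x / 2" by (rule S)
    then have "pi * (real (Suc k))\<^sup>2 * (x / 2) \<le> pi * (real (Suc k))\<^sup>2 * y" by (intro mult_left_mono) auto
    then have "exp (- pi * (real (Suc k))\<^sup>2 * y) \<le> exp (- pi * (real (Suc k))\<^sup>2 * (x / 2))" by simp
    then have "pi * (real (Suc k) ^ (m + 2) * exp (- pi * (real (Suc k))\<^sup>2 * y)) \<le> pi * (real (Suc k) ^ (m + 2) * exp (- pi * (real (Suc k))\<^sup>2 * (x / 2)))"
      by (intro mult_left_mono) auto
    moreover have "norm (f' k y) = pi * (real (Suc k) ^ (m + 2) * exp (- pi * (real (Suc k))\<^sup>2 * y))"
      unfolding f'_def by (simp add: abs_mult)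
    ultimately show "norm (f' k y) \<le> pi * (real (Suc k) ^ (m + 2) * exp (- pi * (real (Suc k))\<^sup>2 * (x / 2)))" by simp
  qed
  have sf: "summable (\<lambda>k. f k x)" unfolding f_def by (rule theta_moment_summable[OF x])
  have "((\<lambda>y. \<Sum>k. f k y) has_field_derivative (\<Sum>k. f' k x)) (at x)"
    by (rule has_field_derivative_series'(2)[OF S(1) d u S(2) sf S(3)])
  moreover have "(\<Sum>k. f' k x) = - pi * theta_moment (m + 2) x"
    unfolding f'_def theta_moment_def by (intro suminf_mult theta_moment_summable x)
  moreover have "(\<lambda>y. \<Sum>k. f k y) = theta_moment m" unfolding f_def theta_moment_def ..
  ultimately show ?thesis by simp
qed

definition jacobi_theta :: "real \<Rightarrow> real" where
  "jacobi_theta x = 1 + 2 * theta_moment 0 x"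

text \<open>Poisson summation for the Gaussian: \<open>f\<close> is its periodisation and
  \<open>g\<close> the proposed Fourier series. Both are continuous and have the same cosine
  integrals, hence agree, and the claim is their equality at 0.\<close>

theorem jacobi_theta_inversion:
  fixes x :: real
  assumes x: "x > 0"
  shows "jacobi_theta (1 / x) = sqrt x * jacobi_theta x"
proof -
  define G where "G = (\<lambda>u. exp (- pi * x * u\<^sup>2))"
  \<comment> \<open>As \<open>G\<close> is even, the points \<open>n + t\<close> and
    \<open>n + 1 - t\<close> with n \<ge> 0 represent all integer translates of \<open>t\<close>;
    evenness and period 1 make half a period enough.\<close>
  define F where "F = (\<lambda>n t. G (real n + t) + G (real n + 1 - t))"
  define f where "f = (\<lambda>t. \<Sum>n. F n t)"
  define H where "H = (\<lambda>n t. exp (- pi * (real (Suc n))\<^sup>2 / x) * cos (2 * pi * real (Suc n) * t))"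
  define g where "g = (\<lambda>t. (1 + 2 * (\<Sum>n. H n t)) / sqrt x)"
  have G_mono: "G u \<le> G v" if "0 \<le> v" "v \<le> u" for u v
  proof -
    have "v\<^sup>2 \<le> u\<^sup>2" using that by (intro power_mono) auto
    then show ?thesis unfolding G_def using x by (simp add: mult_left_mono)
  qed
  have sumG: "summable (\<lambda>n. G (real (Suc n)))"
    using power_exp_square_summable[of "pi * x" 0] x by (simp add: G_def)
  then have sumG0: "summable (\<lambda>n. G (real n))" using summable_Suc_iff[of "\<lambda>n. G (real n)"] by simp
  have uf: "uniform_limit {0..1/2} (\<lambda>N t. \<Sum>n<N. F n t) f sequentially"
    unfolding f_def
  proof (rule Weierstrass_m_test)
    show "summable (\<lambda>n. 2 * G (real n))" by (intro summable_mult sumG0)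
    fix n and t :: real assume t: "t \<in> {0..1/2}"
    have "G (real n + t) \<le> G (real n)" "G (real n + 1 - t) \<le> G (real n)" using t by (intro G_mono; simp)+
    moreover have "G (real n + t) \<ge> 0" "G (real n + 1 - t) \<ge> 0" by (auto simp: G_def)
    ultimately show "norm (F n t) \<le> 2 * G (real n)" by (simp add: F_def)
  qed
  have sumH: "summable (\<lambda>n. exp (- pi * (real (Suc n))\<^sup>2 / x))"
    using power_exp_square_summable[of "pi / x" 0] x by simp
  have ug: "uniform_limit {0..1/2} (\<lambda>N t. \<Sum>n<N. H n t) (\<lambda>t. \<Sum>n. H n t) sequentially"
  proof (rule Weierstrass_m_test)
    show "summable (\<lambda>n. exp (- pi * (real (Suc n))\<^sup>2 / x))" by (rule sumH)
    fix n and t :: real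
    have "exp (- pi * (real (Suc n))\<^sup>2 / x) * \<bar>cos (2 * pi * real (Suc n) * t)\<bar> \<le> exp (- pi * (real (Suc n))\<^sup>2 / x) * 1"
      by (intro mult_left_mono abs_cos_le_one) auto
    then show "norm (H n t) \<le> exp (- pi * (real (Suc n))\<^sup>2 / x)" by (simp add: H_def abs_mult)
  qed
  have Fc: "continuous_on A (F n)" for n and A :: "real set" unfolding F_def G_def by (intro continuous_intros)
  have Hc: "continuous_on A (H n)" for n and A :: "real set" unfolding H_def by (intro continuous_intros)
  have fc: "continuous_on {0..1/2} f"
    by (rule uniform_limit_theorem[OF _ uf]) (auto intro!: always_eventually continuous_intros Fc)
  have Hsc: "continuous_on {0..1/2} (\<lambda>t. \<Sum>n. H n t)"
    by (rule uniform_limit_theorem[OF _ ug]) (auto intro!: always_eventually continuous_intros Hc)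
  have gc: "continuous_on {0..1/2} g" unfolding g_def using x by (intro continuous_intros Hsc) auto
  have intf: "integral {0..1/2} (\<lambda>t. f t * cos (2 * pi * real k * t)) = exp (- pi * (real k)\<^sup>2 / x) / sqrt x / 2" for k
  proof -
    define c where "c = (\<lambda>t. cos (2 * pi * real k * t))"
    have cc: "continuous_on A c" for A unfolding c_def by (intro continuous_intros)
    have cper: "c (real n + t) = c t" "c (real n + 1 - t) = c t" for n t
    proof -
      have e: "2 * pi * real k * (real n + t) = 2 * pi * real k * t + 2 * real (k * n) * pi"
        "2 * pi * real k * (real n + 1 - t) = - (2 * pi * real k * t) + 2 * real (k * (n + 1)) * pi"
        by (simp_all add: algebra_simps)
      show "c (real n + t) = c t" unfolding c_def e(1) by (simp add: cos_add cos_2npi sin_2npi del: of_nat_mult)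
      show "c (real n + 1 - t) = c t" unfolding c_def e(2)
        by (simp only: cos_add cos_2npi sin_2npi mult_1_right mult_zero_right diff_zero cos_minus)
    qed
    define q where "q = (\<lambda>u. G u * c u)"
    have qc: "continuous_on A q" for A unfolding q_def G_def by (intro continuous_intros cc)
    have qi: "q integrable_on {a..b}" for a b by (intro integrable_continuous_real qc)
    have un: "uniform_limit {0..1/2} (\<lambda>N t. (\<Sum>n<N. F n t) * c t) (\<lambda>t. f t * c t) sequentially"
    proof (rule uniform_lim_mult[OF uf uniform_limit_const])
      show "bounded (f ` {0..1/2})" by (intro compact_imp_bounded compact_continuous_image fc) auto
      show "bounded (c ` {0..1/2})" by (intro compact_imp_bounded compact_continuous_image cc) auto
    qed
    \<comment> \<open>Each unit interval is cut in the middle and its right half reflected; the two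
      pieces then match the two summands of \<open>F\<close>, and the cosine has the same value at
      corresponding points.\<close>
    have part: "((\<lambda>t. (\<Sum>n<N. F n t) * c t) has_integral integral {0..real N} q) {0..1/2}" for N
    proof (induction N)
      case (Suc N)
      have "(q has_integral integral {real N..real N + 1/2} q) {real N..real N + 1/2}"
        using qi by (rule integrable_integral)
      then have 1: "((\<lambda>t. q (t + real N)) has_integral integral {real N..real N + 1/2} q) {0..1/2}"
        using has_integral_shift_real_ivl[of q _ "real N" "real N + 1/2" "real N"] by simp
      have "(q has_integral integral {real N + 1/2..real N + 1} q) {real N + 1/2..real N + 1}"
        using qi by (rule integrable_integral)
      from has_integral_affinity[OF this[unfolded box_real(2)[symmetric]], of "-1" "real N + 1"]
      have 2: "((\<lambda>t. q (real N + 1 - t)) has_integral integral {real N + 1/2..real N + 1} q) {0..1/2}"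
        by (simp add: add.commute image_affinity_atLeastAtMost)
      have "((\<lambda>t. q (t + real N) + q (real N + 1 - t)) has_integral
         integral {real N..real N + 1/2} q + integral {real N + 1/2..real N + 1} q) {0..1/2}"
        by (rule has_integral_add[OF 1 2])
      also have "integral {real N..real N + 1/2} q + integral {real N + 1/2..real N + 1} q = integral {real N..real N + 1} q"
        by (intro Henstock_Kurzweil_Integration.integral_combine qi) auto
      finally have "((\<lambda>t. F N t * c t) has_integral integral {real N..real N + 1} q) {0..1/2}"
        by (simp add: q_def F_def cper add.commute[of _ "real N"] distrib_right)
      from has_integral_add[OF Suc this]
      have "((\<lambda>t. (\<Sum>n<Suc N. F n t) * c t) has_integral (integral {0..real N} q + integral {real N..real N + 1} q)) {0..1/2}"
        by (simp add: distrib_right)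
      also have "integral {0..real N} q + integral {real N..real N + 1} q = integral {0..real N + 1} q"
        by (intro Henstock_Kurzweil_Integration.integral_combine qi) auto
      finally show ?case by (simp add: add.commute)
    qed simp
    obtain I J where IJ: "\<And>N. ((\<lambda>t. (\<Sum>n<N. F n t) * c t) has_integral I N) {0..1/2}"
      "((\<lambda>t. f t * c t) has_integral J) {0..1/2}" "I \<longlonglongrightarrow> J"
    proof -
      have "continuous_on {0..1/2} (\<lambda>t. (\<Sum>n<N. F n t) * c t)" for N by (intro continuous_intros Fc cc)
      from uniform_limit_integral[OF un this sequentially_bot] show thesis using that by blast
    qed
    have "I N = integral {0..real N} q" for N using IJ(1)[of N] part[of N] by (rule has_integral_unique)
    then have I: "I = (\<lambda>N. integral {0..real N} q)" by blast
    have "I \<longlonglongrightarrow> exp (- pi * (real k)\<^sup>2 / x) / sqrt x / 2"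
      unfolding I q_def G_def c_def by (rule gaussian_cos_integral_half[OF x])
    then have "J = exp (- pi * (real k)\<^sup>2 / x) / sqrt x / 2" by (rule LIMSEQ_unique[OF IJ(3)])
    then show ?thesis using IJ(2) by (simp add: c_def integral_unique)
  qed
  have cosint: "((\<lambda>t. cos (2 * pi * real j * t)) has_integral (if j = 0 then 1/2 else 0)) {0..1/2}" for j :: nat
  proof (cases "j = 0")
    case True
    then show ?thesis using has_integral_const_real[of "1::real" 0 "1/2"] by simp
  next
    case False
    have "((\<lambda>t. cos (2 * pi * real j * t)) has_integral (sin (2 * pi * real j * (1/2)) / (2 * pi * real j) - sin (2 * pi * real j * 0) / (2 * pi * real j))) {0..1/2}"
      by (rule fundamental_theorem_of_calculus)
         (use False in \<open>auto intro!: derivative_eq_intros simp flip: has_real_derivative_iff_has_vector_derivative\<close>)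
    moreover have "sin (2 * pi * real j * (1/2)) = 0" using sin_npi2[of j] by simp
    ultimately show ?thesis using False by simp
  qed
  have intg: "integral {0..1/2} (\<lambda>t. g t * cos (2 * pi * real k * t)) = exp (- pi * (real k)\<^sup>2 / x) / sqrt x / 2" for k
  proof -
    define c where "c = (\<lambda>t. cos (2 * pi * real k * t))"
    have cc: "continuous_on A c" for A unfolding c_def by (intro continuous_intros)
    define e where "e = (\<lambda>n. exp (- pi * (real n)\<^sup>2 / x))"
    have un: "uniform_limit {0..1/2} (\<lambda>N t. (\<Sum>n<N. H n t) * c t) (\<lambda>t. (\<Sum>n. H n t) * c t) sequentially"
    proof (rule uniform_lim_mult[OF ug uniform_limit_const])
      show "bounded ((\<lambda>t. \<Sum>n. H n t) ` {0..1/2})" by (intro compact_imp_bounded compact_continuous_image Hsc) auto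
      show "bounded (c ` {0..1/2})" by (intro compact_imp_bounded compact_continuous_image cc) auto
    qed
    \<comment> \<open>The value is the length 1/2 times the mean 1/2 of a squared cosine.
      \<open>d\<close> is |n + 1 - k|, computed within the natural numbers; the other frequency n +
      1 + k is never 0.\<close>
    have prod: "((\<lambda>t. H n t * c t) has_integral (if k = Suc n then e k / 4 else 0)) {0..1/2}" for n
    proof -
      define d where "d = (if Suc n \<ge> k then Suc n - k else k - Suc n)"
      have 1: "cos (2 * pi * real (Suc n) * t) * cos (2 * pi * real k * t) =
        cos (2 * pi * real (Suc n + k) * t) / 2 + cos (2 * pi * real d * t) / 2" for t
      proof -
        have a: "2 * pi * real (Suc n + k) * t = 2 * pi * real (Suc n) * t + 2 * pi * real k * t" by (simp add: algebra_simps)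
        have b: "cos (2 * pi * real d * t) = cos (2 * pi * real (Suc n) * t - 2 * pi * real k * t)"
        proof (cases "Suc n \<ge> k")
          case True
          then have "2 * pi * real d * t = 2 * pi * real (Suc n) * t - 2 * pi * real k * t" by (simp add: d_def of_nat_diff algebra_simps)
          then show ?thesis by (simp only:)
        next
          case False
          then have "2 * pi * real d * t = - (2 * pi * real (Suc n) * t - 2 * pi * real k * t)" by (simp add: d_def of_nat_diff algebra_simps)
          then show ?thesis by (simp only: cos_minus)
        qed
        have "cos A * cos B = cos (A + B) / 2 + cos (A - B) / 2" for A B :: real by (simp add: cos_add cos_diff add_divide_distrib diff_divide_distrib)
        then show ?thesis by (simp only: a b)
      qed
      have "((\<lambda>t. cos (2 * pi * real (Suc n + k) * t) / 2 + cos (2 * pi * real d * t) / 2) has_integral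
         ((if Suc n + k = 0 then 1/2 else 0) / 2 + (if d = 0 then 1/2 else 0) / 2)) {0..1/2}"
        by (intro has_integral_add has_integral_divide cosint)
      then have "((\<lambda>t. e (Suc n) * (cos (2 * pi * real (Suc n + k) * t) / 2 + cos (2 * pi * real d * t) / 2)) has_integral
         (e (Suc n) * ((if Suc n + k = 0 then 1/2 else 0) / 2 + (if d = 0 then 1/2 else 0) / 2))) {0..1/2}"
        by (rule has_integral_mult_right)
      moreover have "e (Suc n) * ((if Suc n + k = 0 then 1/2 else 0) / 2 + (if d = 0 then 1/2 else 0) / 2) = (if k = Suc n then e k / 4 else 0)"
        by (auto simp: d_def)
      moreover have "H n t * c t = e (Suc n) * (cos (2 * pi * real (Suc n + k) * t) / 2 + cos (2 * pi * real d * t) / 2)" for t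
        unfolding H_def c_def e_def by (rule trans[OF mult.assoc], rule arg_cong[where f = "(*) (exp (- pi * (real (Suc n))\<^sup>2 / x))", OF 1])
      ultimately show ?thesis by (simp only:)
    qed
    obtain I J where IJ: "\<And>N. ((\<lambda>t. (\<Sum>n<N. H n t) * c t) has_integral I N) {0..1/2}"
      "((\<lambda>t. (\<Sum>n. H n t) * c t) has_integral J) {0..1/2}" "I \<longlonglongrightarrow> J"
    proof -
      have "continuous_on {0..1/2} (\<lambda>t. (\<Sum>n<N. H n t) * c t)" for N by (intro continuous_intros Hc cc)
      from uniform_limit_integral[OF un this sequentially_bot] show thesis using that by blast
    qed
    have I: "I N = (\<Sum>n<N. if k = Suc n then e k / 4 else 0)" for N
    proof -
      have "((\<lambda>t. \<Sum>n<N. H n t * c t) has_integral (\<Sum>n<N. if k = Suc n then e k / 4 else 0)) {0..1/2}"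
        by (intro has_integral_sum prod) auto
      then show ?thesis using IJ(1)[of N] by (simp add: sum_distrib_right has_integral_unique)
    qed
    have "I \<longlonglongrightarrow> (if k = 0 then 0 else e k / 4)"
    proof -
      have "(\<lambda>n. if k = Suc n then e k / 4 else 0) sums (if k = 0 then 0 else e k / 4)"
      proof (cases k)
        case (Suc k')
        then have "(\<lambda>n. if k = Suc n then e k / 4 else 0) = (\<lambda>n. if n = k' then e k / 4 else 0)" by auto
        then show ?thesis using sums_single[of k' "\<lambda>_. e k / 4"] Suc by simp
      qed simp
      moreover have "I = (\<lambda>N. \<Sum>n<N. if k = Suc n then e k / 4 else 0)" using I by blast
      ultimately show ?thesis by (simp only: sums_def)
    qed
    then have J: "J = (if k = 0 then 0 else e k / 4)" by (rule LIMSEQ_unique[OF IJ(3)])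
    have "((\<lambda>t. (c t + 2 * ((\<Sum>n. H n t) * c t)) / sqrt x) has_integral (((if k = 0 then 1/2 else 0) + 2 * J) / sqrt x)) {0..1/2}"
      unfolding c_def by (intro has_integral_divide has_integral_add has_integral_mult_right cosint IJ(2)[unfolded c_def])
    moreover have "(c t + 2 * ((\<Sum>n. H n t) * c t)) / sqrt x = g t * c t" for t
      by (simp add: g_def distrib_right)
    moreover have "((if k = 0 then 1/2 else 0) + 2 * J) / sqrt x = e k / sqrt x / 2"
      unfolding J by (auto simp: e_def)
    ultimately show ?thesis by (simp add: c_def e_def integral_unique)
  qed
  have "f 0 - g 0 = 0"
  proof (rule cos_orthogonal_imp_zero[where h = "\<lambda>t. f t - g t"])
    show "continuous_on {0..1/2} (\<lambda>t. f t - g t)" by (intro continuous_intros fc gc)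
    fix k :: nat
    have "integral {0..1/2} (\<lambda>t. f t * cos (2 * pi * real k * t) - g t * cos (2 * pi * real k * t)) =
       integral {0..1/2} (\<lambda>t. f t * cos (2 * pi * real k * t)) - integral {0..1/2} (\<lambda>t. g t * cos (2 * pi * real k * t))"
      by (intro Henstock_Kurzweil_Integration.integral_diff integrable_continuous_real continuous_intros fc gc)
    then show "integral {0..1/2} (\<lambda>t. (f t - g t) * cos (2 * pi * real k * t)) = 0"
      unfolding intf intg by (simp add: left_diff_distrib)
  qed simp
  then have fg: "f 0 = g 0" by simp
  \<comment> \<open>\<open>F n 0\<close> is G n + G (n + 1), so the term at 0 is counted once and
    every other one twice.\<close>
  have "f 0 = jacobi_theta x"
  proof -
    have a: "(\<lambda>n. G (real (Suc n))) sums theta_moment 0 x"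
      using theta_moment_sums[OF x, of 0] by (simp add: G_def mult_ac)
    then have "(\<lambda>n. G (real n)) sums (theta_moment 0 x + G 0)"
      using sums_Suc_iff[of "\<lambda>n. G (real n)" "theta_moment 0 x"] by simp
    from sums_add[OF this a] have "(\<lambda>n. F n 0) sums (theta_moment 0 x + G 0 + theta_moment 0 x)"
      by (simp add: F_def add.commute)
    then show ?thesis by (simp add: f_def jacobi_theta_def sums_iff G_def)
  qed
  moreover have "g 0 = jacobi_theta (1 / x) / sqrt x"
    using x by (simp add: g_def H_def jacobi_theta_def theta_moment_def)
  ultimately show ?thesis using fg x by (simp add: field_simps)
qed

text \<open>With \<omega> = \<open>theta_moment 0\<close> this is 2 x^2 \<omega>'' + 3 x \<omega>'.
  The operator annihilates constants and \<open>x powr (-1/2)\<close>, so the elementary terms of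
  the theta inversion leave no trace, and the folded integral has no boundary terms.\<close>

definition xi_kernel :: "real \<Rightarrow> real" where
  "xi_kernel x = 2 * pi\<^sup>2 * x\<^sup>2 * theta_moment 4 x - 3 * pi * x * theta_moment 2 x"

lemma xi_kernel_inversion:
  assumes x: "x > 0"
  shows "xi_kernel (1 / x) = sqrt x * xi_kernel x"
proof -
  define A where "A = (\<lambda>m x. theta_moment m x)"
  have dA [derivative_intros]: "((\<lambda>x. A m (g x)) has_field_derivative - pi * A (m + 2) (g x) * g') (at x)"
    if "g x > 0" "(g has_field_derivative g') (at x)" for m g g' x
    using DERIV_chain2[OF theta_moment_deriv[of "g x" m, OF that(1)] that(2)] by (simp add: A_def)
  define L where "L = (\<lambda>x. 1 + 2 * A 0 (1 / x))"
  define L1 where "L1 = (\<lambda>x. 2 * pi * A 2 (1 / x) / x\<^sup>2)"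
  define L2 where "L2 = (\<lambda>x. 2 * pi\<^sup>2 * A 4 (1 / x) / x ^ 4 - 4 * pi * A 2 (1 / x) / x ^ 3)"
  define R where "R = (\<lambda>x. sqrt x * (1 + 2 * A 0 x))"
  define R1 where "R1 = (\<lambda>x. (1 + 2 * A 0 x) / (2 * sqrt x) - 2 * pi * sqrt x * A 2 x)"
  define R2 where "R2 = (\<lambda>x. - (1 + 2 * A 0 x) / (4 * x * sqrt x) - 2 * pi * A 2 x / sqrt x + 2 * pi\<^sup>2 * sqrt x * A 4 x)"
  have LR: "L y = R y" if "y > 0" for y
    using jacobi_theta_inversion[OF that] by (simp add: L_def R_def jacobi_theta_def A_def)
  have dL: "(L has_field_derivative L1 y) (at y)" if "y > 0" for y
    unfolding L_def L1_def using that by (auto intro!: derivative_eq_intros simp: power2_eq_square numeral_2_eq_2)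
  have da: "(A m has_field_derivative - pi * A (m + 2) y) (at y)" if "y > 0" for m y
    using theta_moment_deriv[OF that, of m] by (simp add: A_def)
  have sq: "(sqrt has_field_derivative 1 / (2 * sqrt y)) (at y)" if "y > 0" for y
    by (rule DERIV_cong[OF DERIV_real_sqrt[OF that]]) (simp add: inverse_eq_divide)
  have dR: "(R has_field_derivative R1 y) (at y)" if y: "y > 0" for y
    unfolding R_def
    by (rule DERIV_cong[OF DERIV_mult[OF sq[OF y] DERIV_add[OF DERIV_const DERIV_cmult[OF da[OF y]]]]])
       (simp add: R1_def numeral_2_eq_2)
  have LR1: "L1 y = R1 y" if y: "y > 0" for y
  proof -
    have "(R has_field_derivative L1 y) (at y)"
      using dL[OF y] by (rule has_field_derivative_transform_within_open[of _ _ _ "{0<..}"]) (use y LR in auto)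
    then show ?thesis using dR[OF y] by (rule DERIV_unique)
  qed
  have dL1: "(L1 has_field_derivative L2 y) (at y)" if "y > 0" for y
  proof -
    have i: "((\<lambda>x. 1 / x) has_field_derivative - 1 / y\<^sup>2) (at y)"
      using that by (auto intro!: derivative_eq_intros simp: power2_eq_square)
    have c: "((\<lambda>x. A 2 (1 / x)) has_field_derivative - pi * A (2 + 2) (1 / y) * (- 1 / y\<^sup>2)) (at y)"
      by (rule dA) (use that i in auto)
    have "((\<lambda>x. 2 * pi * (A 2 (1 / x) * (1 / x) ^ 2)) has_field_derivative L2 y) (at y)"
      by (rule DERIV_cong[OF DERIV_cmult[OF DERIV_mult[OF c DERIV_power[OF i]]]])
         (use that in \<open>simp add: L2_def field_simps power2_eq_square power3_eq_cube power4_eq_xxxx\<close>)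
    moreover have "2 * pi * (A 2 (1 / x) * (1 / x) ^ 2) = L1 x" for x by (simp add: L1_def power_divide)
    ultimately show ?thesis by simp
  qed
  have dR1: "(R1 has_field_derivative R2 y) (at y)" if y: "y > 0" for y
  proof -
    define s where "s = sqrt y"
    have s: "s > 0" "y = s * s" using y by (auto simp: s_def)
    have nz: "2 * sqrt y \<noteq> 0" using y by simp
    have "(R1 has_field_derivative ((2 * (- pi * A 2 y)) * (2 * sqrt y) - (1 + 2 * A 0 y) * (2 * (1 / (2 * sqrt y)))) / ((2 * sqrt y) * (2 * sqrt y))
        - (2 * pi * (1 / (2 * sqrt y)) * A 2 y + 2 * pi * sqrt y * (- pi * A 4 y))) (at y)"
      unfolding R1_def
      by (rule DERIV_cong[OF DERIV_diff[OF DERIV_divide[OF DERIV_add[OF DERIV_const DERIV_cmult[OF da[OF y]]] DERIV_cmult[OF sq[OF y]] nz] DERIV_mult[OF DERIV_cmult[OF sq[OF y]] da[OF y]]]])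
         (simp add: numeral_2_eq_2 eval_nat_numeral)
    moreover have "((2 * (- pi * A 2 y)) * (2 * s) - (1 + 2 * A 0 y) * (2 * (1 / (2 * s)))) / ((2 * s) * (2 * s))
        - (2 * pi * (1 / (2 * s)) * A 2 y + 2 * pi * s * (- pi * A 4 y)) = - (1 + 2 * A 0 y) / (4 * y * s) - 2 * pi * A 2 y / s + 2 * pi\<^sup>2 * s * A 4 y"
    proof -
      have "((2 * (- p * a)) * (2 * s) - B * (2 * (1 / (2 * s)))) / ((2 * s) * (2 * s)) - (2 * p * (1 / (2 * s)) * a + 2 * p * s * (- p * b)) =
         - B / (4 * (s * s) * s) - 2 * p * a / s + 2 * p\<^sup>2 * s * b" for p a b B
        using s(1) by (simp add: field_simps power2_eq_square)
      from this[where p = pi and a = "A 2 y" and B = "1 + 2 * A 0 y" and b = "A 4 y"] show ?thesis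
        unfolding s(2)[symmetric] .
    qed
    ultimately show ?thesis by (simp add: R2_def s_def[symmetric])
  qed
  have LR2: "L2 y = R2 y" if y: "y > 0" for y
  proof -
    have "(R1 has_field_derivative L2 y) (at y)"
      using dL1[OF y] by (rule has_field_derivative_transform_within_open[of _ _ _ "{0<..}"]) (use y LR1 in auto)
    then show ?thesis using dR1[OF y] by (rule DERIV_unique)
  qed
  \<comment> \<open>This combination of derivatives of \<open>L\<close> reproduces the kernel at
    \<open>1 / x\<close>; on the side of \<open>R\<close> the contributions of
    \<open>1 + 2 * A 0 x\<close> cancel.\<close>
  have "xi_kernel (1 / x) = x\<^sup>2 * L2 x + x / 2 * L1 x"
    using x by (simp add: xi_kernel_def L2_def L1_def A_def field_simps power2_eq_square power3_eq_cube power4_eq_xxxx)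
  also have "\<dots> = x\<^sup>2 * R2 x + x / 2 * R1 x" using LR1[OF x] LR2[OF x] by simp
  also have "\<dots> = sqrt x * xi_kernel x"
  proof -
    define s where "s = sqrt x"
    have s: "s > 0" "x = s * s" using x by (auto simp: s_def)
    have "(s * s)\<^sup>2 * (- B / (4 * (s * s) * s) - 2 * p * a / s + 2 * p\<^sup>2 * s * b) + (s * s) / 2 * (B / (2 * s) - 2 * p * s * a)
      = s * (2 * p\<^sup>2 * (s * s)\<^sup>2 * b - 3 * p * (s * s) * a)" for B p a b
      using s(1) by (simp add: field_simps power2_eq_square)
    from this[of "1 + 2 * A 0 x" pi "A 2 x" "A 4 x"] show ?thesis
      unfolding R2_def R1_def xi_kernel_def s_def[symmetric] s(2)[symmetric] by (simp add: A_def)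
  qed
  finally show ?thesis .
qed

lemma xi_kernel_sums:
  assumes "x > 0"
  shows "(\<lambda>k. (2 * pi\<^sup>2 * real (Suc k) ^ 4 * x\<^sup>2 - 3 * pi * real (Suc k) ^ 2 * x) * exp (- pi * (real (Suc k))\<^sup>2 * x)) sums xi_kernel x"
proof -
  have "(\<lambda>k. 2 * pi\<^sup>2 * x\<^sup>2 * (real (Suc k) ^ 4 * exp (- pi * (real (Suc k))\<^sup>2 * x)) - 3 * pi * x * (real (Suc k) ^ 2 * exp (- pi * (real (Suc k))\<^sup>2 * x))) sums xi_kernel x"
    unfolding xi_kernel_def by (intro sums_diff sums_mult theta_moment_sums assms)
  moreover have "2 * pi\<^sup>2 * x\<^sup>2 * (a * e) - 3 * pi * x * (b * e) = (2 * pi\<^sup>2 * a * x\<^sup>2 - 3 * pi * b * x) * e" for a b e :: real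
    by (simp add: algebra_simps)
  ultimately show ?thesis by (simp only:)
qed

section \<open>Analytic continuation and the Taylor coefficients of xi\<close>

lemma Gamma_scaled_integral:
  fixes a c :: real
  assumes a: "a > 0" and c: "c > 0"
  shows "has_bochner_integral lborel (\<lambda>x. indicator {0<..} x * (x powr (a - 1) * exp (- c * x))) (Gamma a / c powr a)"
proof -
  define f where "f = (\<lambda>t::real. indicator {0..} t * t powr (a - 1) / exp t)"
  have G: "Gamma a > 0" using a by (rule Gamma_real_pos)
  have m: "f \<in> borel_measurable lborel" unfolding f_def by measurable
  have "integrable lborel f \<and> integral\<^sup>L lborel f = Gamma a"
    using nn_integral_eq_integrable[OF m, of "Gamma a"] Gamma_conv_nn_integral_real[OF a] G by (simp add: f_def)
  then have "has_bochner_integral lborel f (Gamma a)" by (simp add: has_bochner_integral_iff)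
  then have "has_bochner_integral lborel (\<lambda>x. f (0 + c * x)) (Gamma a /\<^sub>R \<bar>c\<bar>)"
    using lborel_has_bochner_integral_real_affine_iff[of c f _ 0] c by simp
  from has_bochner_integral_mult_right[OF this, of "1 / c powr (a - 1)"]
  have "has_bochner_integral lborel (\<lambda>x. 1 / c powr (a - 1) * f (0 + c * x)) (1 / c powr (a - 1) * (Gamma a /\<^sub>R \<bar>c\<bar>))" by simp
  moreover have "1 / c powr (a - 1) * f (0 + c * x) = indicator {0<..} x * (x powr (a - 1) * exp (- c * x))" for x
  proof (cases "x > 0")
    case True
    then show ?thesis using c by (simp add: f_def powr_mult exp_minus inverse_eq_divide)
  next
    case False
    then show ?thesis using c by (cases "x = 0") (auto simp: f_def indicator_def zero_le_mult_iff)
  qed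
  moreover have "1 / c powr (a - 1) * (Gamma a /\<^sub>R \<bar>c\<bar>) = Gamma a / c powr a"
    using c by (simp add: powr_diff inverse_eq_divide)
  ultimately show ?thesis by simp
qed

lemma xi_kernel_measurable [measurable]: "xi_kernel \<in> borel_measurable borel"
  unfolding xi_kernel_def theta_moment_def by measurable

text \<open>With \<open>a = s / 2\<close> the two parts of each term give
  \<open>2 * Gamma (a + 2) - 3 * Gamma (a + 1)\<close>, which is Gamma a times a (2 a - 1) = s (s -
  1) / 2. Real \<open>s\<close> suffice, since the identity theorem extends the result
  later.\<close>

lemma xi_kernel_Mellin:
  fixes s :: real
  assumes s: "s > 1"
  shows "has_bochner_integral lborel (\<lambda>x. indicator {0<..} x * (xi_kernel x * x powr (s / 2 - 1)))
    (pi powr (- s / 2) * Gamma (s / 2) * (s * (s - 1) / 2) * (\<Sum>k. real (Suc k) powr (- s)))"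
proof -
  define a where "a = s / 2"
  have a: "a > 0" using s by (simp add: a_def)
  define c where "c = (\<lambda>k. pi * (real (Suc k))\<^sup>2)"
  have c: "c k > 0" for k by (simp add: c_def)
  \<comment> \<open>The sign \<open>e\<close> handles two families at once: \<open>e = -1\<close> is
    the series itself and \<open>e = 1\<close> a majorant whose integrals are given by the same
    computation, which justifies exchanging sum and integral.\<close>
  define T where "T = (\<lambda>e k x. (2 * (c k)\<^sup>2 * x\<^sup>2 + e * (3 * c k * x)) * exp (- c k * x))"
  define f where "f = (\<lambda>e k x. indicator {0<..} x * (T e k x * x powr (a - 1)))"
  have cp: "c k powr - a = pi powr - a * real (Suc k) powr (- s)" for k
  proof -
    have "(real (Suc k))\<^sup>2 powr - a = real (Suc k) powr (2 * (- a))"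
      by (subst powr_powr[symmetric]) simp
    then show ?thesis unfolding c_def by (subst powr_mult) (auto simp: a_def)
  qed
  have Gm: "Gamma (a + 1) = a * Gamma a" "Gamma (a + 2) = (a + 1) * (a * Gamma a)"
  proof -
    have n: "y \<notin> \<int>\<^sub>\<le>\<^sub>0" if "y > 0" for y :: real using that nonpos_Ints_nonpos[of y] by force
    show 1: "Gamma (a + 1) = a * Gamma a" using Gamma_plus1[OF n[OF a]] .
    have "Gamma ((a + 1) + 1) = (a + 1) * Gamma (a + 1)" by (rule Gamma_plus1[OF n]) (use a in simp)
    then show "Gamma (a + 2) = (a + 1) * (a * Gamma a)" using 1 by (simp add: add.assoc)
  qed
  have fi: "has_bochner_integral lborel (f e k) ((2 * Gamma (a + 2) + e * (3 * Gamma (a + 1))) * pi powr - a * real (Suc k) powr (- s))" for e k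
  proof -
    have "has_bochner_integral lborel (\<lambda>x. 2 * (c k)\<^sup>2 * (indicator {0<..} x * (x powr ((a + 2) - 1) * exp (- c k * x)))
       + e * (3 * c k) * (indicator {0<..} x * (x powr ((a + 1) - 1) * exp (- c k * x))))
       (2 * (c k)\<^sup>2 * (Gamma (a + 2) / c k powr (a + 2)) + e * (3 * c k) * (Gamma (a + 1) / c k powr (a + 1)))"
      by (intro has_bochner_integral_add has_bochner_integral_mult_right Gamma_scaled_integral c) (use a in auto)
    moreover have "2 * (c k)\<^sup>2 * (indicator {0<..} x * (x powr ((a + 2) - 1) * exp (- c k * x)))
       + e * (3 * c k) * (indicator {0<..} x * (x powr ((a + 1) - 1) * exp (- c k * x))) = f e k x" for x
    proof (cases "x > 0")
      case True
      have "x powr ((a + 2) - 1) = x\<^sup>2 * x powr (a - 1)" "x powr ((a + 1) - 1) = x * x powr (a - 1)"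
        using True by (simp_all add: powr_add powr_diff power2_eq_square)
      then show ?thesis using True by (simp add: f_def T_def algebra_simps)
    qed (simp add: f_def)
    moreover have "2 * (c k)\<^sup>2 * (Gamma (a + 2) / c k powr (a + 2)) + e * (3 * c k) * (Gamma (a + 1) / c k powr (a + 1)) =
       (2 * Gamma (a + 2) + e * (3 * Gamma (a + 1))) * c k powr - a"
      using c[of k] by (simp add: powr_add powr_minus field_simps)
    ultimately show ?thesis unfolding cp by (simp add: mult_ac)
  qed
  have zs: "summable (\<lambda>k. real (Suc k) powr (- s))"
    using s summable_real_powr_iff[of "- s"] by (subst summable_Suc_iff) simp
  have f1: "f (- 1) k x = indicator {0<..} x * ((2 * pi\<^sup>2 * real (Suc k) ^ 4 * x\<^sup>2 - 3 * pi * real (Suc k) ^ 2 * x) * exp (- pi * (real (Suc k))\<^sup>2 * x)) * x powr (a - 1)" for k x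
    by (simp add: f_def T_def c_def power_mult_distrib mult_ac)
  have fle: "\<bar>f (- 1) k x\<bar> \<le> f 1 k x" for k x
  proof (cases "x > 0")
    case True
    have "\<bar>(2 * (c k)\<^sup>2 * x\<^sup>2 + (- 1) * (3 * c k * x))\<bar> \<le> \<bar>2 * (c k)\<^sup>2 * x\<^sup>2\<bar> + \<bar>(- 1) * (3 * c k * x)\<bar>" by (rule abs_triangle_ineq)
    also have "\<dots> = 2 * (c k)\<^sup>2 * x\<^sup>2 + 1 * (3 * c k * x)" using True c[of k] by (simp add: abs_mult)
    finally have "\<bar>(2 * (c k)\<^sup>2 * x\<^sup>2 + (- 1) * (3 * c k * x))\<bar> \<le> 2 * (c k)\<^sup>2 * x\<^sup>2 + 1 * (3 * c k * x)" .
    then have "\<bar>T (- 1) k x\<bar> \<le> T 1 k x" unfolding T_def abs_mult by (simp add: mult_right_mono)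
    then show ?thesis using True by (simp add: f_def abs_mult mult_right_mono)
  qed (simp add: f_def)
  have ptw: "(\<lambda>k. f (- 1) k x) sums (indicator {0<..} x * (xi_kernel x * x powr (a - 1)))" for x
  proof (cases "x > 0")
    case True
    from sums_mult2[OF sums_mult[OF xi_kernel_sums[OF True], of "indicator {0<..} x"], of "x powr (a - 1)"]
    show ?thesis unfolding f1 by (simp add: mult.assoc)
  qed (simp add: f_def)
  have int1: "integrable lborel (f (- 1) k)" for k using fi[of "- 1" k] by (simp add: has_bochner_integral_iff)
  have abs_sum: "summable (\<lambda>k. norm (f (- 1) k x))" for x
  proof (cases "x > 0")
    case True
    have "summable (\<lambda>k. f 1 k x)"
    proof -
      have "summable (\<lambda>k. 2 * pi\<^sup>2 * x\<^sup>2 * x powr (a - 1) * (real (Suc k) ^ 4 * exp (- pi * (real (Suc k))\<^sup>2 * x)) + 3 * pi * x * x powr (a - 1) * (real (Suc k) ^ 2 * exp (- pi * (real (Suc k))\<^sup>2 * x)))"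
        by (intro summable_add summable_mult theta_moment_summable True)
      moreover have "2 * pi\<^sup>2 * x\<^sup>2 * x powr (a - 1) * (real (Suc k) ^ 4 * exp (- pi * (real (Suc k))\<^sup>2 * x)) + 3 * pi * x * x powr (a - 1) * (real (Suc k) ^ 2 * exp (- pi * (real (Suc k))\<^sup>2 * x)) = f 1 k x" for k
      proof -
        have q: "(c k)\<^sup>2 = pi\<^sup>2 * real (Suc k) ^ 4" by (simp add: c_def power_mult_distrib)
        have "2 * A * x\<^sup>2 * P * (B * E) + 3 * pi * x * P * (D * E) = (2 * (A * B) * x\<^sup>2 + 1 * (3 * (pi * D) * x)) * E * P" for A B D E P
          by (simp add: algebra_simps)
        then show ?thesis using True unfolding f_def T_def q by (simp add: c_def)
      qed
      ultimately show ?thesis by (simp only:)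
    qed
    then show ?thesis by (rule summable_comparison_test'[where N = 0]) (use fle in auto)
  qed (simp add: f_def)
  have int_sum: "summable (\<lambda>k. \<integral>x. norm (f (- 1) k x) \<partial>lborel)"
  proof (rule summable_comparison_test'[where N = 0])
    show "summable (\<lambda>k. (2 * Gamma (a + 2) + 1 * (3 * Gamma (a + 1))) * pi powr - a * real (Suc k) powr (- s))"
      by (intro summable_mult zs)
    fix k
    have "(\<integral>x. norm (f (- 1) k x) \<partial>lborel) \<le> (\<integral>x. f 1 k x \<partial>lborel)"
      using fi[of 1 k] int1[of k] fle by (intro integral_mono) (auto simp: has_bochner_integral_iff)
    also have "\<dots> = (2 * Gamma (a + 2) + 1 * (3 * Gamma (a + 1))) * pi powr - a * real (Suc k) powr (- s)"
      using fi[of 1 k] by (simp add: has_bochner_integral_iff)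
    finally show "norm (\<integral>x. norm (f (- 1) k x) \<partial>lborel) \<le> (2 * Gamma (a + 2) + 1 * (3 * Gamma (a + 1))) * pi powr - a * real (Suc k) powr (- s)"
      by (simp add: Bochner_Integration.integral_nonneg)
  qed
  have AE: "AE x in lborel. summable (\<lambda>k. norm (f (- 1) k x))" using abs_sum by simp
  have lim: "(\<lambda>x. \<Sum>k. f (- 1) k x) = (\<lambda>x. indicator {0<..} x * (xi_kernel x * x powr (a - 1)))"
    using ptw by (simp add: sums_iff)
  have "integrable lborel (\<lambda>x. indicator {0<..} x * (xi_kernel x * x powr (a - 1)))"
    using integrable_suminf[OF int1 AE int_sum] unfolding lim .
  moreover have "(\<lambda>k. integral\<^sup>L lborel (f (- 1) k)) sums (\<integral>x. indicator {0<..} x * (xi_kernel x * x powr (a - 1)) \<partial>lborel)"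
    using sums_integral[OF int1 AE int_sum] unfolding lim .
  moreover have "integral\<^sup>L lborel (f (- 1) k) = pi powr (- s / 2) * Gamma (s / 2) * (s * (s - 1) / 2) * real (Suc k) powr (- s)" for k
  proof -
    have "2 * ((a + 1) * (a * Gamma a)) + (- 1) * (3 * (a * Gamma a)) = Gamma (s / 2) * (s * (s - 1) / 2)"
      by (simp add: a_def algebra_simps)
    then show ?thesis using fi[of "- 1" k] unfolding has_bochner_integral_iff Gm by (simp add: a_def mult_ac)
  qed
  then have "(\<lambda>k. integral\<^sup>L lborel (f (- 1) k)) sums (pi powr (- s / 2) * Gamma (s / 2) * (s * (s - 1) / 2) * (\<Sum>k. real (Suc k) powr (- s)))"
    by (simp only:) (intro sums_mult summable_sums zs)
  ultimately have "integrable lborel (\<lambda>x. indicator {0<..} x * (xi_kernel x * x powr (a - 1)))"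
    "(\<integral>x. indicator {0<..} x * (xi_kernel x * x powr (a - 1)) \<partial>lborel) = pi powr (- s / 2) * Gamma (s / 2) * (s * (s - 1) / 2) * (\<Sum>k. real (Suc k) powr (- s))"
    using sums_unique2 by blast+
  then show ?thesis by (simp add: has_bochner_integral_iff a_def)
qed

text \<open>The substitution \<open>x = 1 / y\<close> maps an open half-line onto the open unit
  interval; the endpoint 1 is then added as a null set, so that the result can be summed with an
  integral over \<open>{1..}\<close>.\<close>

lemma inversion_integral:
  fixes f :: "real \<Rightarrow> real"
  assumes [measurable]: "f \<in> borel_measurable borel"
    and int: "integrable lborel (\<lambda>x. indicator {0<..<1} x * f x)"
  shows "has_bochner_integral lborel (\<lambda>y. indicator {1..} y * (f (1 / y) / y\<^sup>2)) (\<integral>x. indicator {0<..<1} x * f x \<partial>lborel)"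
proof -
  have cv: "set_integrable lebesgue A g \<longleftrightarrow> integrable lborel (\<lambda>x. indicator A x * g x)"
    "set_lebesgue_integral lebesgue A g = (\<integral>x. indicator A x * g x \<partial>lborel)"
    if [measurable]: "A \<in> sets borel" "g \<in> borel_measurable borel" for A and g :: "real \<Rightarrow> real"
  proof -
    have "(\<lambda>x. indicator A x *\<^sub>R g x) \<in> borel_measurable lborel" by measurable
    then show "set_integrable lebesgue A g \<longleftrightarrow> integrable lborel (\<lambda>x. indicator A x * g x)"
      "set_lebesgue_integral lebesgue A g = (\<integral>x. indicator A x * g x \<partial>lborel)"
      unfolding set_integrable_def set_lebesgue_integral_def by (simp_all add: integrable_completion integral_completion)
  qed
  have im: "(\<lambda>y::real. 1 / y) ` {1<..} = {0<..<1}"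
  proof
    show "{0<..<1} \<subseteq> (\<lambda>y::real. 1 / y) ` {1<..}"
    proof
      fix x :: real assume "x \<in> {0<..<1}"
      then show "x \<in> (\<lambda>y::real. 1 / y) ` {1<..}" by (intro image_eqI[of _ _ "1 / x"]) auto
    qed
  qed auto
  have ai: "f absolutely_integrable_on {0<..<1}" using int cv(1)[of "{0<..<1}" f] by simp
  have "(\<lambda>y. \<bar>- 1 / y\<^sup>2\<bar> * f (1 / y)) absolutely_integrable_on {1<..} \<and>
    integral {1<..} (\<lambda>y. \<bar>- 1 / y\<^sup>2\<bar> * f (1 / y)) = integral {0<..<1} f"
  proof (subst has_absolute_integral_change_of_variables_1'[where g = "\<lambda>y. 1 / y"])
    show "((\<lambda>y::real. 1 / y) has_field_derivative - 1 / y\<^sup>2) (at y within {1<..})" if "y \<in> {1<..}" for y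
      using that by (auto intro!: derivative_eq_intros simp: power2_eq_square)
    show "inj_on (\<lambda>y::real. 1 / y) {1<..}" by (auto simp: inj_on_def)
    show "f absolutely_integrable_on (\<lambda>y. 1 / y) ` {1<..} \<and> integral ((\<lambda>y. 1 / y) ` {1<..}) f = integral {0<..<1} f"
      using ai im by simp
  qed simp
  then have A: "(\<lambda>y. f (1 / y) / y\<^sup>2) absolutely_integrable_on {1<..}" "integral {1<..} (\<lambda>y. f (1 / y) / y\<^sup>2) = integral {0<..<1} f"
    by simp_all
  have m2: "(\<lambda>y. f (1 / y) / y\<^sup>2) \<in> borel_measurable borel" by measurable
  have B: "integrable lborel (\<lambda>y. indicator {1<..} y * (f (1 / y) / y\<^sup>2))"
    using A(1) cv(1)[OF _ m2, of "{1<..}"] by simp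
  have C: "(\<integral>y. indicator {1<..} y * (f (1 / y) / y\<^sup>2) \<partial>lborel) = (\<integral>x. indicator {0<..<1} x * f x \<partial>lborel)"
    using set_lebesgue_integral_eq_integral(2)[OF A(1)] set_lebesgue_integral_eq_integral(2)[OF ai] A(2)
      cv(2)[OF _ m2, of "{1<..}"] cv(2)[OF _ assms(1), of "{0<..<1}"] by simp
  have ae: "AE y in lborel. indicator {1<..} y * (f (1 / y) / y\<^sup>2) = indicator {1..} y * (f (1 / y) / y\<^sup>2)"
    using AE_lborel_singleton[of 1] by eventually_elim (auto simp: indicator_def)
  have "has_bochner_integral lborel (\<lambda>y. indicator {1<..} y * (f (1 / y) / y\<^sup>2)) (\<integral>x. indicator {0<..<1} x * f x \<partial>lborel)"
    using B C by (simp add: has_bochner_integral_iff)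
  then show ?thesis
    by (subst (asm) has_bochner_integral_cong_AE[OF _ _ ae]) measurable
qed

text \<open>With m = k + 1, the polynomial factors as pi m^2 x (2 pi m^2 x - 3), and 2 pi > 3. This
  positivity replaces estimates when sum and integral are exchanged, and gives the lower bound for
  the terms beyond the first.\<close>

lemma xi_kernel_term_nonneg:
  assumes "x \<ge> 1"
  shows "(2 * pi\<^sup>2 * real (Suc k) ^ 4 * x\<^sup>2 - 3 * pi * real (Suc k) ^ 2 * x) * exp (- pi * (real (Suc k))\<^sup>2 * x) \<ge> 0"
proof -
  have "1 * 1 \<le> (real (Suc k))\<^sup>2 * x" using assms by (intro mult_mono) auto
  then have "3 * 1 \<le> (2 * pi) * ((real (Suc k))\<^sup>2 * x)" using pi_gt3 by (intro mult_mono) auto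
  then have "0 \<le> (pi * (real (Suc k))\<^sup>2 * x) * (2 * pi * ((real (Suc k))\<^sup>2 * x) - 3)" using assms by (intro mult_nonneg_nonneg) auto
  also have "\<dots> = 2 * pi\<^sup>2 * real (Suc k) ^ 4 * x\<^sup>2 - 3 * pi * real (Suc k) ^ 2 * x"
    by (simp only: power2_eq_square power4_eq_xxxx) (simp only: right_diff_distrib mult_ac)
  finally show ?thesis by (intro mult_nonneg_nonneg) auto
qed

lemma xi_kernel_nonneg: "x \<ge> 1 \<Longrightarrow> xi_kernel x \<ge> 0"
  using sums_le[OF _ sums_zero xi_kernel_sums[of x]] xi_kernel_term_nonneg[of x] by simp

section \<open>Even moments and the entire function xi\<close>

definition xi_moment_integrand :: "nat \<Rightarrow> real \<Rightarrow> real" where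
  "xi_moment_integrand m x = indicator {1..} x * (x powr (- 3 / 4) * xi_kernel x * ln x ^ m)"

definition xi_moment :: "nat \<Rightarrow> real" where
  "xi_moment m = integral\<^sup>L lborel (xi_moment_integrand m)"

text \<open>The coefficients of the integrated series of \<open>2 * cosh (z * ln x)\<close>: the
  factor \<open>2 ^ m\<close> stems from z = (s - 1/2) / 2, and odd orders are absent because cosh
  is even.\<close>

definition xi_fps :: "real fps" where
  "xi_fps = Abs_fps (\<lambda>m. if even m then 2 * xi_moment m / (2 ^ m * fact m) else 0)"

text \<open>For real \<open>s > 1\<close> all terms of the cosh series are nonnegative and their
  partial sums stay below the integrand. This yields the integrability of every even moment, and the
  exchange of sum and integral, without any growth estimate.\<close>

lemma xi_fps_sums:
  fixes s :: real
  assumes s: "s > 1"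
  shows "even m \<Longrightarrow> integrable lborel (xi_moment_integrand m)"
    and "(\<lambda>m. fps_nth xi_fps m * (s - 1/2) ^ m) sums
      (pi powr (- s / 2) * Gamma (s / 2) * (s * (s - 1) / 2) * (\<Sum>k. real (Suc k) powr (- s)))"
proof -
  define z where "z = (s - 1/2) / 2"
  have z: "z > 0" using s by (simp add: z_def)
  define h where "h = (\<lambda>x. xi_kernel x * x powr (s / 2 - 1))"
  have [measurable]: "h \<in> borel_measurable borel" unfolding h_def by measurable
  have M: "has_bochner_integral lborel (\<lambda>x. indicator {0<..} x * h x)
    (pi powr (- s / 2) * Gamma (s / 2) * (s * (s - 1) / 2) * (\<Sum>k. real (Suc k) powr (- s)))"
    unfolding h_def by (rule xi_kernel_Mellin[OF s])
  have sub: "integrable lborel (\<lambda>x. indicator A x * h x)" if "A \<in> sets borel" "A \<subseteq> {0<..}" for A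
  proof -
    have "integrable lborel (\<lambda>x. indicator A x *\<^sub>R (indicator {0<..} x * h x))"
      using M that by (intro integrable_mult_indicator) (auto simp: has_bochner_integral_iff)
    moreover have "indicator A x *\<^sub>R (indicator {0<..} x * h x) = indicator A x * h x" for x
      using that(2) by (auto simp: indicator_def)
    ultimately show ?thesis by (simp only:)
  qed
  have i01: "integrable lborel (\<lambda>x. indicator {0<..<1} x * h x)" and i1: "integrable lborel (\<lambda>x. indicator {1..} x * h x)"
    by (auto intro!: sub)
  have "has_bochner_integral lborel (\<lambda>y. indicator {1..} y * (h (1 / y) / y\<^sup>2) + indicator {1..} y * h y)
     ((\<integral>x. indicator {0<..<1} x * h x \<partial>lborel) + (\<integral>x. indicator {1..} x * h x \<partial>lborel))"
    using i01 i1 by (intro has_bochner_integral_add inversion_integral has_bochner_integral_integrable) auto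
  moreover have "(\<integral>x. indicator {0<..<1} x * h x \<partial>lborel) + (\<integral>x. indicator {1..} x * h x \<partial>lborel) = (\<integral>x. indicator {0<..} x * h x \<partial>lborel)"
  proof -
    have "(\<integral>x. indicator {0<..<1} x * h x \<partial>lborel) + (\<integral>x. indicator {1..} x * h x \<partial>lborel) = (\<integral>x. indicator {0<..<1} x * h x + indicator {1..} x * h x \<partial>lborel)"
      using i01 i1 by simp
    also have "\<dots> = (\<integral>x. indicator {0<..} x * h x \<partial>lborel)"
      by (intro Bochner_Integration.integral_cong) (auto simp: indicator_def)
    finally show ?thesis .
  qed
  moreover have "(\<integral>x. indicator {0<..} x * h x \<partial>lborel) = pi powr (- s / 2) * Gamma (s / 2) * (s * (s - 1) / 2) * (\<Sum>k. real (Suc k) powr (- s))"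
    using M by (simp add: has_bochner_integral_iff)
  \<comment> \<open>Inversion and the Jacobian give the exponent 1/2 - (s/2 - 1) - 2 = -3/4 - z, and
    the original one is s/2 - 1 = -3/4 + z; their mean is the weight
    \<open>y powr (- 3 / 4)\<close>.\<close>
  moreover have "indicator {1..} y * (h (1 / y) / y\<^sup>2) + indicator {1..} y * h y =
      indicator {1..} y * (y powr (- 3 / 4) * xi_kernel y * (2 * cosh (z * ln y)))" for y :: real
  proof (cases "y \<ge> 1")
    case True
    then have y: "y > 0" by simp
    have p: "y powr r = exp (r * ln y)" for r using y by (simp add: powr_def)
    have "h (1 / y) / y\<^sup>2 = xi_kernel y * (sqrt y * (1 / y) powr (s / 2 - 1) / y\<^sup>2)"
      unfolding h_def xi_kernel_inversion[OF y] by simp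
    also have "sqrt y * (1 / y) powr (s / 2 - 1) / y\<^sup>2 = y powr (- 3 / 4) * exp (- (z * ln y))"
    proof -
      have a: "sqrt y = exp (ln y / 2)" using y by (simp add: ln_sqrt[symmetric])
      have b: "(1 / y) powr (s / 2 - 1) = exp (- (s / 2 - 1) * ln y)" using y by (simp add: powr_def ln_div algebra_simps)
      have c: "y\<^sup>2 = exp (2 * ln y)" using y by (simp add: exp_double)
      show ?thesis unfolding a b c p z_def exp_add[symmetric] exp_diff[symmetric]
        by (rule arg_cong[where f = exp]) (simp add: field_simps)
    qed
    finally have 1: "h (1 / y) / y\<^sup>2 = xi_kernel y * (y powr (- 3 / 4) * exp (- (z * ln y)))" .
    have "y powr (s / 2 - 1) = y powr (- 3 / 4) * exp (z * ln y)"
      unfolding p z_def exp_add[symmetric] by (rule arg_cong[where f = exp]) (simp add: field_simps)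
    then have 2: "h y = xi_kernel y * (y powr (- 3 / 4) * exp (z * ln y))" by (simp add: h_def)
    have "xi_kernel y * (P * exp (- u)) + xi_kernel y * (P * exp u) = P * xi_kernel y * (2 * cosh u)" for P u
      by (simp add: cosh_def algebra_simps)
    then show ?thesis using True unfolding 1 2 by simp
  qed simp
  ultimately have tot: "has_bochner_integral lborel (\<lambda>y. indicator {1..} y * (y powr (- 3 / 4) * xi_kernel y * (2 * cosh (z * ln y))))
    (pi powr (- s / 2) * Gamma (s / 2) * (s * (s - 1) / 2) * (\<Sum>k. real (Suc k) powr (- s)))" by simp
  define g where "g = (\<lambda>y. indicator {1..} y * (y powr (- 3 / 4) * xi_kernel y * (2 * cosh (z * ln y))))"
  define f where "f = (\<lambda>m y. if even m then 2 * z ^ m / fact m * xi_moment_integrand m y else 0)"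
  have gi: "integrable lborel g" using tot by (simp add: has_bochner_integral_iff g_def)
  have [measurable]: "xi_moment_integrand m \<in> borel_measurable borel" for m
    unfolding xi_moment_integrand_def by measurable
  have fm: "f m \<in> borel_measurable borel" for m unfolding f_def by measurable
  have f0: "f m y \<ge> 0" for m y
  proof (cases "y \<ge> 1")
    case True
    then show ?thesis using xi_kernel_nonneg[OF True] z by (auto simp: f_def xi_moment_integrand_def intro!: mult_nonneg_nonneg)
  qed (simp add: f_def xi_moment_integrand_def)
  have fs: "(\<lambda>m. f m y) sums g y" for y
  proof -
    have "(\<lambda>m. (indicator {1..} y * (y powr (- 3 / 4) * xi_kernel y) * 2) * (if even m then (z * ln y) ^ m /\<^sub>R fact m else 0)) sums
      ((indicator {1..} y * (y powr (- 3 / 4) * xi_kernel y) * 2) * cosh (z * ln y))"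
      by (intro sums_mult cosh_converges)
    moreover have "(indicator {1..} y * (y powr (- 3 / 4) * xi_kernel y) * 2) * (if even m then (z * ln y) ^ m /\<^sub>R fact m else 0) = f m y" for m
      by (simp add: f_def xi_moment_integrand_def power_mult_distrib inverse_eq_divide)
    ultimately show ?thesis by (simp add: g_def mult_ac)
  qed
  have fg: "(\<Sum>m<N. f m y) \<le> g y" for N y
    using sum_le_suminf[OF sums_summable[OF fs[of y]], of "{..<N}"] f0 sums_unique[OF fs[of y]] by simp
  have fle: "f m y \<le> g y" for m y
  proof -
    have "f m y \<le> (\<Sum>m<Suc m. f m y)" using f0 by (simp add: sum_nonneg)
    then show ?thesis using fg[of y "Suc m"] by linarith
  qed
  have fi: "integrable lborel (f m)" for m
  proof (rule Bochner_Integration.integrable_bound[OF gi])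
    show "f m \<in> borel_measurable lborel" using fm by simp
    have "norm (f m y) \<le> norm (g y)" for y using fle[of m y] f0[of m y] by simp
    then show "AE y in lborel. norm (f m y) \<le> norm (g y)" by simp
  qed
  show "integrable lborel (xi_moment_integrand m)" if "even m"
  proof -
    have "integrable lborel (\<lambda>y. fact m / (2 * z ^ m) * f m y)" using fi by simp
    moreover have "fact m / (2 * z ^ m) * f m y = xi_moment_integrand m y" for y using that z by (simp add: f_def)
    ultimately show ?thesis by simp
  qed
  have AE: "AE y in lborel. summable (\<lambda>m. norm (f m y))" using f0 sums_summable[OF fs] by simp
  have su: "summable (\<lambda>m. \<integral>y. norm (f m y) \<partial>lborel)"
  proof (rule summableI_nonneg_bounded)
    fix N
    have "(\<Sum>m<N. \<integral>y. norm (f m y) \<partial>lborel) = (\<integral>y. (\<Sum>m<N. f m y) \<partial>lborel)"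
      using f0 fi by (subst Bochner_Integration.integral_sum) auto
    also have "\<dots> \<le> integral\<^sup>L lborel g" using fi gi fg by (intro integral_mono) auto
    finally show "(\<Sum>m<N. \<integral>y. norm (f m y) \<partial>lborel) \<le> integral\<^sup>L lborel g" .
  qed simp
  have "(\<lambda>m. integral\<^sup>L lborel (f m)) sums (\<integral>y. (\<Sum>m. f m y) \<partial>lborel)"
    by (rule sums_integral[OF fi AE su])
  also have "(\<integral>y. (\<Sum>m. f m y) \<partial>lborel) = integral\<^sup>L lborel g"
    by (rule arg_cong[where f = "integral\<^sup>L lborel"]) (use sums_unique[OF fs] in auto)
  also have "integral\<^sup>L lborel g = pi powr (- s / 2) * Gamma (s / 2) * (s * (s - 1) / 2) * (\<Sum>k. real (Suc k) powr (- s))"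
    using tot by (simp add: has_bochner_integral_iff g_def)
  also have "(\<lambda>m. integral\<^sup>L lborel (f m)) = (\<lambda>m. fps_nth xi_fps m * (s - 1/2) ^ m)"
  proof
    fix m
    have "z ^ m = (s - 1/2) ^ m / 2 ^ m" by (simp add: z_def power_divide)
    then show "integral\<^sup>L lborel (f m) = fps_nth xi_fps m * (s - 1/2) ^ m"
      by (simp add: f_def xi_fps_def xi_moment_def)
  qed
  finally show "(\<lambda>m. fps_nth xi_fps m * (s - 1/2) ^ m) sums
      (pi powr (- s / 2) * Gamma (s / 2) * (s * (s - 1) / 2) * (\<Sum>k. real (Suc k) powr (- s)))" .
qed

text \<open>The series converges at every real \<open>s > 1\<close>, thus at points arbitrarily far
  from 1/2, which makes its sum entire.\<close>

lemma xi_fps_conv_radius: "fps_conv_radius (fps_complex xi_fps) = \<infinity>"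
proof (rule ereal_top)
  fix B :: real
  define s where "s = max 2 (B + 1/2)"
  have s: "s > 1" "B \<le> s - 1/2" by (auto simp: s_def)
  have "summable (\<lambda>m. complex_of_real (fps_nth xi_fps m * (s - 1/2) ^ m))"
    using sums_summable[OF xi_fps_sums(2)[OF s(1)]] by (simp only: summable_complex_of_real)
  then have "summable (\<lambda>m. fps_nth (fps_complex xi_fps) m * of_real (s - 1/2) ^ m)" by simp
  from conv_radius_geI[OF this] have "fps_conv_radius (fps_complex xi_fps) \<ge> ereal \<bar>s - 1/2\<bar>"
    unfolding fps_conv_radius_def norm_of_real .
  then show "fps_conv_radius (fps_complex xi_fps) \<ge> ereal B"
    using s by (elim order.trans[rotated]) simp
qed

definition xi_entire :: "complex \<Rightarrow> complex" where
  "xi_entire s = eval_fps (fps_complex xi_fps) (s - 1/2)"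

lemma xi_entire_holomorphic [holomorphic_intros]: "xi_entire holomorphic_on A"
proof -
  have "eval_fps (fps_complex xi_fps) holomorphic_on UNIV"
    by (rule holomorphic_on_eval_fps) (simp add: xi_fps_conv_radius)
  then have "(eval_fps (fps_complex xi_fps) \<circ> (\<lambda>s. s - 1/2)) holomorphic_on A"
    by (intro holomorphic_on_compose holomorphic_on_subset[OF \<open>eval_fps (fps_complex xi_fps) holomorphic_on UNIV\<close>] holomorphic_on_diff holomorphic_on_ident holomorphic_on_const subset_UNIV)
  then show ?thesis by (simp add: o_def xi_entire_def[abs_def])
qed

lemma xi_entire_real:
  assumes s: "s > 1"
  shows "xi_entire (of_real s) = of_real (pi powr (- s / 2) * Gamma (s / 2) * (s * (s - 1) / 2) * (\<Sum>k. real (Suc k) powr (- s)))"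
proof -
  have "(\<lambda>m. complex_of_real (fps_nth xi_fps m * (s - 1/2) ^ m)) sums of_real (pi powr (- s / 2) * Gamma (s / 2) * (s * (s - 1) / 2) * (\<Sum>k. real (Suc k) powr (- s)))"
    using xi_fps_sums(2)[OF s] by (simp only: sums_of_real_iff)
  moreover have "complex_of_real (fps_nth xi_fps m * (s - 1/2) ^ m) = fps_nth (fps_complex xi_fps) m * (of_real s - 1/2) ^ m" for m
    by simp
  ultimately show ?thesis unfolding xi_entire_def eval_fps_def by (simp only: sums_iff)
qed

text \<open>At \<open>s = 1\<close> the division yields \<open>0\<close>, which is the value that \<open>riemann_zeta\<close> takes at the pole.\<close>
definition zeta_continuation :: "complex \<Rightarrow> complex" where
  "zeta_continuation s = xi_entire s * of_real pi powr (s / 2) * rGamma (s / 2 + 1) / (s - 1)"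

text \<open>Merging \<open>s / 2\<close> with Gamma (s / 2) into Gamma (s / 2 + 1), whose reciprocal
  is entire, leaves \<open>s = 1\<close> as the only possible singularity.\<close>

lemma zeta_continuation_holomorphic: "zeta_continuation holomorphic_on - {1}"
  unfolding zeta_continuation_def by (intro holomorphic_intros) auto

lemma zeta_continuation_real:
  assumes s: "s > 1"
  shows "zeta_continuation (of_real s) = of_real (\<Sum>k. real (Suc k) powr (- s))"
proof -
  have G: "Gamma (s / 2) > 0" using s by (intro Gamma_real_pos) auto
  have r1: "s / 2 * rGamma (s / 2 + 1) = inverse (Gamma (s / 2))"
    unfolding rGamma_plus1 by (rule rGamma_inverse_Gamma)
  have p: "complex_of_real pi powr (of_real s / 2) = of_real (pi powr (s / 2))"
    using powr_of_real[of pi "s / 2"] by simp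
  have r: "rGamma (complex_of_real s / 2 + 1) = of_real (rGamma (s / 2 + 1))"
    using rGamma_complex_of_real[of "s / 2 + 1"] by simp
  have "P * A * (s * (s - 1) / 2) * Z * Q * R / (s - 1) = Z"
    if "P * Q = 1" "s / 2 * R = inverse A" "A > 0" for P A Z Q R :: real
  proof -
    have "P * A * (s * u / 2) * Z * Q * R / u = (P * Q) * (A * (s / 2 * R)) * Z" if "u \<noteq> 0" for u using that by simp
    from this[of "s - 1"] show ?thesis using s unfolding that(1,2) using that(3) by simp
  qed
  note calc = this
  have "zeta_continuation (of_real s) = of_real (pi powr (- s / 2) * Gamma (s / 2) * (s * (s - 1) / 2) * (\<Sum>k. real (Suc k) powr (- s)) * pi powr (s / 2) * rGamma (s / 2 + 1) / (s - 1))"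
    unfolding zeta_continuation_def xi_entire_real[OF s] p r by simp
  also have "pi powr (- s / 2) * Gamma (s / 2) * (s * (s - 1) / 2) * (\<Sum>k. real (Suc k) powr (- s)) * pi powr (s / 2) * rGamma (s / 2 + 1) / (s - 1) = (\<Sum>k. real (Suc k) powr (- s))"
    by (rule calc[OF _ r1 G]) (simp flip: powr_add)
  finally show ?thesis .
qed

section \<open>Identification of zeta and xi\<close>

lemma dirichlet_zeta_holomorphic:
  shows "\<And>s. Re s > 1 \<Longrightarrow> summable (\<lambda>k. 1 / of_nat (Suc k) powr s :: complex)"
    and "(\<lambda>s. \<Sum>k. 1 / of_nat (Suc k) powr s :: complex) holomorphic_on {s. Re s > 1}"
proof -
  have nrm: "norm (1 / of_nat (Suc k) powr s :: complex) = real (Suc k) powr (- Re s)" for k s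
    by (simp add: norm_divide norm_powr_real_powr powr_minus_divide del: of_nat_Suc)
  have sm: "summable (\<lambda>k. real (Suc k) powr (- r))" if "r > 1" for r
    using that summable_real_powr_iff[of "- r"] by (subst summable_Suc_iff) simp
  show "summable (\<lambda>k. 1 / of_nat (Suc k) powr s :: complex)" if "Re s > 1" for s
    by (rule summable_norm_cancel) (simp only: nrm sm that)
  show "(\<lambda>s. \<Sum>k. 1 / of_nat (Suc k) powr s :: complex) holomorphic_on {s. Re s > 1}"
  proof (rule holomorphic_uniform_sequence[where f = "\<lambda>n s. \<Sum>k<n. 1 / of_nat (Suc k) powr s"])
    show "open {s. Re s > 1}" by (rule open_halfspace_Re_gt)
    show "(\<lambda>s. \<Sum>k<n. 1 / of_nat (Suc k) powr s :: complex) holomorphic_on {s. Re s > 1}" for n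
      by (intro holomorphic_intros) (auto simp del: of_nat_Suc)
    fix x :: complex assume x: "x \<in> {s. Re s > 1}"
    define d where "d = (Re x - 1) / 2"
    have d: "d > 0" using x by (simp add: d_def)
    have ge: "Re s \<ge> 1 + d" if "s \<in> cball x d" for s
    proof -
      have "\<bar>Re (x - s)\<bar> \<le> d" using that abs_Re_le_cmod[of "x - s"] by (simp add: dist_norm)
      then have "Re x - Re s \<le> d" unfolding minus_complex.sel by (rule order.trans[OF abs_ge_self])
      moreover have "2 * d = Re x - 1" by (simp add: d_def)
      ultimately show ?thesis by linarith
    qed
    show "\<exists>d>0. cball x d \<subseteq> {s. Re s > 1} \<and> uniform_limit (cball x d) (\<lambda>n s. \<Sum>k<n. 1 / of_nat (Suc k) powr s) (\<lambda>s. \<Sum>k. 1 / of_nat (Suc k) powr s) sequentially"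
    proof (intro exI[of _ d] conjI d)
      show "cball x d \<subseteq> {s. Re s > 1}" using ge d by force
      show "uniform_limit (cball x d) (\<lambda>n s. \<Sum>k<n. 1 / of_nat (Suc k) powr s) (\<lambda>s. \<Sum>k. 1 / of_nat (Suc k) powr s) sequentially"
      proof (rule Weierstrass_m_test)
        show "summable (\<lambda>k. real (Suc k) powr (- (1 + d)))" by (rule sm) (use d in simp)
        fix k s assume "s \<in> cball x d"
        then have "- Re s \<le> - (1 + d)" using ge[of s] by linarith
        then have "real (Suc k) powr (- Re s) \<le> real (Suc k) powr (- (1 + d))"
          by (intro powr_mono) auto
        then show "norm (1 / of_nat (Suc k) powr s :: complex) \<le> real (Suc k) powr (- (1 + d))" unfolding nrm .
      qed
    qed
  qed
qed

text \<open>Agreement on the real ray beyond 1, which has the limit point 2 in the half-plane,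
  spreads by the identity theorem.\<close>

lemma zeta_continuation_eq_dirichlet:
  assumes "Re s > 1"
  shows "zeta_continuation s = (\<Sum>k. 1 / of_nat (Suc k) powr s)"
proof -
  define g where "g = (\<lambda>s. zeta_continuation s - (\<Sum>k. 1 / of_nat (Suc k) powr s))"
  have "g s = 0"
  proof (rule analytic_continuation[of g "{s. Re s > 1}" "complex_of_real ` {1<..}" 2])
    show "g holomorphic_on {s. Re s > 1}"
      unfolding g_def
      by (intro holomorphic_intros dirichlet_zeta_holomorphic holomorphic_on_subset[OF zeta_continuation_holomorphic]) auto
    show "open {s. Re s > 1}" by (rule open_halfspace_Re_gt)
    show "connected {s. Re s > 1}" by (intro convex_connected convex_halfspace_Re_gt)
    show "2 islimpt complex_of_real ` {1<..}"
    proof -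
      have "\<exists>y\<in>complex_of_real ` {1<..}. y \<noteq> 2 \<and> dist y 2 < e" if e: "e > 0" for e
      proof (rule bexI[of _ "complex_of_real (2 + e / 2)"])
        have "complex_of_real (2 + e / 2) - 2 = of_real (e / 2)" by simp
        then have n: "norm (complex_of_real (2 + e / 2) - 2) = e / 2" using e by (simp only: norm_of_real)
        show "complex_of_real (2 + e / 2) \<noteq> 2 \<and> dist (complex_of_real (2 + e / 2)) 2 < e"
          unfolding dist_norm n using e n by auto
        show "complex_of_real (2 + e / 2) \<in> complex_of_real ` {1<..}"
          by (rule imageI) (use e in simp)
      qed
      then show ?thesis unfolding islimpt_approachable by blast
    qed
    fix z assume "z \<in> complex_of_real ` {1<..}"
    then obtain r where r: "z = of_real r" "r > 1" by auto
    have e: "1 / of_nat (Suc k) powr complex_of_real r = of_real (real (Suc k) powr (- r))" for k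
      using powr_of_real[of "real (Suc k)" r] by (simp add: powr_minus_divide del: of_nat_Suc)
    have "summable (\<lambda>k. real (Suc k) powr (- r))"
      using r summable_real_powr_iff[of "- r"] by (subst summable_Suc_iff) simp
    then have "(\<Sum>k. complex_of_real (real (Suc k) powr (- r))) = of_real (\<Sum>k. real (Suc k) powr (- r))"
      by (rule suminf_of_real[symmetric])
    then show "g z = 0" unfolding g_def r(1) e zeta_continuation_real[OF r(2)] by simp
  qed (use assms in auto)
  then show ?thesis by (simp add: g_def)
qed

text \<open>The construction gives existence in the description; uniqueness is the identity theorem
  on the punctured plane, which is connected, with the value at 1 prescribed.\<close>

lemma riemann_zeta_eq: "riemann_zeta = zeta_continuation"
  unfolding riemann_zeta_def
proof (rule the_equality)
  have S: "(\<lambda>n. 1 / of_nat (Suc n) powr s) sums zeta_continuation s" if "Re s > 1" for s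
    unfolding zeta_continuation_eq_dirichlet[OF that] by (intro summable_sums dirichlet_zeta_holomorphic that)
  then show "zeta_continuation holomorphic_on - {1} \<and> zeta_continuation 1 = 0 \<and> (\<forall>s. 1 < Re s \<longrightarrow> (\<lambda>n. 1 / of_nat (Suc n) powr s) sums zeta_continuation s)"
    using zeta_continuation_holomorphic by (simp add: zeta_continuation_def)
  fix f assume f: "f holomorphic_on - {1} \<and> f 1 = 0 \<and> (\<forall>s. 1 < Re s \<longrightarrow> (\<lambda>n. 1 / of_nat (Suc n) powr s) sums f s)"
  show "f = zeta_continuation"
  proof
    fix s
    show "f s = zeta_continuation s"
    proof (cases "s = 1")
      case True then show ?thesis using f by (simp add: zeta_continuation_def)
    next
      case False
      show ?thesis
      proof (rule analytic_continuation_open[of "{s. Re s > 1}" "- {1}" f zeta_continuation])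
        show "{s. Re s > 1} \<noteq> {}" by (auto intro: exI[of _ 2])
        show "connected (- {1::complex})" by (rule connected_punctured_universe) simp
        show "f z = zeta_continuation z" if "z \<in> {s. Re s > 1}" for z
          using f S[of z] that by (auto intro: sums_unique2)
      qed (use f False zeta_continuation_holomorphic in \<open>auto intro: open_halfspace_Re_gt\<close>)
    qed
  qed
qed

text \<open>This region contains a neighbourhood of 1/2 and avoids the poles of Gamma (s / 2) and of
  zeta, where the default values of the definitions would differ from the limits.\<close>

lemma riemann_xi_eq:
  assumes "Re s > 0" "s \<noteq> 1"
  shows "riemann_xi s = xi_entire s"
proof -
  have n: "s / 2 \<notin> \<int>\<^sub>\<le>\<^sub>0"
  proof
    assume "s / 2 \<in> \<int>\<^sub>\<le>\<^sub>0"
    then obtain m where "s / 2 = - of_nat m" by (auto elim!: nonpos_Ints_cases')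
    then have "Re (s / 2) = - real m" by simp
    then show False using assms(1) by simp
  qed
  have "Gamma (s / 2) * (s / 2 * rGamma (s / 2 + 1)) = 1"
    unfolding rGamma_plus1 unfolding rGamma_inverse_Gamma using n by (simp add: Gamma_eq_zero_iff)
  moreover have "complex_of_real pi powr (- s / 2) * of_real pi powr (s / 2) = 1"
    by (simp flip: powr_add)
  moreover have "1 / 2 * s * u * P * G * (X * Q * R / u) = (P * Q) * (G * (s / 2 * R)) * X" if "u \<noteq> 0" for P G X Q R u
    using that by simp
  from this[of "s - 1"] have "1 / 2 * s * (s - 1) * P * G * (X * Q * R / (s - 1)) = (P * Q) * (G * (s / 2 * R)) * X" for P G X Q R
    using assms(2) by (simp only: right_minus_eq not_False_eq_True)
  ultimately show ?thesis
    unfolding riemann_xi_def riemann_zeta_eq zeta_continuation_def by (simp only: mult_1_left)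
qed

text \<open>Derivatives at 1/2 see only a neighbourhood, where xi is the sum of its moment series;
  the (2 n)! of Taylor's formula cancels the one in the coefficient of \<open>xi_fps\<close>, so
  that only the factor from \<open>gamma_coeff\<close> remains.\<close>

theorem gamma_coeff_eq:
  "gamma_coeff n = complex_of_real (fact n / fact (2 * n) * (2 * xi_moment (2 * n) / 4 ^ n))"
proof -
  have "eventually (\<lambda>s. s \<in> {s. Re s > 0} - {1}) (nhds (1/2 :: complex))"
    by (intro eventually_nhds_in_open open_Diff open_halfspace_Re_gt) auto
  then have ev: "eventually (\<lambda>s. riemann_xi s = xi_entire s) (nhds (1/2))"
    by eventually_elim (auto intro: riemann_xi_eq)
  have "(deriv ^^ (2 * n)) riemann_xi (1/2) = (deriv ^^ (2 * n)) xi_entire (1/2)"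
    by (rule higher_deriv_cong_ev[OF ev refl])
  also have "\<dots> = (deriv ^^ (2 * n)) (eval_fps (fps_complex xi_fps)) 0"
    by (subst higher_deriv_shift_0) (simp add: o_def xi_entire_def)
  also have "\<dots> = fact (2 * n) * fps_nth (fps_complex xi_fps) (2 * n)"
    using fps_nth_conv_deriv[of "fps_complex xi_fps" "2 * n"] by (simp add: xi_fps_conv_radius)
  also have "\<dots> = of_real (2 * xi_moment (2 * n) / 4 ^ n)"
    by (simp add: xi_fps_def power_mult)
  finally show ?thesis unfolding gamma_coeff_def by simp
qed

section \<open>The coefficients as functions of w\<close>

text \<open>Positive arguments are the natural domain: the denominators that occur are built from
  \<open>w\<close> and \<open>w + 1\<close>.\<close>

definition rational_on_pos :: "(real \<Rightarrow> real) \<Rightarrow> bool" where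
  "rational_on_pos f \<longleftrightarrow> (\<exists>P Q :: real poly. \<forall>x>0. poly Q x \<noteq> 0 \<and> f x = poly P x / poly Q x)"

lemma rational_on_pos_const: "rational_on_pos (\<lambda>_. c)"
  unfolding rational_on_pos_def by (intro exI[of _ "[:c:]"] exI[of _ 1]) auto

lemma rational_on_pos_ident: "rational_on_pos (\<lambda>x. x)"
  unfolding rational_on_pos_def by (intro exI[of _ "[:0, 1:]"] exI[of _ 1]) auto

lemma rational_on_pos_add:
  assumes "rational_on_pos f" "rational_on_pos g"
  shows "rational_on_pos (\<lambda>x. f x + g x)"
proof -
  obtain P Q P' Q' where "\<forall>x>0. poly Q x \<noteq> 0 \<and> f x = poly P x / poly Q x" "\<forall>x>0. poly Q' x \<noteq> 0 \<and> g x = poly P' x / poly Q' x"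
    using assms unfolding rational_on_pos_def by blast
  then show ?thesis
    unfolding rational_on_pos_def by (intro exI[of _ "P * Q' + P' * Q"] exI[of _ "Q * Q'"]) (auto simp: add_frac_eq)
qed

lemma rational_on_pos_mult:
  assumes "rational_on_pos f" "rational_on_pos g"
  shows "rational_on_pos (\<lambda>x. f x * g x)"
proof -
  obtain P Q P' Q' where "\<forall>x>0. poly Q x \<noteq> 0 \<and> f x = poly P x / poly Q x" "\<forall>x>0. poly Q' x \<noteq> 0 \<and> g x = poly P' x / poly Q' x"
    using assms unfolding rational_on_pos_def by blast
  then show ?thesis
    unfolding rational_on_pos_def by (intro exI[of _ "P * P'"] exI[of _ "Q * Q'"]) auto
qed

lemma rational_on_pos_inverse:
  assumes "rational_on_pos f" "\<And>x. x > 0 \<Longrightarrow> f x \<noteq> 0"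
  shows "rational_on_pos (\<lambda>x. inverse (f x))"
proof -
  obtain P Q where "\<forall>x>0. poly Q x \<noteq> 0 \<and> f x = poly P x / poly Q x"
    using assms(1) unfolding rational_on_pos_def by blast
  with assms(2) have "\<forall>x>0. poly P x \<noteq> 0 \<and> inverse (f x) = poly Q x / poly P x" by force
  then show ?thesis unfolding rational_on_pos_def by blast
qed

lemma rational_on_pos_diff:
  "rational_on_pos f \<Longrightarrow> rational_on_pos g \<Longrightarrow> rational_on_pos (\<lambda>x. f x - g x)"
  using rational_on_pos_add[OF _ rational_on_pos_mult[OF rational_on_pos_const[of "-1"]], of f g] by simp

lemma rational_on_pos_divide:
  "rational_on_pos f \<Longrightarrow> rational_on_pos g \<Longrightarrow> (\<And>x. x > 0 \<Longrightarrow> g x \<noteq> 0) \<Longrightarrow> rational_on_pos (\<lambda>x. f x / g x)"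
  unfolding divide_inverse by (intro rational_on_pos_mult rational_on_pos_inverse)

lemma rational_on_pos_power: "rational_on_pos f \<Longrightarrow> rational_on_pos (\<lambda>x. f x ^ n)"
  by (induction n) (auto intro: rational_on_pos_const rational_on_pos_mult)

lemma rational_on_pos_sum:
  assumes "\<And>i. i \<in> A \<Longrightarrow> rational_on_pos (f i)"
  shows "rational_on_pos (\<lambda>x. \<Sum>i\<in>A. f i x)"
  using assms by (induction A rule: infinite_finite_induct) (auto intro: rational_on_pos_const rational_on_pos_add)

lemmas rational_on_pos_intros = rational_on_pos_const rational_on_pos_ident rational_on_pos_add rational_on_pos_mult
  rational_on_pos_diff rational_on_pos_divide rational_on_pos_power rational_on_pos_sum

lemma rational_ell: "rational_on_pos (ell i)"
  unfolding ell_def[abs_def] by (intro rational_on_pos_intros) auto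

lemma ord_bell_Suc:
  "ord_bell i (Suc j) p = (\<Sum>l=0..i. (if l = 0 then 0 else p l) * ord_bell (i - l) j p)"
  by (simp add: ord_bell_def fps_mult_nth)

lemma ord_bell_0: "ord_bell i 0 p = (if i = 0 then 1 else 0)"
  by (simp add: ord_bell_def)

text \<open>The recursion in \<open>j\<close> turns Bell polynomials into finite sums of products,
  to which the closure rules apply.\<close>

lemma rational_ord_bell: "rational_on_pos (\<lambda>w. ord_bell i j (\<lambda>k. ell (k + 2) w))"
proof (induction j arbitrary: i)
  case 0
  then show ?case unfolding ord_bell_0 by (rule rational_on_pos_const)
next
  case (Suc j)
  have "rational_on_pos (\<lambda>w. if l = 0 then 0 else ell (l + 2) w)" for l
    using rational_on_pos_const[of 0] rational_ell[of "l + 2"] by (cases "l = 0") simp_all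
  then show ?case unfolding ord_bell_Suc by (intro rational_on_pos_sum rational_on_pos_mult Suc)
qed

lemma rational_a_coeff: "rational_on_pos (a_coeff \<beta> r)"
  unfolding a_coeff_def[abs_def] by (intro rational_on_pos_intros rational_ord_bell) auto

lemma rational_mu_coeff: "rational_on_pos (mu_coeff r)"
proof -
  have "rational_on_pos (\<lambda>w. if r = 0 then 0 else a_coeff (1/4) (r - 1) w)"
    using rational_on_pos_const[of 0] rational_a_coeff[of "1/4" "r - 1"] by (cases "r = 0") simp_all
  then show ?thesis unfolding mu_coeff_def[abs_def] by (intro rational_on_pos_intros rational_a_coeff) auto
qed

lemma rational_c_coeff: "rational_on_pos (c_coeff k)"
  unfolding c_coeff_def[abs_def] by (intro rational_on_pos_intros rational_mu_coeff)

section \<open>Growth of the coefficients in \<open>w\<close>\<close>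

definition power_bounded :: "nat \<Rightarrow> (real \<Rightarrow> real) \<Rightarrow> bool" where
  "power_bounded r f \<longleftrightarrow> (\<exists>C. \<forall>w\<ge>1. \<bar>f w\<bar> \<le> C * w ^ r)"

lemma power_bounded_add:
  assumes "power_bounded r f" "power_bounded r g"
  shows "power_bounded r (\<lambda>w. f w + g w)"
proof -
  obtain C D where "\<forall>w\<ge>1. \<bar>f w\<bar> \<le> C * w ^ r" "\<forall>w\<ge>1. \<bar>g w\<bar> \<le> D * w ^ r"
    using assms unfolding power_bounded_def by blast
  then have "\<forall>w\<ge>1. \<bar>f w + g w\<bar> \<le> (C + D) * w ^ r"
    by (auto simp: distrib_right intro!: order.trans[OF abs_triangle_ineq] add_mono)
  then show ?thesis unfolding power_bounded_def by blast
qed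

lemma power_bounded_0: "power_bounded r (\<lambda>_. 0)"
  unfolding power_bounded_def by (intro exI[of _ 0]) auto

lemma power_bounded_sum:
  assumes "\<And>i. i \<in> A \<Longrightarrow> power_bounded r (f i)"
  shows "power_bounded r (\<lambda>x. \<Sum>i\<in>A. f i x)"
  using assms by (induction A rule: infinite_finite_induct) (auto intro: power_bounded_0 power_bounded_add)

lemma power_bounded_mult:
  assumes "power_bounded r f" "power_bounded s g"
  shows "power_bounded (r + s) (\<lambda>w. f w * g w)"
proof -
  obtain C D where CD: "\<forall>w\<ge>1. \<bar>f w\<bar> \<le> C * w ^ r" "\<forall>w\<ge>1. \<bar>g w\<bar> \<le> D * w ^ s"
    using assms unfolding power_bounded_def by blast
  have "\<bar>f w * g w\<bar> \<le> (C * D) * w ^ (r + s)" if "w \<ge> 1" for w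
  proof -
    have "\<bar>f w\<bar> * \<bar>g w\<bar> \<le> (C * w ^ r) * (D * w ^ s)"
    proof (rule mult_mono)
      show "0 \<le> C * w ^ r" using CD(1) that abs_ge_zero order.trans by blast
    qed (use CD that in auto)
    then show ?thesis by (simp add: abs_mult power_add mult_ac)
  qed
  then show ?thesis unfolding power_bounded_def by blast
qed

lemma power_bounded_const: "power_bounded 0 (\<lambda>_. c)"
  unfolding power_bounded_def by (intro exI[of _ "\<bar>c\<bar>"]) auto

lemma power_bounded_ident: "power_bounded 1 (\<lambda>w. w)"
  unfolding power_bounded_def by (intro exI[of _ 1]) auto

lemma power_bounded_cmult: "power_bounded r f \<Longrightarrow> power_bounded r (\<lambda>w. c * f w)"
  using power_bounded_mult[OF power_bounded_const, of r f c] by simp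

lemma power_bounded_mono:
  assumes "power_bounded r f" "r \<le> s"
  shows "power_bounded s f"
proof -
  obtain C where C: "\<forall>w\<ge>1. \<bar>f w\<bar> \<le> C * w ^ r" using assms unfolding power_bounded_def by blast
  have "\<bar>f w\<bar> \<le> \<bar>C\<bar> * w ^ s" if w: "w \<ge> 1" for w
  proof -
    have "\<bar>f w\<bar> \<le> C * w ^ r" using C w by blast
    also have "\<dots> \<le> \<bar>C\<bar> * w ^ s" using w assms(2) by (intro mult_mono power_increasing) auto
    finally show ?thesis .
  qed
  then show ?thesis unfolding power_bounded_def by blast
qed

text \<open>Each of the \<open>j\<close> factors \<open>ell (k + 2) w\<close> is O(1/w), so a
  product of \<open>j\<close> of them compensates \<open>w ^ j\<close>.\<close>

lemma power_bounded_ord_bell: "power_bounded 0 (\<lambda>w. w ^ j * ord_bell i j (\<lambda>k. ell (k + 2) w))"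
proof (induction j arbitrary: i)
  case 0
  then show ?case unfolding ord_bell_0 by (simp add: power_bounded_const)
next
  case (Suc j)
  have e: "power_bounded 0 (\<lambda>w. w * (if l = 0 then 0 else ell (l + 2) w))" for l
  proof -
    have "\<bar>w * (if l = 0 then 0 else ell (l + 2) w)\<bar> \<le> 5 ^ (l + 2) * w ^ 0" if "w \<ge> 1" for w
    proof -
      have "w * \<bar>ell (l + 2) w\<bar> \<le> w * (5 ^ (l + 2) / w)" using that by (intro mult_left_mono ell_bound) auto
      then show ?thesis using that by (simp add: abs_mult)
    qed
    then show ?thesis unfolding power_bounded_def by blast
  qed
  have "power_bounded 0 (\<lambda>w. \<Sum>l=0..i. (w * (if l = 0 then 0 else ell (l + 2) w)) * (w ^ j * ord_bell (i - l) j (\<lambda>k. ell (k + 2) w)))"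
    by (intro power_bounded_sum power_bounded_mult[of 0 _ 0, simplified] e Suc)
  moreover have "(\<Sum>l=0..i. (w * (if l = 0 then 0 else ell (l + 2) w)) * (w ^ j * ord_bell (i - l) j (\<lambda>k. ell (k + 2) w))) =
     w ^ Suc j * ord_bell i (Suc j) (\<lambda>k. ell (k + 2) w)" for w
    unfolding ord_bell_Suc sum_distrib_left by (intro sum.cong refl) (simp add: mult_ac)
  ultimately show ?case by simp
qed

text \<open>\<open>(w\<^sup>2 / (w + 1)) ^ (j + r)\<close> is a bounded quotient times
  \<open>w ^ j * w ^ r\<close>, and the Bell polynomial absorbs \<open>w ^ j\<close>. The growth
  \<open>w ^ r\<close> is thus the same for all j; it is the origin of the powers of the logarithm
  in the theorem.\<close>

lemma power_bounded_a_coeff: "power_bounded r (a_coeff \<beta> r)"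
proof -
  have t: "power_bounded r (\<lambda>w. (w\<^sup>2 / (w + 1)) ^ (j + r) * ord_bell i j (\<lambda>k. ell (k + 2) w))" for i j
  proof -
    have 1: "power_bounded 0 (\<lambda>w. (w / (w + 1)) ^ (j + r))"
      unfolding power_bounded_def by (intro exI[of _ 1]) (auto intro!: power_le_one)
    have 2: "power_bounded r (\<lambda>w. w ^ r)" unfolding power_bounded_def by (intro exI[of _ 1]) auto
    have "power_bounded (0 + (r + 0)) (\<lambda>w. (w / (w + 1)) ^ (j + r) * (w ^ r * (w ^ j * ord_bell i j (\<lambda>k. ell (k + 2) w))))"
      by (intro power_bounded_mult 1 2 power_bounded_ord_bell)
    moreover have "(w / (w + 1)) ^ (j + r) * (w ^ r * (w ^ j * b)) = (w\<^sup>2 / (w + 1)) ^ (j + r) * b" for w b :: real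
      by (simp add: power_divide power_add power2_eq_square power_mult_distrib mult_ac)
    ultimately show ?thesis by simp
  qed
  have "power_bounded r (\<lambda>w. \<Sum>j=0..2*r. \<Sum>i=j..2*r. (real (odd_dfact (j + r)) / fact j * (\<beta> gchoose (2 * r - i))) * ((w\<^sup>2 / (w + 1)) ^ (j + r) * ord_bell i j (\<lambda>k. ell (k + 2) w)))"
    by (intro power_bounded_sum power_bounded_cmult t)
  moreover have "(\<Sum>j=0..2*r. \<Sum>i=j..2*r. (real (odd_dfact (j + r)) / fact j * (\<beta> gchoose (2 * r - i))) * ((w\<^sup>2 / (w + 1)) ^ (j + r) * ord_bell i j (\<lambda>k. ell (k + 2) w))) = a_coeff \<beta> r w" for w
    unfolding a_coeff_def sum_distrib_left by (intro sum.cong refl) (simp only: mult_ac times_divide_eq_left times_divide_eq_right)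
  ultimately show ?thesis by simp
qed

text \<open>The index shift in the second coefficient lowers its growth by one power, which the
  explicit \<open>w\<close> restores.\<close>

lemma power_bounded_mu_coeff: "power_bounded r (mu_coeff r)"
proof -
  have 1: "power_bounded r (\<lambda>w. w * (if r = 0 then 0 else a_coeff (1/4) (r - 1) w))"
  proof (cases "r = 0")
    case False
    then show ?thesis using power_bounded_mult[OF power_bounded_ident power_bounded_a_coeff[of "r - 1" "1/4"]] by simp
  qed (simp add: power_bounded_0)
  have "power_bounded r (\<lambda>w. (2 / 2 ^ (r + 1)) * a_coeff (5/4) r w + (- 3 / 2 ^ (r + 1)) * (w * (if r = 0 then 0 else a_coeff (1/4) (r - 1) w)))"
    by (intro power_bounded_add power_bounded_cmult 1 power_bounded_a_coeff)
  moreover have "(2 / 2 ^ (r + 1)) * a_coeff (5/4) r w + (- 3 / 2 ^ (r + 1)) * (w * (if r = 0 then 0 else a_coeff (1/4) (r - 1) w)) = mu_coeff r w" for w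
    unfolding mu_coeff_def by (simp add: diff_divide_distrib)
  ultimately show ?thesis by simp
qed

lemma power_bounded_c_coeff: "power_bounded k (c_coeff k)"
proof -
  have "power_bounded k (\<lambda>w. \<Sum>j=0..k. kappa_star (k - j) * mu_coeff j w)"
    by (intro power_bounded_sum power_bounded_cmult power_bounded_mono[OF power_bounded_mu_coeff]) auto
  moreover have "(\<Sum>j=0..k. kappa_star (k - j) * mu_coeff j w) = c_coeff k w" for w
    by (simp add: c_coeff_def mult.commute)
  ultimately show ?thesis by simp
qed

section \<open>The asymptotic expansion\<close>

text \<open>Since \<open>y \<le> y * exp y\<close>, the intermediate value theorem on
  \<open>{0..y}\<close> finds a preimage; strict monotonicity makes it unique.\<close>

lemma Lambert_W_props:
  assumes y: "y \<ge> 0"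
  shows "Lambert_W y \<ge> 0" "Lambert_W y * exp (Lambert_W y) = y"
proof -
  define f where "f = (\<lambda>x::real. x * exp x)"
  have mono: "f a < f b" if "0 \<le> a" "a < b" for a b
    unfolding f_def using that by (intro mult_strict_mono') auto
  have inj: "inj_on f {0..}"
  proof (rule inj_onI)
    fix a b assume "a \<in> {0..}" "b \<in> {0..}" "f a = f b"
    then show "a = b" using mono[of a b] mono[of b a] by (cases a b rule: linorder_cases) auto
  qed
  have "f 0 \<le> y" using y by (simp add: f_def)
  moreover have "y \<le> f y" unfolding f_def using y mult_left_mono[of 1 "exp y" y] by simp
  ultimately have "\<exists>x\<ge>0. x \<le> y \<and> f x = y"
    by (intro IVT') (use y in \<open>auto simp: f_def intro!: continuous_intros\<close>)
  then have yi: "y \<in> f ` {0..}" by force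
  have W: "Lambert_W y = the_inv_into {0..} f y" by (simp add: Lambert_W_def f_def)
  show "Lambert_W y \<ge> 0" using the_inv_into_into[OF inj yi, of "{0..}"] by (simp add: W)
  show "Lambert_W y * exp (Lambert_W y) = y" using f_the_inv_into_f[OF inj yi] by (simp add: W f_def)
qed

section \<open>The saddle point as a function of n\<close>

context
  fixes w :: "nat \<Rightarrow> real"
  defines "w \<equiv> \<lambda>n. Lambert_W (2 * real n / pi)"
begin

lemma w_nonneg: "w n \<ge> 0" and w_eq: "2 * real n = pi * w n * exp (w n)"
  using Lambert_W_props[of "2 * real n / pi"] by (auto simp: w_def field_simps)

lemma w_pos: "n \<ge> 1 \<Longrightarrow> w n > 0"
  using w_nonneg[of n] w_eq[of n] by (cases "w n = 0") auto

lemma w_at_top: "filterlim w at_top sequentially"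
  unfolding filterlim_at_top
proof
  fix Z :: real
  define c where "c = max 0 Z"
  have "eventually (\<lambda>n. real n > pi * c * exp c) sequentially" by real_asymp
  then show "eventually (\<lambda>n. Z \<le> w n) sequentially"
  proof eventually_elim
    case (elim n)
    have "\<not> w n < c"
    proof
      assume "w n < c"
      then have "pi * w n * exp (w n) \<le> pi * c * exp c" using w_nonneg[of n] by (intro mult_mono) auto
      then show False using elim w_eq[of n] by linarith
    qed
    then show ?case by (simp add: c_def)
  qed
qed

lemma w_ge: "eventually (\<lambda>n. w n \<ge> W) sequentially"
  using w_at_top unfolding filterlim_at_top by blast

lemma w_le_ln: "eventually (\<lambda>n. w n \<le> ln (real n)) sequentially"
  using w_ge[of 1] eventually_gt_at_top[of 0]
proof eventually_elim
  case (elim n)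
  have "1 * exp (w n) \<le> w n * exp (w n)" using elim by (intro mult_right_mono) auto
  also have "\<dots> = 2 * real n / pi" using w_eq[of n] by (simp add: field_simps)
  also have "\<dots> \<le> real n"
  proof -
    have "2 * real n \<le> pi * real n" using pi_gt3 by (intro mult_right_mono) auto
    then show ?thesis by (simp add: field_simps)
  qed
  finally have "ln (exp (w n)) \<le> ln (real n)" using elim by (intro ln_mono) auto
  then show ?case by simp
qed

lemma w_over_n_le_1: "eventually (\<lambda>n. 0 < w n / real n \<and> w n / real n \<le> 1) sequentially"
  using w_le_ln w_ge[of 1] eventually_gt_at_top[of 0]
proof eventually_elim
  case (elim n)
  have "ln (real n) \<le> real n" using elim ln_bound[of "real n"] by simp
  then show ?case using elim by (auto simp: field_simps)
qed

lemma power_bounded_bigo: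
  assumes "power_bounded r f"
  shows "(\<lambda>n. f (w n)) \<in> O(\<lambda>n. w n ^ r)"
proof -
  obtain C where C: "\<forall>w\<ge>1. \<bar>f w\<bar> \<le> C * w ^ r" using assms unfolding power_bounded_def by blast
  have "eventually (\<lambda>n. norm (f (w n)) \<le> C * norm (w n ^ r)) sequentially"
    using w_ge[of 1] by eventually_elim (use C in auto)
  then show ?thesis by (rule bigoI)
qed

lemma w_power_bigo_ln: "(\<lambda>n. w n ^ k) \<in> O(\<lambda>n. ln (real n) ^ k)"
proof -
  have "eventually (\<lambda>n. norm (w n ^ k) \<le> 1 * norm (ln (real n) ^ k)) sequentially"
    using w_le_ln w_ge[of 1] by eventually_elim (auto intro!: power_mono)
  then show ?thesis by (rule bigoI)
qed

end

text \<open>The terms may depend on n through more than a power, as \<open>mu_coeff k (w n)\<close>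
  does. The error splits into \<open>(f - F) * g\<close>, \<open>F * (g - G)\<close> and the
  products of total order at least \<open>K\<close>, each of the size of the \<open>K\<close>-th
  power of \<open>\<epsilon>\<close>.\<close>

lemma asymptotic_product:
  fixes f g \<epsilon> :: "nat \<Rightarrow> real" and X Y :: "nat \<Rightarrow> nat \<Rightarrow> real"
  assumes \<epsilon>: "eventually (\<lambda>n. 0 < \<epsilon> n \<and> \<epsilon> n \<le> 1) sequentially"
    and X: "\<And>k. X k \<in> O(\<lambda>n. \<epsilon> n ^ k)" and Y: "\<And>k. Y k \<in> O(\<lambda>n. \<epsilon> n ^ k)"
    and f: "(\<lambda>n. f n - (\<Sum>k<K. X k n)) \<in> O(\<lambda>n. \<epsilon> n ^ K)"
    and g: "(\<lambda>n. g n - (\<Sum>k<K. Y k n)) \<in> O(\<lambda>n. \<epsilon> n ^ K)"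
  shows "(\<lambda>n. f n * g n - (\<Sum>k<K. \<Sum>j=0..k. X j n * Y (k - j) n)) \<in> O(\<lambda>n. \<epsilon> n ^ K)"
proof -
  have pow: "(\<lambda>n. \<epsilon> n ^ a) \<in> O(\<lambda>n. \<epsilon> n ^ b)" if "b \<le> a" for a b
  proof -
    have "eventually (\<lambda>n. norm (\<epsilon> n ^ a) \<le> 1 * norm (\<epsilon> n ^ b)) sequentially"
      using \<epsilon> by eventually_elim (use that in \<open>auto intro!: power_decreasing\<close>)
    then show ?thesis by (rule bigoI)
  qed
  have one: "(\<lambda>n. \<epsilon> n ^ a) \<in> O(\<lambda>_. 1)" for a using pow[of 0 a] by simp
  define F where "F = (\<lambda>n. \<Sum>k<K. X k n)"
  define G where "G = (\<lambda>n. \<Sum>k<K. Y k n)"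
  have gG: "(\<lambda>n. g n - G n) \<in> O(\<lambda>n. \<epsilon> n ^ K)" using g by (simp add: G_def)
  have F1: "F \<in> O(\<lambda>_. 1)" unfolding F_def by (intro big_sum_in_bigo landau_o.big_trans[OF X one])
  have G1: "G \<in> O(\<lambda>_. 1)" unfolding G_def by (intro big_sum_in_bigo landau_o.big_trans[OF Y one])
  have "(\<lambda>n. (g n - G n) + G n) \<in> O(\<lambda>_. 1)"
    by (rule sum_in_bigo(1)[OF landau_o.big_trans[OF gG one] G1])
  then have g1: "g \<in> O(\<lambda>_. 1)" by simp
  have 1: "(\<lambda>n. (f n - F n) * g n) \<in> O(\<lambda>n. \<epsilon> n ^ K)"
    using landau_o.big.mult[OF f g1] by (simp add: F_def)
  have 2: "(\<lambda>n. F n * (g n - G n)) \<in> O(\<lambda>n. \<epsilon> n ^ K)"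
    using landau_o.big.mult[OF F1 g] by (simp add: G_def)
  have 3: "(\<lambda>n. \<Sum>p\<in>{p\<in>{..<K} \<times> {..<K}. K \<le> fst p + snd p}. X (fst p) n * Y (snd p) n) \<in> O(\<lambda>n. \<epsilon> n ^ K)"
  proof (rule big_sum_in_bigo)
    fix p assume p: "p \<in> {p\<in>{..<K} \<times> {..<K}. K \<le> fst p + snd p}"
    have "(\<lambda>n. X (fst p) n * Y (snd p) n) \<in> O(\<lambda>n. \<epsilon> n ^ fst p * \<epsilon> n ^ snd p)" by (intro landau_o.big.mult X Y)
    also have "(\<lambda>n. \<epsilon> n ^ fst p * \<epsilon> n ^ snd p) \<in> O(\<lambda>n. \<epsilon> n ^ K)"
      unfolding power_add[symmetric] by (rule pow) (use p in auto)
    finally show "(\<lambda>n. X (fst p) n * Y (snd p) n) \<in> O(\<lambda>n. \<epsilon> n ^ K)" .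
  qed
  have FG: "F n * G n - (\<Sum>k<K. \<Sum>j=0..k. X j n * Y (k - j) n) =
     (\<Sum>p\<in>{p\<in>{..<K} \<times> {..<K}. K \<le> fst p + snd p}. X (fst p) n * Y (snd p) n)" for n
  proof -
    have "(\<Sum>k<K. \<Sum>j=0..k. X j n * Y (k - j) n) = (\<Sum>p\<in>{p\<in>{..<K} \<times> {..<K}. fst p + snd p < K}. X (fst p) n * Y (snd p) n)"
      unfolding sum.Sigma[OF finite_lessThan ballI[OF finite_atLeastAtMost]]
      by (rule sum.reindex_bij_witness[of _ "\<lambda>p. (fst p + snd p, fst p)" "\<lambda>q. (snd q, fst q - snd q)"]) auto
    note conv = this
    have "F n * G n = (\<Sum>p\<in>{..<K} \<times> {..<K}. X (fst p) n * Y (snd p) n)"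
      unfolding F_def G_def sum_product sum.cartesian_product by (simp add: case_prod_beta)
    also have "\<dots> = (\<Sum>p\<in>{p\<in>{..<K} \<times> {..<K}. fst p + snd p < K}. X (fst p) n * Y (snd p) n) + (\<Sum>p\<in>{p\<in>{..<K} \<times> {..<K}. K \<le> fst p + snd p}. X (fst p) n * Y (snd p) n)"
      by (subst sum.union_disjoint[symmetric]) (auto intro!: sum.cong)
    finally show ?thesis unfolding conv by simp
  qed
  have "(\<lambda>n. (f n - F n) * g n + F n * (g n - G n) + (F n * G n - (\<Sum>k<K. \<Sum>j=0..k. X j n * Y (k - j) n))) \<in> O(\<lambda>n. \<epsilon> n ^ K)"
    unfolding FG by (intro sum_in_bigo 1 2 3)
  moreover have "(f n - F n) * g n + F n * (g n - G n) + (F n * G n - S) = f n * g n - S" for n S by (simp add: algebra_simps)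
  ultimately show ?thesis by (simp only:)
qed

text \<open>The reciprocal series taken at \<open>2 * n\<close> has the coefficients
  \<open>(-1) ^ j * stirling_kappa j / 2 ^ j\<close>, which is the origin of the powers of -2 in
  \<open>kappa_star\<close>.\<close>

lemma stirling_quotient_expansion:
  "(\<lambda>n. stirling_ratio n / stirling_ratio (2 * n) - (\<Sum>k<K. kappa_star k / real n ^ k)) \<in> O(\<lambda>n. 1 / real n ^ K)"
proof -
  define X where "X = (\<lambda>j n. (-1) ^ j * stirling_kappa j / real (2 * n) ^ j)"
  define Y where "Y = (\<lambda>j n. stirling_kappa j / real n ^ j)"
  have sm: "filterlim (\<lambda>n::nat. 2 * n) at_top sequentially" by (intro filterlim_subseq) (simp add: strict_mono_def)
  have "(\<lambda>n. 1 / stirling_ratio (2 * n) * stirling_ratio n - (\<Sum>k<K. \<Sum>j=0..k. X j n * Y (k - j) n)) \<in> O(\<lambda>n. (1 / real n) ^ K)"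
  proof (rule asymptotic_product)
    show "eventually (\<lambda>n. 0 < 1 / real n \<and> 1 / real n \<le> 1) sequentially"
      using eventually_gt_at_top[of 0] by eventually_elim auto
    show "X k \<in> O(\<lambda>n. (1 / real n) ^ k)" for k
    proof (rule bigoI)
      show "eventually (\<lambda>n. norm (X k n) \<le> (\<bar>stirling_kappa k\<bar> / 2 ^ k) * norm ((1 / real n) ^ k)) sequentially"
        by (intro always_eventually allI) (simp add: X_def abs_mult power_abs power_mult_distrib power_divide)
    qed
    show "Y k \<in> O(\<lambda>n. (1 / real n) ^ k)" for k
    proof (rule bigoI)
      show "eventually (\<lambda>n. norm (Y k n) \<le> \<bar>stirling_kappa k\<bar> * norm ((1 / real n) ^ k)) sequentially"
        by (intro always_eventually allI) (simp add: Y_def abs_mult power_abs power_divide)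
    qed
    have "(\<lambda>n. 1 / stirling_ratio (2 * n) - (\<Sum>m<K. (-1) ^ m * stirling_kappa m / real (2 * n) ^ m)) \<in> O(\<lambda>n. 1 / real (2 * n) ^ K)"
      by (rule landau_o.big.compose[OF inverse_stirling_kappa_bigo[of K] sm])
    also have "(\<lambda>n. 1 / real (2 * n) ^ K) \<in> O(\<lambda>n. (1 / real n) ^ K)"
    proof (rule bigoI)
      show "eventually (\<lambda>n. norm (1 / real (2 * n) ^ K) \<le> (1 / 2 ^ K) * norm ((1 / real n) ^ K)) sequentially"
        by (intro always_eventually allI) (simp add: power_mult_distrib power_divide)
    qed
    finally show "(\<lambda>n. 1 / stirling_ratio (2 * n) - (\<Sum>k<K. X k n)) \<in> O(\<lambda>n. (1 / real n) ^ K)"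
      unfolding X_def .
    show "(\<lambda>n. stirling_ratio n - (\<Sum>k<K. Y k n)) \<in> O(\<lambda>n. (1 / real n) ^ K)"
      using stirling_kappa_bigo[of K] unfolding Y_def by (simp add: power_divide)
  qed
  moreover have "(\<Sum>j=0..k. X j n * Y (k - j) n) = kappa_star k / real n ^ k" for k n
    unfolding kappa_star_def sum_divide_distrib
  proof (intro sum.cong refl)
    fix j assume "j \<in> {0..k}"
    then have "real n ^ k = real n ^ j * real n ^ (k - j)" by (simp flip: power_add)
    moreover have "(-1) ^ j * A / real (2 * n) ^ j * (B / real n ^ (k - j)) = A * B / (-2) ^ j / (real n ^ j * real n ^ (k - j))" for A B :: real
    proof -
      have "(-2) ^ j = (-1) ^ j * (2::real) ^ j" by (simp flip: power_mult_distrib)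
      then show ?thesis by (cases "even j") (simp_all add: power_mult_distrib)
    qed
    ultimately show "X j n * Y (k - j) n = stirling_kappa j * stirling_kappa (k - j) / (- 2) ^ j / real n ^ k"
      unfolding X_def Y_def by simp
  qed
  ultimately show ?thesis by (simp add: power_divide)
qed


text \<open>For m \<ge> 2 and x \<ge> 1 the inequality (m^2 - 4) (x - 1) \<ge> 0 separates the
  variables: exp (- pi m^2 x) is at most exp (- 4 pi x) times exp (4 pi - pi m^2). What remains is a
  convergent series independent of \<open>x\<close>.\<close>

lemma xi_kernel_tail:
  obtains D where "D \<ge> 0" "\<And>x. x \<ge> 1 \<Longrightarrow> 0 \<le> xi_kernel x - (2 * pi\<^sup>2 * x\<^sup>2 - 3 * pi * x) * exp (- pi * x)"
    "\<And>x. x \<ge> 1 \<Longrightarrow> xi_kernel x - (2 * pi\<^sup>2 * x\<^sup>2 - 3 * pi * x) * exp (- pi * x) \<le> D * (x\<^sup>2 * exp (- 4 * pi * x))"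
proof -
  define b where "b = (\<lambda>k. 2 * pi\<^sup>2 * exp (4 * pi) * (real (Suc (k + 1)) ^ 4 * exp (- pi * (real (Suc (k + 1)))\<^sup>2 * 1)))"
  have bs: "summable b"
    unfolding b_def by (intro summable_mult summable_ignore_initial_segment[OF theta_moment_summable]) auto
  define D where "D = suminf b"
  have D0: "D \<ge> 0" unfolding D_def by (intro suminf_nonneg bs) (simp add: b_def)
  define T where "T = (\<lambda>x k. (2 * pi\<^sup>2 * real (Suc k) ^ 4 * x\<^sup>2 - 3 * pi * real (Suc k) ^ 2 * x) * exp (- pi * (real (Suc k))\<^sup>2 * x))"
  have S: "(\<lambda>k. T x (k + 1)) sums (xi_kernel x - (2 * pi\<^sup>2 * x\<^sup>2 - 3 * pi * x) * exp (- pi * x))" if "x \<ge> 1" for x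
  proof -
    have "(\<lambda>k. T x k) sums xi_kernel x" unfolding T_def by (rule xi_kernel_sums) (use that in simp)
    from sums_split_initial_segment[OF this, of 1] show ?thesis by (simp add: T_def)
  qed
  have T0: "T x k \<ge> 0" if "x \<ge> 1" for x k unfolding T_def by (rule xi_kernel_term_nonneg[OF that])
  have Tb: "T x (k + 1) \<le> (x\<^sup>2 * exp (- 4 * pi * x)) * b k" if x: "x \<ge> 1" for x k
  proof -
    define m where "m = real (Suc (k + 1))"
    have m: "m \<ge> 2" by (simp add: m_def)
    have "m\<^sup>2 \<ge> 2\<^sup>2" using m by (intro power_mono) auto
    then have "0 \<le> pi * ((m\<^sup>2 - 4) * (x - 1))" using x by (intro mult_nonneg_nonneg) auto
    then have e: "- pi * m\<^sup>2 * x \<le> - 4 * pi * x + (4 * pi + - pi * m\<^sup>2 * 1)" by (simp add: algebra_simps)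
    have "T x (k + 1) \<le> 2 * pi\<^sup>2 * m ^ 4 * x\<^sup>2 * exp (- pi * m\<^sup>2 * x)"
      unfolding T_def m_def[symmetric] using x m by (intro mult_right_mono) auto
    also have "\<dots> \<le> 2 * pi\<^sup>2 * m ^ 4 * x\<^sup>2 * exp (- 4 * pi * x + (4 * pi + - pi * m\<^sup>2 * 1))"
      using e m by (intro mult_left_mono) auto
    also have "\<dots> = (x\<^sup>2 * exp (- 4 * pi * x)) * b k"
      unfolding b_def m_def[symmetric] exp_add by (simp only: mult_ac)
    finally show ?thesis .
  qed
  show ?thesis
  proof (rule that[OF D0])
    fix x :: real assume x: "x \<ge> 1"
    show "0 \<le> xi_kernel x - (2 * pi\<^sup>2 * x\<^sup>2 - 3 * pi * x) * exp (- pi * x)"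
      by (rule sums_le[OF _ sums_zero S[OF x]]) (rule T0[OF x])
    have "(\<lambda>k. (x\<^sup>2 * exp (- 4 * pi * x)) * b k) sums ((x\<^sup>2 * exp (- 4 * pi * x)) * D)"
      unfolding D_def by (intro sums_mult summable_sums bs)
    from sums_le[OF Tb[OF x] S[OF x] this]
    show "xi_kernel x - (2 * pi\<^sup>2 * x\<^sup>2 - 3 * pi * x) * exp (- pi * x) \<le> D * (x\<^sup>2 * exp (- 4 * pi * x))"
      by (simp add: mult.commute)
  qed
qed

text \<open>In the variable \<open>s = x / exp w\<close> the exponent is T (ln s - 3 s), and ln (3
  s) \<le> 3 s - 1 with ln 3 \<ge> 1 bounds it by - 2 T. The leading term has the exponent - T at
  its peak, so the terms beyond the first lose a full factor \<open>exp (- T)\<close>.\<close>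

lemma log_power_exp_bound:
  assumes w: "w > 0" and n: "2 * real n = pi * w * exp w" and x: "x \<ge> 1"
  shows "ln x ^ (2 * n) * exp (- 3 * pi * x) \<le> w ^ (2 * n) * exp (- (2 * real n / w)) * exp (- (2 * real n / w))"
proof -
  define T where "T = 2 * real n / w"
  have T: "T = pi * exp w" using w n by (simp add: T_def)
  have T0: "T > 0" by (simp add: T)
  define s where "s = x / exp w"
  have s: "s > 0" "x = exp w * s" using x by (simp_all add: s_def)
  have l: "ln x = w * (1 + ln s / w)" using s w by (simp add: ln_mult distrib_left)
  have "0 \<le> w * (1 + ln s / w)" using l ln_ge_zero[OF x] by simp
  then have l0: "0 \<le> 1 + ln s / w" using w by (simp add: zero_le_mult_iff)
  have "(1 + ln s / w) ^ (2 * n) \<le> exp (ln s / w) ^ (2 * n)"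
    using l0 by (intro power_mono) (auto intro: exp_ge_add_one_self)
  also have "\<dots> = exp (T * ln s)" by (simp add: T_def flip: exp_of_nat_mult)
  finally have 1: "ln x ^ (2 * n) \<le> w ^ (2 * n) * exp (T * ln s)"
    unfolding l power_mult_distrib using w by (intro mult_left_mono) auto
  have "ln (3 * s) \<le> 3 * s - 1" using s by (intro ln_le_minus_one) auto
  moreover have "ln (3 * s) = ln 3 + ln s" using s by (simp add: ln_mult)
  moreover have "ln (3::real) \<ge> 1" using ln_mono[OF exp_le] by simp
  ultimately have "ln s - 3 * s \<le> - 2" by linarith
  then have "T * (ln s - 3 * s) \<le> T * (- 2)" using T0 by (intro mult_left_mono) auto
  then have "exp (T * ln s + - 3 * pi * x) \<le> exp (- T + - T)" by (simp add: T s(2) algebra_simps)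
  then have 2: "exp (T * ln s) * exp (- 3 * pi * x) \<le> exp (- T) * exp (- T)" unfolding exp_add .
  have "ln x ^ (2 * n) * exp (- 3 * pi * x) \<le> w ^ (2 * n) * exp (T * ln s) * exp (- 3 * pi * x)"
    using 1 by (intro mult_right_mono) auto
  also have "\<dots> \<le> w ^ (2 * n) * (exp (- T) * exp (- T))"
    using mult_left_mono[OF 2, of "w ^ (2 * n)"] w by (simp add: mult.assoc)
  finally show ?thesis by (simp add: T_def mult.assoc)
qed

lemma log_moment_integrand_0_integrable: "integrable lborel (log_moment_integrand (5/4) 0)"
proof -
  have "integrable lborel (\<lambda>x. indicator {1..} x *\<^sub>R (indicator {0<..} x * (x powr (9/4 - 1) * exp (- pi * x))))"
    using Gamma_scaled_integral[of "9/4" pi] by (intro integrable_mult_indicator) (auto simp: has_bochner_integral_iff)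
  moreover have "indicator {1..} x *\<^sub>R (indicator {0<..} x * (x powr (9/4 - 1) * exp (- pi * x))) = log_moment_integrand (5/4) 0 x" for x
    by (auto simp: log_moment_integrand_def indicator_def)
  ultimately show ?thesis by (simp only:)
qed

lemma xi_moment_split:
  obtains D where "D \<ge> 0" "\<And>w n. w > 0 \<Longrightarrow> 2 * real n = pi * w * exp w \<Longrightarrow>
      integrable lborel (log_moment_integrand (5/4) n) \<Longrightarrow> integrable lborel (log_moment_integrand (1/4) n) \<Longrightarrow>
      \<bar>xi_moment (2 * n) - (2 * pi\<^sup>2 * integral\<^sup>L lborel (log_moment_integrand (5/4) n) - 3 * pi * integral\<^sup>L lborel (log_moment_integrand (1/4) n))\<bar>
      \<le> D * (w ^ (2 * n) * exp (- (2 * real n / w)) * exp (- (2 * real n / w)))"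
proof -
  obtain D where D: "D \<ge> 0" "\<And>x. x \<ge> 1 \<Longrightarrow> 0 \<le> xi_kernel x - (2 * pi\<^sup>2 * x\<^sup>2 - 3 * pi * x) * exp (- pi * x)"
    "\<And>x. x \<ge> 1 \<Longrightarrow> xi_kernel x - (2 * pi\<^sup>2 * x\<^sup>2 - 3 * pi * x) * exp (- pi * x) \<le> D * (x\<^sup>2 * exp (- 4 * pi * x))"
    by (rule xi_kernel_tail) blast
  define J where "J = integral\<^sup>L lborel (log_moment_integrand (5/4) 0)"
  have J0: "J \<ge> 0" unfolding J_def by (intro Bochner_Integration.integral_nonneg) (simp add: log_moment_integrand_def)
  show ?thesis
  proof (rule that[of "D * J"])
    show "D * J \<ge> 0" using D(1) J0 by simp
    fix w :: real and n :: nat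
    assume w: "w > 0" and n: "2 * real n = pi * w * exp w"
      and i5: "integrable lborel (log_moment_integrand (5/4) n)" and i1: "integrable lborel (log_moment_integrand (1/4) n)"
    define B where "B = w ^ (2 * n) * exp (- (2 * real n / w)) * exp (- (2 * real n / w))"
    have iM: "integrable lborel (xi_moment_integrand (2 * n))" using xi_fps_sums(1)[of 2 "2 * n"] by simp
    define d where "d = (\<lambda>x. xi_moment_integrand (2 * n) x - (2 * pi\<^sup>2 * log_moment_integrand (5/4) n x - 3 * pi * log_moment_integrand (1/4) n x))"
    have dx: "d x = indicator {1..} x * (x powr (- 3 / 4) * ln x ^ (2 * n) * (xi_kernel x - (2 * pi\<^sup>2 * x\<^sup>2 - 3 * pi * x) * exp (- pi * x)))" for x
    proof (cases "x \<ge> 1")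
      case True
      have "x powr (5/4) = x powr (- 3 / 4 + 2)" by simp
      also have "\<dots> = x powr (- 3 / 4) * x\<^sup>2" unfolding powr_add using True by simp
      finally have p5: "x powr (5/4) = x powr (- 3 / 4) * x\<^sup>2" .
      have "x powr (1/4) = x powr (- 3 / 4 + 1)" by simp
      also have "\<dots> = x powr (- 3 / 4) * x" unfolding powr_add using True by simp
      finally have p1: "x powr (1/4) = x powr (- 3 / 4) * x" .
      show ?thesis using True unfolding d_def xi_moment_integrand_def log_moment_integrand_def p5 p1
        by (simp add: algebra_simps)
    qed (simp add: d_def xi_moment_integrand_def log_moment_integrand_def)
    have db: "\<bar>d x\<bar> \<le> D * B * log_moment_integrand (5/4) 0 x" for x
    proof (cases "x \<ge> 1")
      case True
      have l0: "ln x ^ (2 * n) \<ge> 0" using True by simp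
      have "d x \<ge> 0" unfolding dx using D(2)[OF True] True by simp
      then have "\<bar>d x\<bar> = d x" by simp
      also have "d x = x powr (- 3 / 4) * ln x ^ (2 * n) * (xi_kernel x - (2 * pi\<^sup>2 * x\<^sup>2 - 3 * pi * x) * exp (- pi * x))"
        unfolding dx using True by simp
      also have "\<dots> \<le> x powr (- 3 / 4) * ln x ^ (2 * n) * (D * (x\<^sup>2 * exp (- 4 * pi * x)))"
        using D(3)[OF True] True by (intro mult_left_mono) auto
      \<comment> \<open>Of the decay \<open>exp (- 4 * pi * x)\<close>, three quarters tame the
        power of the logarithm and one quarter keeps integrability, in the form of the moment of
        order 0.\<close>
      also have "\<dots> = D * (x powr (- 3 / 4) * x\<^sup>2 * exp (- pi * x)) * (ln x ^ (2 * n) * exp (- 3 * pi * x))"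
      proof -
        have "exp (- 4 * pi * x) = exp (- pi * x) * exp (- 3 * pi * x)" by (simp flip: exp_add)
        then show ?thesis by (simp only: mult_ac)
      qed
      also have "\<dots> \<le> D * (x powr (- 3 / 4) * x\<^sup>2 * exp (- pi * x)) * B"
        unfolding B_def using log_power_exp_bound[OF w n True] D(1) True by (intro mult_left_mono) auto
      also have "x powr (- 3 / 4) * x\<^sup>2 = x powr (5/4)"
      proof -
        have "x powr (5/4) = x powr (- 3 / 4 + 2)" by simp
        also have "\<dots> = x powr (- 3 / 4) * x\<^sup>2" unfolding powr_add using True by simp
        finally show ?thesis ..
      qed
      finally show ?thesis using True by (simp add: log_moment_integrand_def mult_ac)
    qed (simp add: dx log_moment_integrand_def)
    have "\<bar>xi_moment (2 * n) - (2 * pi\<^sup>2 * integral\<^sup>L lborel (log_moment_integrand (5/4) n) - 3 * pi * integral\<^sup>L lborel (log_moment_integrand (1/4) n))\<bar> = \<bar>integral\<^sup>L lborel d\<bar>"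
      unfolding xi_moment_def d_def using iM i5 i1 by simp
    also have "\<dots> \<le> (\<integral>x. \<bar>d x\<bar> \<partial>lborel)" using integral_norm_bound[of lborel d] by simp
    also have "\<dots> \<le> (\<integral>x. D * B * log_moment_integrand (5/4) 0 x \<partial>lborel)"
    proof (rule integral_mono)
      have "integrable lborel d" unfolding d_def using iM i5 i1 by simp
      then show "integrable lborel (\<lambda>x. \<bar>d x\<bar>)" by simp
      show "integrable lborel (\<lambda>x. D * B * log_moment_integrand (5/4) 0 x)"
        using log_moment_integrand_0_integrable by simp
    qed (rule db)
    also have "\<dots> = D * J * B" by (simp add: J_def)
    finally show "\<bar>xi_moment (2 * n) - (2 * pi\<^sup>2 * integral\<^sup>L lborel (log_moment_integrand (5/4) n) - 3 * pi * integral\<^sup>L lborel (log_moment_integrand (1/4) n))\<bar>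
      \<le> D * J * (w ^ (2 * n) * exp (- (2 * real n / w)) * exp (- (2 * real n / w)))" unfolding B_def .
  qed
qed


text \<open>The second sum stops one term earlier because its factor \<open>w / n\<close> raises the
  order by one.\<close>

lemma mu_coeff_partial_sum:
  assumes n: "n \<ge> 1"
  shows "(\<Sum>r<Suc K. a_coeff (5/4) r w / (2 * real n) ^ r) - 3 * w / (4 * real n) * (\<Sum>r<K. a_coeff (1/4) r w / (2 * real n) ^ r)
    = (\<Sum>k<Suc K. mu_coeff k w / real n ^ k)"
proof -
  define g where "g = (\<lambda>r. 3 * w * (if r = 0 then 0 else a_coeff (1/4) (r - 1) w) / (2 ^ (r + 1) * real n ^ r))"
  have "mu_coeff k w / real n ^ k = a_coeff (5/4) k w / (2 * real n) ^ k - g k" for k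
    unfolding mu_coeff_def g_def by (simp add: diff_divide_distrib power_mult_distrib)
  then have "(\<Sum>k<Suc K. mu_coeff k w / real n ^ k) = (\<Sum>r<Suc K. a_coeff (5/4) r w / (2 * real n) ^ r) - (\<Sum>k<Suc K. g k)"
    by (simp only: sum_subtractf)
  also have "(\<Sum>k<Suc K. g k) = (\<Sum>k<K. g (Suc k))"
    by (subst sum.lessThan_Suc_shift) (simp add: g_def)
  also have "\<dots> = 3 * w / (4 * real n) * (\<Sum>r<K. a_coeff (1/4) r w / (2 * real n) ^ r)"
    unfolding sum_distrib_left by (intro sum.cong refl) (simp add: g_def power_mult_distrib)
  finally show ?thesis by simp
qed

text \<open>The prefactors differ only by \<open>exp (- w)\<close>, which the saddle point equation
  converts. Together with the ratio 3 pi / (2 pi^2) of the leading constants this gives the factor 3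
  w / (4 n) in the combined expansion.\<close>

lemma laplace_prefactor_ratio:
  assumes "w > 0" "2 * real n = pi * w * exp w"
  shows "laplace_prefactor (1/4) n w = laplace_prefactor (5/4) n w * (pi * w / (2 * real n))"
proof -
  have "exp ((1/4 + 1) * w) = exp ((5/4 + 1) * w + - w)" by (simp add: field_simps)
  also have "\<dots> = exp ((5/4 + 1) * w) * exp (- w)" by (rule exp_add)
  also have "exp (- w) = pi * w / (2 * real n)" unfolding assms(2) using assms(1) by (simp add: exp_minus inverse_eq_divide)
  finally show ?thesis unfolding laplace_prefactor_def by (simp only: mult_ac)
qed

text \<open>With \<open>Suc K\<close> terms on the left, the moment with exponent 1/4 is needed to
  \<open>K\<close> terms. The part of the kernel beyond its first term is negligible even after
  division by the prefactor.\<close>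

lemma xi_moment_expansion:
  fixes K :: nat
  defines "w \<equiv> \<lambda>n::nat. Lambert_W (2 * real n / pi)"
  shows "(\<lambda>n. xi_moment (2 * n) / (2 * pi\<^sup>2 * (laplace_prefactor (5/4) n (w n) * sqrt (2 * pi)))
     - (\<Sum>k<Suc K. mu_coeff k (w n) / real n ^ k)) \<in> O(\<lambda>n. (w n / real n) ^ Suc K)"
proof -
  obtain C5 W5 where W5: "\<And>w n. w \<ge> W5 \<Longrightarrow> 2 * real n = pi * w * exp w \<Longrightarrow>
     integrable lborel (log_moment_integrand (5/4) n) \<and>
     \<bar>integral\<^sup>L lborel (log_moment_integrand (5/4) n) / (laplace_prefactor (5/4) n w * sqrt (2 * pi))
       - (\<Sum>r<Suc K. a_coeff (5/4) r w / (2 * real n) ^ r)\<bar> \<le> C5 * (w / real n) ^ Suc K"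
  proof -
    have "(5/4::real) \<ge> 0" by simp
    from log_moment_asymptotics[OF this, of "Suc K"] show thesis using that by blast
  qed
  obtain C1 W1 where W1: "\<And>w n. w \<ge> W1 \<Longrightarrow> 2 * real n = pi * w * exp w \<Longrightarrow>
     integrable lborel (log_moment_integrand (1/4) n) \<and>
     \<bar>integral\<^sup>L lborel (log_moment_integrand (1/4) n) / (laplace_prefactor (1/4) n w * sqrt (2 * pi))
       - (\<Sum>r<K. a_coeff (1/4) r w / (2 * real n) ^ r)\<bar> \<le> C1 * (w / real n) ^ K"
  proof -
    have "(1/4::real) \<ge> 0" by simp
    from log_moment_asymptotics[OF this, of K] show thesis using that by blast
  qed
  obtain D where D: "D \<ge> 0" "\<And>w n. w > 0 \<Longrightarrow> 2 * real n = pi * w * exp w \<Longrightarrow>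
      integrable lborel (log_moment_integrand (5/4) n) \<Longrightarrow> integrable lborel (log_moment_integrand (1/4) n) \<Longrightarrow>
      \<bar>xi_moment (2 * n) - (2 * pi\<^sup>2 * integral\<^sup>L lborel (log_moment_integrand (5/4) n) - 3 * pi * integral\<^sup>L lborel (log_moment_integrand (1/4) n))\<bar>
      \<le> D * (w ^ (2 * n) * exp (- (2 * real n / w)) * exp (- (2 * real n / w)))"
    by (rule xi_moment_split) blast
  have "eventually (\<lambda>x::real. x ^ (Suc K + 1) / exp x < 1) at_top"
    using tendsto_power_div_exp_0[of "Suc K + 1"] by (rule order_tendstoD) simp
  then obtain X :: real where X: "\<And>x. x \<ge> X \<Longrightarrow> x ^ (Suc K + 1) / exp x < 1" unfolding eventually_at_top_linorder by blast
  have wge: "eventually (\<lambda>n. c \<le> w n) sequentially" for c unfolding w_def by (rule w_ge)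
  have "eventually (\<lambda>n. norm (xi_moment (2 * n) / (2 * pi\<^sup>2 * (laplace_prefactor (5/4) n (w n) * sqrt (2 * pi)))
     - (\<Sum>k<Suc K. mu_coeff k (w n) / real n ^ k)) \<le> (C5 + C1 + 2 * D) * norm ((w n / real n) ^ Suc K)) sequentially"
    using wge[of W5] wge[of W1] wge[of 1] wge[of X] eventually_gt_at_top[of 0]
  proof eventually_elim
    case (elim n)
    define v where "v = w n"
    have v: "v \<ge> W5" "v \<ge> W1" "v \<ge> 1" "v \<ge> X" using elim by (auto simp: v_def)
    have n: "n \<ge> 1" "real n > 0" using elim by auto
    have vn: "2 * real n = pi * v * exp v" unfolding v_def w_def by (rule w_eq)
    define T where "T = 2 * real n / v"
    have T: "T = pi * exp v" using v vn by (simp add: T_def)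
    have "v \<le> 1 * exp v" using exp_ge_add_one_self[of v] by linarith
    also have "\<dots> \<le> pi * exp v" using pi_gt3 by (intro mult_right_mono) auto
    finally have Tv: "T \<ge> v" by (simp add: T)
    have T1: "T \<ge> 1" "T \<ge> X" using Tv v by auto
    define Q where "Q = laplace_prefactor (5/4) n v * sqrt (2 * pi)"
    define I5 where "I5 = integral\<^sup>L lborel (log_moment_integrand (5/4) n)"
    define I1 where "I1 = integral\<^sup>L lborel (log_moment_integrand (1/4) n)"
    define S5 where "S5 = (\<Sum>r<Suc K. a_coeff (5/4) r v / (2 * real n) ^ r)"
    define S1 where "S1 = (\<Sum>r<K. a_coeff (1/4) r v / (2 * real n) ^ r)"
    define \<sigma> where "\<sigma> = sqrt (v\<^sup>2 / (2 * real n * (v + 1)))"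
    have \<sigma>0: "\<sigma> > 0" unfolding \<sigma>_def using v n by simp
    \<comment> \<open>A crude lower bound suffices: the dropped factors exp (9 v / 4) and sqrt (2
      pi) are at least 1, and the surplus factor \<open>exp (- T)\<close> in the bound for
      \<open>\<delta>\<close> beats \<open>1 / \<sigma>\<close>.\<close>
    have Qlow: "v ^ (2 * n) * exp (- T) * \<sigma> \<le> Q"
    proof -
      have "1 * (v ^ (2 * n) * exp (- T) * \<sigma>) * 1 \<le> exp ((5/4 + 1) * v) * (v ^ (2 * n) * exp (- T) * \<sigma>) * sqrt (2 * pi)"
        using v \<sigma>0 pi_gt3 by (intro mult_mono) auto
      then show ?thesis unfolding Q_def laplace_prefactor_def \<sigma>_def T_def by (simp only: mult_ac mult_1_left)
    qed
    have Q0: "Q > 0" by (rule less_le_trans[OF _ Qlow]) (use v \<sigma>0 in auto)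
    have i5: "integrable lborel (log_moment_integrand (5/4) n)" and e5: "\<bar>I5 / Q - S5\<bar> \<le> C5 * (v / real n) ^ Suc K"
      using W5[OF v(1) vn] by (auto simp: I5_def Q_def S5_def)
    have Q1: "laplace_prefactor (1/4) n v * sqrt (2 * pi) = Q * (pi * v / (2 * real n))"
      using laplace_prefactor_ratio[OF _ vn] v by (simp add: Q_def)
    have i1: "integrable lborel (log_moment_integrand (1/4) n)" and e1: "\<bar>I1 / (Q * (pi * v / (2 * real n))) - S1\<bar> \<le> C1 * (v / real n) ^ K"
      using W1[OF v(2) vn] unfolding Q1 by (auto simp: I1_def S1_def)
    define \<delta> where "\<delta> = xi_moment (2 * n) - (2 * pi\<^sup>2 * I5 - 3 * pi * I1)"
    have \<delta>: "\<bar>\<delta>\<bar> \<le> D * (v ^ (2 * n) * exp (- T) * exp (- T))"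
      using D(2)[OF _ vn i5 i1] v by (simp add: \<delta>_def I5_def I1_def T_def)
    have \<delta>Q: "\<bar>\<delta> / (2 * pi\<^sup>2 * Q)\<bar> \<le> 2 * D * (v / real n) ^ Suc K"
    proof -
      have "1 * Q \<le> 2 * pi\<^sup>2 * Q"
      proof (rule mult_right_mono)
        have "3\<^sup>2 \<le> pi\<^sup>2" using pi_gt3 by (intro power_mono) auto
        then show "1 \<le> 2 * pi\<^sup>2" by simp
      qed (use Q0 in simp)
      then have "v ^ (2 * n) * exp (- T) * \<sigma> \<le> 2 * pi\<^sup>2 * Q" using Qlow by linarith
      then have "\<bar>\<delta> / (2 * pi\<^sup>2 * Q)\<bar> \<le> D * (v ^ (2 * n) * exp (- T) * exp (- T)) / (v ^ (2 * n) * exp (- T) * \<sigma>)"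
        using \<delta> Q0 v \<sigma>0 D(1) unfolding abs_divide by (intro frac_le) auto
      also have "\<dots> = D * (exp (- T) * (1 / \<sigma>))" using v \<sigma>0 by simp
      also have "\<dots> \<le> D * (1 / T ^ (Suc K + 1) * (2 * T))"
      proof (intro mult_left_mono mult_mono D(1))
        have "T ^ (Suc K + 1) < exp T" using X[OF T1(2)] by (simp only: divide_less_eq_1_pos exp_gt_zero)
        then have "inverse (exp T) \<le> inverse (T ^ (Suc K + 1))" using T1(1) by (intro le_imp_inverse_le) auto
        then show "exp (- T) \<le> 1 / T ^ (Suc K + 1)" by (simp only: exp_minus inverse_eq_divide)
        have s2: "\<sigma>\<^sup>2 = v / (v + 1) / T" unfolding \<sigma>_def T_def using v n by (simp add: power2_eq_square)
        have "1 / 2 \<le> v / (v + 1)" using v by (simp add: field_simps)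
        then have "1 / 2 / T \<le> \<sigma>\<^sup>2" unfolding s2 using T1 by (intro divide_right_mono) auto
        then have "(1 / \<sigma>)\<^sup>2 \<le> 2 * T" using \<sigma>0 T1 by (simp add: power_divide field_simps)
        also have "\<dots> \<le> (2 * T)\<^sup>2" using T1 by (simp add: power2_eq_square)
        finally show "1 / \<sigma> \<le> 2 * T" by (rule power2_le_imp_le) (use T1 in auto)
      qed (use \<sigma>0 T1 in auto)
      also have "\<dots> = 2 * D * (1 / T) ^ Suc K" using T1 by (simp add: power_divide)
      also have "\<dots> \<le> 2 * D * (v / real n) ^ Suc K"
        unfolding T_def using v n D(1) by (intro mult_left_mono power_mono) (auto simp: field_simps)
      finally show ?thesis .
    qed
    have main: "xi_moment (2 * n) / (2 * pi\<^sup>2 * Q) - (\<Sum>k<Suc K. mu_coeff k v / real n ^ k) =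
      (I5 / Q - S5) - 3 * v / (4 * real n) * (I1 / (Q * (pi * v / (2 * real n))) - S1) + \<delta> / (2 * pi\<^sup>2 * Q)"
    proof -
      have "3 * v / (4 * real n) * (I1 / (Q * (pi * v / (2 * real n)))) = 3 * pi * I1 / (2 * pi\<^sup>2 * Q)"
        using v n Q0 by (simp add: power2_eq_square)
      moreover have "I5 / Q = 2 * pi\<^sup>2 * I5 / (2 * pi\<^sup>2 * Q)" by simp
      moreover have "xi_moment (2 * n) / (2 * pi\<^sup>2 * Q) = 2 * pi\<^sup>2 * I5 / (2 * pi\<^sup>2 * Q) - 3 * pi * I1 / (2 * pi\<^sup>2 * Q) + \<delta> / (2 * pi\<^sup>2 * Q)"
        unfolding diff_divide_distrib[symmetric] add_divide_distrib[symmetric] by (simp add: \<delta>_def)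
      ultimately show ?thesis
        unfolding mu_coeff_partial_sum[OF n(1), symmetric] S5_def[symmetric] S1_def[symmetric] right_diff_distrib by linarith
    qed
    have e1': "\<bar>3 * v / (4 * real n) * (I1 / (Q * (pi * v / (2 * real n))) - S1)\<bar> \<le> C1 * (v / real n) ^ Suc K"
    proof -
      have c0: "0 \<le> C1 * (v / real n) ^ K" using e1 by (rule order.trans[OF abs_ge_zero])
      have "\<bar>3 * v / (4 * real n) * (I1 / (Q * (pi * v / (2 * real n))) - S1)\<bar> \<le> (3 * v / (4 * real n)) * (C1 * (v / real n) ^ K)"
        unfolding abs_mult using e1 v n by (intro mult_mono) auto
      also have "\<dots> \<le> (v / real n) * (C1 * (v / real n) ^ K)"
        using v n c0 by (intro mult_right_mono) (auto simp: field_simps)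
      finally show ?thesis by (simp add: mult_ac)
    qed
    define u where "u = (v / real n) ^ Suc K"
    have u: "norm u = u" using v n by (simp add: u_def)
    have "\<bar>xi_moment (2 * n) / (2 * pi\<^sup>2 * Q) - (\<Sum>k<Suc K. mu_coeff k v / real n ^ k)\<bar> \<le> C5 * u + C1 * u + 2 * D * u"
      unfolding main u_def using e5 e1' \<delta>Q by linarith
    also have "\<dots> = (C5 + C1 + 2 * D) * norm u" unfolding u by (simp add: distrib_right)
    finally show ?case unfolding v_def[symmetric] Q_def[symmetric] u_def real_norm_def .
  qed
  then show ?thesis by (rule bigoI)
qed

text \<open>Stirling's formula leaves n-th powers, which collect into a single base, and square
  roots. In the latter, \<open>2 * n = pi * w * exp w\<close> trades n for exp (- w / 2), and 9/4 -
  1/2 = 7/4.\<close>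

lemma fact_ratio_prefactor:
  assumes w: "w > 0" and n: "n \<ge> 1" and wn: "2 * real n = pi * w * exp w"
  shows "fact n / fact (2 * n) * (2 * (2 * pi\<^sup>2 * (laplace_prefactor (5/4) n w * sqrt (2 * pi)))) / 4 ^ n =
    4 * pi\<^sup>2 * exp (7 * w / 4) * sqrt (w / (w + 1)) * (exp 1 * w\<^sup>2 / (16 * real n * exp (2 / w))) ^ n
      * (stirling_ratio n / stirling_ratio (2 * n))"
proof -
  have n0: "real n > 0" using n by simp
  have f: "fact m = stirling_ratio m * (sqrt (2 * pi * real m) * (real m / exp 1) ^ m)" if "m > 0" for m
  proof -
    have "Gamma (real m + 1) = fact m" using Gamma_fact[of m, where 'a = real] by (simp add: add.commute)
    then show ?thesis using that by (simp add: stirling_ratio_def)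
  qed
  have S2: "stirling_ratio (2 * n) > 0" using n by (intro stirling_ratio_pos) auto
  define \<sigma> where "\<sigma> = sqrt (w\<^sup>2 / (2 * real n * (w + 1)))"
  have A: "(real n / exp 1) ^ n / (real (2 * n) / exp 1) ^ (2 * n) * (w ^ (2 * n) * exp (- (2 * real n / w))) / 4 ^ n =
     (exp 1 * w\<^sup>2 / (16 * real n * exp (2 / w))) ^ n"
  proof -
    have "exp (- (2 * real n / w)) = exp (- (2 / w)) ^ n" by (simp flip: exp_of_nat_mult)
    then have "(real n / exp 1) ^ n / (real (2 * n) / exp 1) ^ (2 * n) * (w ^ (2 * n) * exp (- (2 * real n / w))) / 4 ^ n =
      ((real n / exp 1) / (real (2 * n) / exp 1)\<^sup>2 * (w\<^sup>2 * exp (- (2 / w))) / 4) ^ n"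
      by (simp only: power_mult power_divide power_mult_distrib)
    also have "(real n / exp 1) / (real (2 * n) / exp 1)\<^sup>2 * (w\<^sup>2 * exp (- (2 / w))) / 4 = exp 1 * w\<^sup>2 / (16 * real n * exp (2 / w))"
    proof -
      have "(N / E) / (2 * N / E)\<^sup>2 * (W * inverse F) / 4 = E * W / (16 * N * F)" if "N > 0" "E > 0" "F > 0" for N E W F :: real
        using that by (simp add: divide_simps power2_eq_square)
      from this[of "real n" "exp 1" "exp (2 / w)" "w\<^sup>2"] show ?thesis using n0 by (simp add: exp_minus)
    qed
    finally show ?thesis .
  qed
  have B: "sqrt (2 * pi * real n) / sqrt (2 * pi * real (2 * n)) * exp ((5/4 + 1) * w) * \<sigma> * sqrt (2 * pi) =
     exp (7 * w / 4) * sqrt (w / (w + 1))"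
  proof -
    have "sqrt (2 * pi * real n) / sqrt (2 * pi * real (2 * n)) * \<sigma> * sqrt (2 * pi) =
      sqrt ((2 * pi * real n) / (2 * pi * real (2 * n)) * (w\<^sup>2 / (2 * real n * (w + 1))) * (2 * pi))"
      unfolding \<sigma>_def by (simp only: real_sqrt_mult real_sqrt_divide)
    also have "(2 * pi * real n) / (2 * pi * real (2 * n)) * (w\<^sup>2 / (2 * real n * (w + 1))) * (2 * pi) = (exp (- w / 2))\<^sup>2 * (w / (w + 1))"
    proof -
      have "(2 * pi * real n) / (2 * pi * real (2 * n)) * (w\<^sup>2 / (2 * real n * (w + 1))) * (2 * pi) = pi * w\<^sup>2 / (2 * real n * (w + 1))"
        using n0 by simp
      also have "\<dots> = w / (exp w * (w + 1))" unfolding wn using w by (simp add: power2_eq_square)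
      also have "\<dots> = exp (- w) * (w / (w + 1))" by (simp add: exp_minus inverse_eq_divide)
      also have "exp (- w) = (exp (- w / 2))\<^sup>2" by (simp flip: exp_double)
      finally show ?thesis .
    qed
    also have "sqrt ((exp (- w / 2))\<^sup>2 * (w / (w + 1))) = exp (- w / 2) * sqrt (w / (w + 1))"
      by (simp only: real_sqrt_mult real_sqrt_abs abs_exp_cancel)
    finally have 1: "sqrt (2 * pi * real n) / sqrt (2 * pi * real (2 * n)) * \<sigma> * sqrt (2 * pi) = exp (- w / 2) * sqrt (w / (w + 1))" .
    have E: "exp ((5/4 + 1) * w) * exp (- w / 2) = exp (7 * w / 4)" unfolding exp_add[symmetric] by (rule arg_cong[where f = exp]) (simp add: field_simps)
    have assoc: "a / b * E * s * q = E * (a / b * s * q)" for a b E s q :: real by simp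
    show ?thesis unfolding assoc 1 mult.assoc[symmetric] E ..
  qed
  have e: "(S * (a * p)) / (S' * (b * p')) * (2 * (2 * P * (E * W * X * s * q))) / F = 4 * P * (a / b * E * s * q) * (p / p' * (W * X) / F) * (S / S')"
    for S a p S' b p' P E W X s q F :: real by (simp add: mult_ac)
  have "fact n / fact (2 * n) * (2 * (2 * pi\<^sup>2 * (laplace_prefactor (5/4) n w * sqrt (2 * pi)))) / 4 ^ n =
    (stirling_ratio n * (sqrt (2 * pi * real n) * (real n / exp 1) ^ n)) / (stirling_ratio (2 * n) * (sqrt (2 * pi * real (2 * n)) * (real (2 * n) / exp 1) ^ (2 * n)))
      * (2 * (2 * pi\<^sup>2 * (exp ((5/4 + 1) * w) * w ^ (2 * n) * exp (- (2 * real n / w)) * \<sigma> * sqrt (2 * pi)))) / 4 ^ n"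
    using n by (simp add: f laplace_prefactor_def \<sigma>_def)
  also have "\<dots> = 4 * pi\<^sup>2 * (exp (7 * w / 4) * sqrt (w / (w + 1))) * (exp 1 * w\<^sup>2 / (16 * real n * exp (2 / w))) ^ n * (stirling_ratio n / stirling_ratio (2 * n))"
    unfolding e A B ..
  finally show ?thesis by (simp only: mult.assoc)
qed

theorem theorem1p4:
  defines "w \<equiv> \<lambda>n::nat. Lambert_W (2 * real n / pi)"
  shows "(\<forall>K\<ge>1. \<exists>E :: nat \<Rightarrow> real.
           E \<in> O(\<lambda>n. ln (real n) ^ K / real n ^ K) \<and>
           (\<forall>n\<ge>1. gamma_coeff n = complex_of_real
              (4 * pi\<^sup>2 * exp (7 * w n / 4) * sqrt (w n / (w n + 1))
               * (exp 1 * (w n)\<^sup>2 / (16 * real n * exp (2 / w n))) ^ n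
               * (1 + (\<Sum>k=1..K-1. c_coeff k (w n) / real n ^ k) + E n))))
       \<and> (\<forall>k. (\<exists>P Q :: real poly. \<forall>x>0. poly Q x \<noteq> 0 \<and> c_coeff k x = poly P x / poly Q x)
            \<and> (\<lambda>n. c_coeff k (w n)) \<in> O(\<lambda>n. ln (real n) ^ k))"
proof (intro conjI allI impI)
  fix k
  show "\<exists>P Q :: real poly. \<forall>x>0. poly Q x \<noteq> 0 \<and> c_coeff k x = poly P x / poly Q x"
    using rational_c_coeff[of k] unfolding rational_on_pos_def .
  show "(\<lambda>n. c_coeff k (w n)) \<in> O(\<lambda>n. ln (real n) ^ k)"
    unfolding w_def by (rule landau_o.big_trans[OF power_bounded_bigo[OF power_bounded_c_coeff] w_power_bigo_ln])
next
  fix K :: nat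
  assume K: "1 \<le> K"
  then obtain K' where K': "K = Suc K'" by (cases K) auto
  define P where "P = (\<lambda>n. 4 * pi\<^sup>2 * exp (7 * w n / 4) * sqrt (w n / (w n + 1))
               * (exp 1 * (w n)\<^sup>2 / (16 * real n * exp (2 / w n))) ^ n)"
  define G where "G = (\<lambda>n. xi_moment (2 * n) / (2 * pi\<^sup>2 * (laplace_prefactor (5/4) n (w n) * sqrt (2 * pi))))"
  define S where "S = (\<lambda>n. stirling_ratio n / stirling_ratio (2 * n))"
  \<comment> \<open>Taking \<open>E\<close> as the difference makes the formula exact for all n
    \<ge> 1; only the size of \<open>E\<close> is an asymptotic statement.\<close>
  define E where "E = (\<lambda>n. G n * S n - (\<Sum>k<K. c_coeff k (w n) / real n ^ k))"
  have c0: "c_coeff 0 v = 1" for v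
    by (simp add: c_coeff_def mu_coeff_def kappa_star_def stirling_kappa_0 a_coeff_def odd_dfact_def ord_bell_def)
  have wp: "w n > 0" if "n \<ge> 1" for n unfolding w_def by (rule w_pos[OF that])
  have formula: "gamma_coeff n = complex_of_real (P n * (G n * S n))" if n: "n \<ge> 1" for n
  proof -
    have wn: "2 * real n = pi * w n * exp (w n)" unfolding w_def by (rule w_eq)
    define Q where "Q = laplace_prefactor (5/4) n (w n) * sqrt (2 * pi)"
    have Q: "Q > 0" unfolding Q_def laplace_prefactor_def using wp[OF n] n by simp
    have "P n * (G n * S n) = (P n * S n) * G n" by simp
    also have "P n * S n = fact n / fact (2 * n) * (2 * (2 * pi\<^sup>2 * Q)) / 4 ^ n"
      unfolding Q_def fact_ratio_prefactor[OF wp[OF n] n wn] P_def S_def ..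
    also have "\<dots> * G n = fact n / fact (2 * n) * (2 * xi_moment (2 * n) / 4 ^ n)"
      unfolding G_def Q_def[symmetric] using Q by simp
    finally show ?thesis unfolding gamma_coeff_eq by (simp only:)
  qed
  have "E \<in> O(\<lambda>n. (w n / real n) ^ K)"
  proof -
    define X where "X = (\<lambda>k n. mu_coeff k (w n) / real n ^ k)"
    define Y where "Y = (\<lambda>k n. kappa_star k / real n ^ k)"
    \<comment> \<open>Stirling's series runs in powers of 1 / n, Laplace's in powers of w / n. As w
      \<ge> 1 eventually, the coarser scale w / n serves both, and w \<le> ln n turns it into the
      stated error.\<close>
    have inv: "(\<lambda>n. 1 / real n ^ k) \<in> O(\<lambda>n. (w n / real n) ^ k)" for k
    proof (rule bigoI)
      show "eventually (\<lambda>n. norm (1 / real n ^ k) \<le> 1 * norm ((w n / real n) ^ k)) sequentially"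
      proof -
        have "eventually (\<lambda>n. 1 \<le> w n) sequentially" unfolding w_def by (rule w_ge)
        then show ?thesis by eventually_elim (auto simp: power_divide one_le_power intro!: divide_right_mono)
      qed
    qed
    have "(\<lambda>n. G n * S n - (\<Sum>k<K. \<Sum>j=0..k. X j n * Y (k - j) n)) \<in> O(\<lambda>n. (w n / real n) ^ K)"
    proof (rule asymptotic_product)
      show "eventually (\<lambda>n. 0 < w n / real n \<and> w n / real n \<le> 1) sequentially"
        unfolding w_def by (rule w_over_n_le_1)
      show "X k \<in> O(\<lambda>n. (w n / real n) ^ k)" for k
        unfolding X_def w_def power_divide
        by (intro landau_o.big.divide_right power_bounded_bigo power_bounded_mu_coeff) (auto intro!: eventually_mono[OF eventually_gt_at_top[of 0]])
      show "Y k \<in> O(\<lambda>n. (w n / real n) ^ k)" for k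
      proof -
        have "(\<lambda>n. kappa_star k * (1 / real n ^ k)) \<in> O(\<lambda>n. (w n / real n) ^ k)"
          using landau_o.big.mult[OF _ inv, of "\<lambda>_. kappa_star k" "\<lambda>_. 1" k] by simp
        then show ?thesis by (simp add: Y_def)
      qed
      show "(\<lambda>n. G n - (\<Sum>k<K. X k n)) \<in> O(\<lambda>n. (w n / real n) ^ K)"
        unfolding G_def X_def K' w_def by (rule xi_moment_expansion)
      show "(\<lambda>n. S n - (\<Sum>k<K. Y k n)) \<in> O(\<lambda>n. (w n / real n) ^ K)"
        unfolding S_def Y_def by (rule landau_o.big_trans[OF stirling_quotient_expansion inv])
    qed
    moreover have "(\<Sum>j=0..k. X j n * Y (k - j) n) = c_coeff k (w n) / real n ^ k" for k n
      unfolding c_coeff_def sum_divide_distrib X_def Y_def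
      by (intro sum.cong refl) (simp flip: power_add)
    ultimately show ?thesis by (simp only: E_def)
  qed
  also have "(\<lambda>n. (w n / real n) ^ K) \<in> O(\<lambda>n. ln (real n) ^ K / real n ^ K)"
    unfolding power_divide w_def
    by (intro landau_o.big.divide_right w_power_bigo_ln) (auto intro!: eventually_mono[OF eventually_gt_at_top[of 0]])
  finally have Eo: "E \<in> O(\<lambda>n. ln (real n) ^ K / real n ^ K)" .
  have sum: "(\<Sum>k<K. c_coeff k (w n) / real n ^ k) = 1 + (\<Sum>k=1..K-1. c_coeff k (w n) / real n ^ k)" for n
  proof -
    have "{..<K} = insert 0 {1..K-1}" using K by auto
    then show ?thesis by (simp add: c0)
  qed
  show "\<exists>E. E \<in> O(\<lambda>n. ln (real n) ^ K / real n ^ K) \<and>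
           (\<forall>n\<ge>1. gamma_coeff n = complex_of_real
              (4 * pi\<^sup>2 * exp (7 * w n / 4) * sqrt (w n / (w n + 1))
               * (exp 1 * (w n)\<^sup>2 / (16 * real n * exp (2 / w n))) ^ n
               * (1 + (\<Sum>k=1..K-1. c_coeff k (w n) / real n ^ k) + E n)))"
  proof (intro exI[of _ E] conjI Eo allI impI)
    fix n :: nat assume n: "1 \<le> n"
    show "gamma_coeff n = complex_of_real
              (4 * pi\<^sup>2 * exp (7 * w n / 4) * sqrt (w n / (w n + 1))
               * (exp 1 * (w n)\<^sup>2 / (16 * real n * exp (2 / w n))) ^ n
               * (1 + (\<Sum>k=1..K-1. c_coeff k (w n) / real n ^ k) + E n))"
      unfolding formula[OF n] P_def[symmetric] sum[symmetric] by (simp add: E_def P_def)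
  qed
qed

end
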